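(* Let $\mathcal A,\mathcal B$ be unital C*-algebras and let $s\in\mathcal S(\mathcal A\otimes\mathcal B)$ be a catalyst state that can embezzle every state of the form $|\psi\rangle=x_0|00\rangle+\cdots+x_n|nn\rangle$ with $x_0,\dots,x_n\in\mathbb Q^+$ (all $n$). Then $s$ must locally contain countably infinitely many copies of all states $|\psi\rangle$ with rational Schmidt coefficients simultaneously. That is, if $\{|\psi_i\rangle\}_{i\in\mathbb N}$ is an enumeration of the countable set of all such states and $g_i$ is the state corresponding to $|\psi_i\rangle$, then $s$ locally contains the state $\bigotimes_{i\in\mathbb N} g_i^{\otimes\infty}$.
   Context: $\mathcal S(\cdot)$ denotes the set of states of a C*-algebra. Tensor products between Alice's and Bob's algebras are maximal; tensor products between algebras on the same party's side are minimal, and infinite tensor products are C*-inductive limits of finite minimal tensor products. $\mathbb Q^+$ is the set of positive rationals; $|\psi\rangle=\sum_{j=0}^n x_j|jj\rangle\in\mathbb C^{n+1}\otimes\mathbb C^{n+1}$ is a unit vector ($\sum_j x_j^2=1$). For the vector $|\psi_i\rangle\in\mathbb C^{n_i+1}\otimes\mathbb C^{n_i+1}$ put $\mathcal C_i=\mathcal D_i=M_{n_i+1}(\mathbb C)$ and let $g_i\in\mathcal S(\mathcal C_i\otimes\mathcal D_i)$ be $g_i(x)=\langle\psi_i|x|\psi_i\rangle$. Embezzlement: $s\in\mathcal S(\mathcal A\otimes\mathcal B)$ can embezzle a state $g\in\mathcal S(\mathcal C\otimes\mathcal D)$ if there are *-isomorphisms $\Phi_A:\mathcal A\otimes\mathcal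 C\to\mathcal A$ and $\Phi_B:\mathcal B\otimes\mathcal D\to\mathcal B$ with $s\circ(\Phi_A\otimes\Phi_B)=s\otimes g$ (up to re-ordering of tensor factors), i.e. $s(\Phi_A(a\otimes c)\otimes\Phi_B(b\otimes d))=s(a\otimes b)\,g(c\otimes d)$ for all $a\in\mathcal A$, $b\in\mathcal B$, $c\in\mathcal C$, $d\in\mathcal D$. Local containment: $f\in\mathcal S(\mathcal F_A\otimes\mathcal F_B)$ locally contains $g\in\mathcal S(\mathcal G_A\otimes\mathcal G_B)$ if there are *-monomorphisms $\pi_A:\mathcal G_A\to\mathcal F_A$ and $\pi_B:\mathcal G_B\to\mathcal F_B$ with $f\circ(\pi_A\otimes\pi_B)(G)=g(G)$ for all $G\in\mathcal G_A\otimes\mathcal G_B$. The state $\bigotimes_{i}g_i^{\otimes\infty}$ is the product state on $\mathcal G_A\otimes\mathcal G_B$, where $\mathcal G_A=\bigotimes_{(i,k)\in\mathbb N\times\mathbb N}\mathcal C_i^{(k)}$, $\mathcal G_B=\bigotimes_{(i,k)\in\mathbb N\times\mathbb N}\mathcal D_i^{(k)}$ ($\mathcal C_i^{(k)},\mathcal D_i^{(k)}$ being copies of $\mathcal C_i,\mathcal D_i$), determined by $\big(\bigotimes_{(i,k)}c_{i,k}\big)\otimes\big(\bigotimes_{(i,k)}d_{i,k}\big)\mapsto\prod_{(i,k)}g_i(c_{i,k}\otimes d_{i,k})$ on elementary tensors with all but finitely many factors equal to $1$. *)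

theory Defs
  imports
    "HOL-Analysis.L2_Norm"
    "HOL-Algebra.Algebraic_Closure_Type"
    "Jordan_Normal_Form.Schur_Decomposition"
begin

section \<open>Unital C*-algebras\<close>

record 'a star_algebra = "(complex, 'a) module" +
  star :: "'a \<Rightarrow> 'a"

record 'a normed_star_algebra = "'a star_algebra" +
  nrm :: "'a \<Rightarrow> real"

definition cstar_seminorm :: "('a, 'm) star_algebra_scheme \<Rightarrow> ('a \<Rightarrow> real) \<Rightarrow> bool" where
  "cstar_seminorm A p \<longleftrightarrow>
     (\<forall>x\<in>carrier A. 0 \<le> p x) \<and>
     (\<forall>x\<in>carrier A. \<forall>y\<in>carrier A. p (x \<oplus>\<^bsub>A\<^esub> y) \<le> p x + p y) \<and>
     (\<forall>c. \<forall>x\<in>carrier A. p (c \<odot>\<^bsub>A\<^esub> x) = cmod c * p x) \<and>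
     (\<forall>x\<in>carrier A. \<forall>y\<in>carrier A. p (x \<otimes>\<^bsub>A\<^esub> y) \<le> p x * p y) \<and>
     (\<forall>x\<in>carrier A. p (star A x \<otimes>\<^bsub>A\<^esub> x) = (p x)\<^sup>2)"

definition cauchy_seqs :: "'a normed_star_algebra \<Rightarrow> (nat \<Rightarrow> 'a) set" where
  "cauchy_seqs A = {x. (\<forall>n. x n \<in> carrier A) \<and>
     (\<forall>e>0. \<exists>N. \<forall>m\<ge>N. \<forall>n\<ge>N. nrm A (x m \<ominus>\<^bsub>A\<^esub> x n) < e)}"

locale cstar_algebra =
  ring A + scalar: module "ring_of_type_algebra :: complex ring" A
  for A :: "'a normed_star_algebra" (structure) +
  assumes smult_mult_left: "\<lbrakk>x \<in> carrier A; y \<in> carrier A\<rbrakk> \<Longrightarrow> (c \<odot> x) \<otimes> y = c \<odot> (x \<otimes> y)"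
    and smult_mult_right: "\<lbrakk>x \<in> carrier A; y \<in> carrier A\<rbrakk> \<Longrightarrow> x \<otimes> (c \<odot> y) = c \<odot> (x \<otimes> y)"
    and star_closed: "x \<in> carrier A \<Longrightarrow> star A x \<in> carrier A"
    and star_star: "x \<in> carrier A \<Longrightarrow> star A (star A x) = x"
    and star_add: "\<lbrakk>x \<in> carrier A; y \<in> carrier A\<rbrakk> \<Longrightarrow> star A (x \<oplus> y) = star A x \<oplus> star A y"
    and star_smult: "x \<in> carrier A \<Longrightarrow> star A (c \<odot> x) = cnj c \<odot> star A x"
    and star_mult: "\<lbrakk>x \<in> carrier A; y \<in> carrier A\<rbrakk> \<Longrightarrow> star A (x \<otimes> y) = star A y \<otimes> star A x"
    and cstar_norm: "cstar_seminorm A (nrm A)"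
    and norm_definite: "\<lbrakk>x \<in> carrier A; nrm A x = 0\<rbrakk> \<Longrightarrow> x = \<zero>"
    and norm_complete: "s \<in> cauchy_seqs A \<Longrightarrow>
      \<exists>x\<in>carrier A. (\<lambda>n. nrm A (s n \<ominus> x)) \<longlonglongrightarrow> 0"

definition linear_functional :: "(complex, 'a, 'm) module_scheme \<Rightarrow> ('a \<Rightarrow> complex) \<Rightarrow> bool" where
  "linear_functional A \<phi> \<longleftrightarrow>
     (\<forall>x\<in>carrier A. \<forall>y\<in>carrier A. \<phi> (x \<oplus>\<^bsub>A\<^esub> y) = \<phi> x + \<phi> y) \<and>
     (\<forall>c. \<forall>x\<in>carrier A. \<phi> (c \<odot>\<^bsub>A\<^esub> x) = c * \<phi> x)"

text \<open>Positive linear functionals of norm one; the last two conditions say that the norm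
  of the functional is one and is attained at the unit. States are extensional functions, so that
  a state is determined by its values on the algebra.\<close>

definition states :: "'a normed_star_algebra \<Rightarrow> ('a \<Rightarrow> complex) set" where
  "states A = {\<phi> \<in> extensional (carrier A). linear_functional A \<phi> \<and>
     (\<forall>x\<in>carrier A. Im (\<phi> (star A x \<otimes>\<^bsub>A\<^esub> x)) = 0 \<and> 0 \<le> Re (\<phi> (star A x \<otimes>\<^bsub>A\<^esub> x))) \<and>
     \<phi> \<one>\<^bsub>A\<^esub> = 1 \<and> (\<forall>x\<in>carrier A. cmod (\<phi> x) \<le> nrm A x)}"

text \<open>Homomorphisms are unital, as \<^const>\<open>Ring.ring_hom\<close> includes preservation of the unit.\<close>

definition star_hom :: "'a normed_star_algebra \<Rightarrow> 'b normed_star_algebra \<Rightarrow> ('a \<Rightarrow> 'b) \<Rightarrow> bool" where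
  "star_hom A B h \<longleftrightarrow> h \<in> Ring.ring_hom A B \<and>
     (\<forall>c. \<forall>x\<in>carrier A. h (c \<odot>\<^bsub>A\<^esub> x) = c \<odot>\<^bsub>B\<^esub> h x) \<and>
     (\<forall>x\<in>carrier A. h (star A x) = star B (h x))"

definition star_mono :: "'a normed_star_algebra \<Rightarrow> 'b normed_star_algebra \<Rightarrow> ('a \<Rightarrow> 'b) \<Rightarrow> bool" where
  "star_mono A B h \<longleftrightarrow> star_hom A B h \<and> inj_on h (carrier A)"

definition star_iso :: "'a normed_star_algebra \<Rightarrow> 'b normed_star_algebra \<Rightarrow> ('a \<Rightarrow> 'b) \<Rightarrow> bool" where
  "star_iso A B h \<longleftrightarrow> star_hom A B h \<and> bij_betw h (carrier A) (carrier B)"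


section \<open>Completion\<close>

text \<open>Cauchy sequences modulo null sequences.\<close>

definition completion_class :: "'a normed_star_algebra \<Rightarrow> (nat \<Rightarrow> 'a) \<Rightarrow> (nat \<Rightarrow> 'a) set" where
  "completion_class A x = {y \<in> cauchy_seqs A. (\<lambda>n. nrm A (x n \<ominus>\<^bsub>A\<^esub> y n)) \<longlonglongrightarrow> 0}"

definition completion_rep :: "(nat \<Rightarrow> 'a) set \<Rightarrow> nat \<Rightarrow> 'a" where
  "completion_rep U = (SOME x. x \<in> U)"

definition completion :: "'a normed_star_algebra \<Rightarrow> (nat \<Rightarrow> 'a) set normed_star_algebra" where
  "completion A =
    \<lparr> carrier = completion_class A ` cauchy_seqs A,
      monoid.mult = (\<lambda>U V. completion_class A (\<lambda>n. completion_rep U n \<otimes>\<^bsub>A\<^esub> completion_rep V n)),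
      one = completion_class A (\<lambda>_. \<one>\<^bsub>A\<^esub>),
      zero = completion_class A (\<lambda>_. \<zero>\<^bsub>A\<^esub>),
      add = (\<lambda>U V. completion_class A (\<lambda>n. completion_rep U n \<oplus>\<^bsub>A\<^esub> completion_rep V n)),
      module.smult = (\<lambda>c U. completion_class A (\<lambda>n. c \<odot>\<^bsub>A\<^esub> completion_rep U n)),
      star = (\<lambda>U. completion_class A (\<lambda>n. star A (completion_rep U n))),
      nrm = (\<lambda>U. lim (\<lambda>n. nrm A (completion_rep U n))) \<rparr>"

definition to_completion :: "'a normed_star_algebra \<Rightarrow> 'a \<Rightarrow> (nat \<Rightarrow> 'a) set" where
  "to_completion A x = completion_class A (\<lambda>_. x)"

definition with_norm :: "'a star_algebra \<Rightarrow> ('a \<Rightarrow> real) \<Rightarrow> 'a normed_star_algebra" where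
  "with_norm A p = star_algebra.extend A \<lparr> nrm = p \<rparr>"


section \<open>Tensor products of two algebras\<close>

text \<open>The algebraic tensor product is realised in the dual of the space of bilinear forms: the
  elementary tensor of \<open>a\<close> and \<open>b\<close> is evaluation of bilinear forms at \<open>(a, b)\<close>.\<close>

definition bilinear_forms ::
    "'a normed_star_algebra \<Rightarrow> 'b normed_star_algebra \<Rightarrow> ('a \<Rightarrow> 'b \<Rightarrow> complex) set" where
  "bilinear_forms A B = {\<beta>. (\<forall>a\<in>carrier A. linear_functional B (\<beta> a)) \<and>
     (\<forall>b\<in>carrier B. linear_functional A (\<lambda>a. \<beta> a b))}"

definition pure_tensor ::
    "'a normed_star_algebra \<Rightarrow> 'b normed_star_algebra \<Rightarrow> 'a \<Rightarrow> 'b \<Rightarrow> ('a \<Rightarrow> 'b \<Rightarrow> complex) \<Rightarrow> complex" where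
  "pure_tensor A B a b = (\<lambda>\<beta>. if \<beta> \<in> bilinear_forms A B then \<beta> a b else 0)"

definition fun_span :: "('f \<Rightarrow> complex) set \<Rightarrow> ('f \<Rightarrow> complex) set" where
  "fun_span S = {(\<lambda>\<beta>. \<Sum>k<n. c k * v k \<beta>) | (n::nat) c v. \<forall>k<n. v k \<in> S}"

text \<open>Multiplication and involution are the (sesqui)linear extensions of
  \<open>(a \<otimes> b)(a' \<otimes> b') = aa' \<otimes> bb'\<close> and \<open>(a \<otimes> b)* = a* \<otimes> b*\<close>; see
  \<open>alg_tensor_mult_pure\<close> and \<open>alg_tensor_star_pure\<close> below.\<close>

definition alg_tensor ::
    "'a normed_star_algebra \<Rightarrow> 'b normed_star_algebra \<Rightarrow> (('a \<Rightarrow> 'b \<Rightarrow> complex) \<Rightarrow> complex) star_algebra" where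
  "alg_tensor A B =
    \<lparr> carrier = fun_span {pure_tensor A B a b | a b. a \<in> carrier A \<and> b \<in> carrier B},
      monoid.mult = (\<lambda>x y \<beta>. if \<beta> \<in> bilinear_forms A B
        then x (\<lambda>a b. y (\<lambda>a' b'. \<beta> (a \<otimes>\<^bsub>A\<^esub> a') (b \<otimes>\<^bsub>B\<^esub> b'))) else 0),
      one = pure_tensor A B \<one>\<^bsub>A\<^esub> \<one>\<^bsub>B\<^esub>,
      zero = (\<lambda>_. 0),
      add = (\<lambda>x y \<beta>. x \<beta> + y \<beta>),
      module.smult = (\<lambda>c x \<beta>. c * x \<beta>),
      star = (\<lambda>x \<beta>. if \<beta> \<in> bilinear_forms A B
        then cnj (x (\<lambda>a b. cnj (\<beta> (star A a) (star B b)))) else 0) \<rparr>"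

definition max_norm ::
    "'a normed_star_algebra \<Rightarrow> 'b normed_star_algebra \<Rightarrow> (('a \<Rightarrow> 'b \<Rightarrow> complex) \<Rightarrow> complex) \<Rightarrow> real" where
  "max_norm A B x = (SUP p\<in>{p. cstar_seminorm (alg_tensor A B) p}. p x)"

text \<open>For a set \<open>\<Omega>\<close> of positive functionals, the operator norm of \<open>x\<close> in the direct sum of the GNS
  representations of the \<open>\<omega> \<in> \<Omega>\<close>, the vectors of which are the classes of the \<open>y \<in> Y\<close>. Inserting
  0 only matters when there is no unit vector at all.\<close>

definition gns_norm ::
    "('a, 'm) star_algebra_scheme \<Rightarrow> ('a \<Rightarrow> complex) set \<Rightarrow> 'a set \<Rightarrow> 'a \<Rightarrow> real" where
  "gns_norm T \<Omega> Y x = Sup (insert 0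
     {sqrt (Re (\<omega> (star T (x \<otimes>\<^bsub>T\<^esub> y) \<otimes>\<^bsub>T\<^esub> (x \<otimes>\<^bsub>T\<^esub> y)))) | \<omega> y.
        \<omega> \<in> \<Omega> \<and> y \<in> Y \<and> \<omega> (star T y \<otimes>\<^bsub>T\<^esub> y) = 1})"

text \<open>The minimal norm is the spatial norm. The direct sum of all GNS representations of an algebra is
  faithful, and the GNS representation of a product state is the tensor product of the GNS
  representations of its factors.\<close>

definition product_functional ::
    "('a \<Rightarrow> complex) \<Rightarrow> ('b \<Rightarrow> complex) \<Rightarrow> (('a \<Rightarrow> 'b \<Rightarrow> complex) \<Rightarrow> complex) \<Rightarrow> complex" where
  "product_functional \<phi> \<psi> z = z (\<lambda>a b. \<phi> a * \<psi> b)"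

definition min_norm ::
    "'a normed_star_algebra \<Rightarrow> 'b normed_star_algebra \<Rightarrow> (('a \<Rightarrow> 'b \<Rightarrow> complex) \<Rightarrow> complex) \<Rightarrow> real" where
  "min_norm A B = gns_norm (alg_tensor A B)
     {product_functional \<phi> \<psi> | \<phi> \<psi>. \<phi> \<in> states A \<and> \<psi> \<in> states B} (carrier (alg_tensor A B))"

type_synonym ('a, 'b) tensor = "(nat \<Rightarrow> (('a \<Rightarrow> 'b \<Rightarrow> complex) \<Rightarrow> complex)) set"

definition max_tensor ::
    "'a normed_star_algebra \<Rightarrow> 'b normed_star_algebra \<Rightarrow> ('a, 'b) tensor normed_star_algebra" where
  "max_tensor A B = completion (with_norm (alg_tensor A B) (max_norm A B))"

definition min_tensor ::
    "'a normed_star_algebra \<Rightarrow> 'b normed_star_algebra \<Rightarrow> ('a, 'b) tensor normed_star_algebra" where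
  "min_tensor A B = completion (with_norm (alg_tensor A B) (min_norm A B))"

definition max_pure ::
    "'a normed_star_algebra \<Rightarrow> 'b normed_star_algebra \<Rightarrow> 'a \<Rightarrow> 'b \<Rightarrow> ('a, 'b) tensor" where
  "max_pure A B a b =
     to_completion (with_norm (alg_tensor A B) (max_norm A B)) (pure_tensor A B a b)"

definition min_pure ::
    "'a normed_star_algebra \<Rightarrow> 'b normed_star_algebra \<Rightarrow> 'a \<Rightarrow> 'b \<Rightarrow> ('a, 'b) tensor" where
  "min_pure A B a b =
     to_completion (with_norm (alg_tensor A B) (min_norm A B)) (pure_tensor A B a b)"


section \<open>Infinite tensor products\<close>

text \<open>The algebraic direct limit of the tensor products over finite \<open>F \<subseteq> J\<close>, along the maps
  \<open>x \<mapsto> x \<otimes> 1\<close>, is spanned by elementary tensors with all but finitely many factors equal to 1.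
  As for two factors, these are evaluations of forms that are linear in every coordinate. The
  finite tensor product over \<open>F\<close> is the subalgebra \<open>tensor_stage J C F\<close>, and the connecting maps are
  inclusions.\<close>

definition restr_prod :: "'j set \<Rightarrow> ('j \<Rightarrow> 'c normed_star_algebra) \<Rightarrow> ('j \<Rightarrow> 'c) set" where
  "restr_prod J C = {c \<in> (\<Pi>\<^sub>E j\<in>J. carrier (C j)). finite {j\<in>J. c j \<noteq> \<one>\<^bsub>C j\<^esub>}}"

definition multilinear_forms ::
    "'j set \<Rightarrow> ('j \<Rightarrow> 'c normed_star_algebra) \<Rightarrow> (('j \<Rightarrow> 'c) \<Rightarrow> complex) set" where
  "multilinear_forms J C = {\<beta>. \<forall>c\<in>restr_prod J C. \<forall>j\<in>J. linear_functional (C j) (\<lambda>v. \<beta> (c(j := v)))}"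

definition pure_inf_tensor ::
    "'j set \<Rightarrow> ('j \<Rightarrow> 'c normed_star_algebra) \<Rightarrow> ('j \<Rightarrow> 'c) \<Rightarrow> (('j \<Rightarrow> 'c) \<Rightarrow> complex) \<Rightarrow> complex" where
  "pure_inf_tensor J C c = (\<lambda>\<beta>. if \<beta> \<in> multilinear_forms J C then \<beta> c else 0)"

definition alg_inf_tensor ::
    "'j set \<Rightarrow> ('j \<Rightarrow> 'c normed_star_algebra) \<Rightarrow> ((('j \<Rightarrow> 'c) \<Rightarrow> complex) \<Rightarrow> complex) star_algebra" where
  "alg_inf_tensor J C =
    \<lparr> carrier = fun_span (pure_inf_tensor J C ` restr_prod J C),
      monoid.mult = (\<lambda>x y \<beta>. if \<beta> \<in> multilinear_forms J C
        then x (\<lambda>c. y (\<lambda>c'. \<beta> (\<lambda>j\<in>J. c j \<otimes>\<^bsub>C j\<^esub> c' j))) else 0),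
      one = pure_inf_tensor J C (\<lambda>j\<in>J. \<one>\<^bsub>C j\<^esub>),
      zero = (\<lambda>_. 0),
      add = (\<lambda>x y \<beta>. x \<beta> + y \<beta>),
      module.smult = (\<lambda>a x \<beta>. a * x \<beta>),
      star = (\<lambda>x \<beta>. if \<beta> \<in> multilinear_forms J C
        then cnj (x (\<lambda>c. cnj (\<beta> (\<lambda>j\<in>J. star (C j) (c j))))) else 0) \<rparr>"

definition tensor_stage ::
    "'j set \<Rightarrow> ('j \<Rightarrow> 'c normed_star_algebra) \<Rightarrow> 'j set \<Rightarrow> ((('j \<Rightarrow> 'c) \<Rightarrow> complex) \<Rightarrow> complex) set" where
  "tensor_stage J C F =
     fun_span (pure_inf_tensor J C ` {c \<in> restr_prod J C. \<forall>j\<in>J - F. c j = \<one>\<^bsub>C j\<^esub>})"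

text \<open>The product over the support of \<open>c\<close> is the product over all of \<open>J\<close>, since states are 1 at
  the unit.\<close>

definition product_inf_functional ::
    "'j set \<Rightarrow> ('j \<Rightarrow> 'c normed_star_algebra) \<Rightarrow> ('j \<Rightarrow> 'c \<Rightarrow> complex) \<Rightarrow>
      ((('j \<Rightarrow> 'c) \<Rightarrow> complex) \<Rightarrow> complex) \<Rightarrow> complex" where
  "product_inf_functional J C \<phi> z = z (\<lambda>c. \<Prod>j\<in>{j\<in>J. c j \<noteq> \<one>\<^bsub>C j\<^esub>}. \<phi> j (c j))"

text \<open>The minimal (spatial) norm of the finite tensor product over \<open>F\<close>; on it the factors
  \<open>\<phi> j\<close> with \<open>j\<close> outside \<open>F\<close> play no role.\<close>

definition stage_min_norm ::
    "'j set \<Rightarrow> ('j \<Rightarrow> 'c normed_star_algebra) \<Rightarrow> 'j set \<Rightarrow>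
      ((('j \<Rightarrow> 'c) \<Rightarrow> complex) \<Rightarrow> complex) \<Rightarrow> real" where
  "stage_min_norm J C F = gns_norm (alg_inf_tensor J C)
     {product_inf_functional J C \<phi> | \<phi>. \<phi> \<in> (\<Pi>\<^sub>E j\<in>J. states (C j))} (tensor_stage J C F)"

text \<open>The norm of a C*-inductive limit: the infimum (that is, the limit) of the norms in the stages.\<close>

definition inf_tensor_norm ::
    "'j set \<Rightarrow> ('j \<Rightarrow> 'c normed_star_algebra) \<Rightarrow> ((('j \<Rightarrow> 'c) \<Rightarrow> complex) \<Rightarrow> complex) \<Rightarrow> real" where
  "inf_tensor_norm J C x =
     (INF F\<in>{F. finite F \<and> F \<subseteq> J \<and> x \<in> tensor_stage J C F}. stage_min_norm J C F x)"

type_synonym ('j, 'c) inf_tensor = "(nat \<Rightarrow> (('j \<Rightarrow> 'c) \<Rightarrow> complex) \<Rightarrow> complex) set"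

definition inf_tensor ::
    "'j set \<Rightarrow> ('j \<Rightarrow> 'c normed_star_algebra) \<Rightarrow> ('j, 'c) inf_tensor normed_star_algebra" where
  "inf_tensor J C = completion (with_norm (alg_inf_tensor J C) (inf_tensor_norm J C))"

definition inf_pure ::
    "'j set \<Rightarrow> ('j \<Rightarrow> 'c normed_star_algebra) \<Rightarrow> ('j \<Rightarrow> 'c) \<Rightarrow> ('j, 'c) inf_tensor" where
  "inf_pure J C c =
     to_completion (with_norm (alg_inf_tensor J C) (inf_tensor_norm J C)) (pure_inf_tensor J C c)"

text \<open>The factors omitted from the product are \<open>g j (1 \<otimes> 1) = 1\<close>.\<close>

definition product_state ::
    "'j set \<Rightarrow> ('j \<Rightarrow> 'c normed_star_algebra) \<Rightarrow> ('j \<Rightarrow> 'd normed_star_algebra) \<Rightarrow>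
      ('j \<Rightarrow> ('c, 'd) tensor \<Rightarrow> complex) \<Rightarrow>
      (('j, 'c) inf_tensor, ('j, 'd) inf_tensor) tensor \<Rightarrow> complex" where
  "product_state J C D g = (THE h.
     h \<in> states (max_tensor (inf_tensor J C) (inf_tensor J D)) \<and>
     (\<forall>c\<in>restr_prod J C. \<forall>d\<in>restr_prod J D.
        h (max_pure (inf_tensor J C) (inf_tensor J D) (inf_pure J C c) (inf_pure J D d)) =
        (\<Prod>j\<in>{j\<in>J. c j \<noteq> \<one>\<^bsub>C j\<^esub> \<or> d j \<noteq> \<one>\<^bsub>D j\<^esub>}. g j (max_pure (C j) (D j) (c j) (d j)))))"


section \<open>Embezzlement and local containment\<close>

text \<open>The notion is meant for states \<open>s\<close> and \<open>g\<close>, but their being states is not part of the definition,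
  so that nothing about \<open>g\<close> is assumed where embezzlement of \<open>g\<close> is a hypothesis.\<close>

definition embezzles ::
    "'a normed_star_algebra \<Rightarrow> 'b normed_star_algebra \<Rightarrow> (('a, 'b) tensor \<Rightarrow> complex) \<Rightarrow>
      'c normed_star_algebra \<Rightarrow> 'd normed_star_algebra \<Rightarrow> (('c, 'd) tensor \<Rightarrow> complex) \<Rightarrow> bool" where
  "embezzles A B s C D g \<longleftrightarrow> (\<exists>\<Phi>\<^sub>A \<Phi>\<^sub>B.
     star_iso (min_tensor A C) A \<Phi>\<^sub>A \<and> star_iso (min_tensor B D) B \<Phi>\<^sub>B \<and>
     (\<forall>a\<in>carrier A. \<forall>b\<in>carrier B. \<forall>c\<in>carrier C. \<forall>d\<in>carrier D.
        s (max_pure A B (\<Phi>\<^sub>A (min_pure A C a c)) (\<Phi>\<^sub>B (min_pure B D b d))) =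
        s (max_pure A B a b) * g (max_pure C D c d)))"

text \<open>The *-homomorphism \<open>\<theta>\<close> is \<open>\<pi>\<^sub>A \<otimes> \<pi>\<^sub>B\<close>: it is determined by its values on elementary tensors.\<close>

definition locally_contains ::
    "'a normed_star_algebra \<Rightarrow> 'b normed_star_algebra \<Rightarrow> (('a, 'b) tensor \<Rightarrow> complex) \<Rightarrow>
      'c normed_star_algebra \<Rightarrow> 'd normed_star_algebra \<Rightarrow> (('c, 'd) tensor \<Rightarrow> complex) \<Rightarrow> bool" where
  "locally_contains F\<^sub>A F\<^sub>B f G\<^sub>A G\<^sub>B g \<longleftrightarrow>
     f \<in> states (max_tensor F\<^sub>A F\<^sub>B) \<and> g \<in> states (max_tensor G\<^sub>A G\<^sub>B) \<and>
     (\<exists>\<pi>\<^sub>A \<pi>\<^sub>B \<theta>. star_mono G\<^sub>A F\<^sub>A \<pi>\<^sub>A \<and> star_mono G\<^sub>B F\<^sub>B \<pi>\<^sub>B \<and>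
        star_hom (max_tensor G\<^sub>A G\<^sub>B) (max_tensor F\<^sub>A F\<^sub>B) \<theta> \<and>
        (\<forall>a\<in>carrier G\<^sub>A. \<forall>b\<in>carrier G\<^sub>B.
           \<theta> (max_pure G\<^sub>A G\<^sub>B a b) = max_pure F\<^sub>A F\<^sub>B (\<pi>\<^sub>A a) (\<pi>\<^sub>B b)) \<and>
        (\<forall>x\<in>carrier (max_tensor G\<^sub>A G\<^sub>B). f (\<theta> x) = g x))"


section \<open>Vectors with positive rational Schmidt coefficients\<close>

definition op_norm :: "complex mat \<Rightarrow> real" where
  "op_norm M = (SUP v\<in>{v \<in> carrier_vec (dim_col M). L2_set (\<lambda>i. cmod (v $ i)) {..<dim_col M} \<le> 1}.
     L2_set (\<lambda>i. cmod ((M *\<^sub>v v) $ i)) {..<dim_row M})"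

definition matrix_algebra :: "nat \<Rightarrow> complex mat normed_star_algebra" where
  "matrix_algebra n =
    \<lparr> carrier = carrier_mat n n, monoid.mult = (*), one = 1\<^sub>m n, zero = 0\<^sub>m n n, add = (+),
      module.smult = (\<cdot>\<^sub>m), star = mat_adjoint, nrm = op_norm \<rparr>"

text \<open>A list \<open>[x\<^sub>0, \<dots>, x\<^sub>n]\<close> stands for the unit vector \<open>x\<^sub>0|00\<rangle> + \<dots> + x\<^sub>n|nn\<rangle>\<close> in the tensor square of
  the Hilbert space of dimension \<open>n + 1\<close>, that is, the length of the list.\<close>

definition rational_schmidt_lists :: "rat list set" where
  "rational_schmidt_lists = {xs. xs \<noteq> [] \<and> (\<forall>x\<in>set xs. 0 < x) \<and> (\<Sum>x\<leftarrow>xs. x\<^sup>2) = 1}"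

definition schmidt_vector :: "rat list \<Rightarrow> nat \<times> nat \<Rightarrow> complex" where
  "schmidt_vector xs = (\<lambda>(i, j). if i = j then of_rat (xs ! i) else 0)"

text \<open>\<open>\<langle>\<psi>|c \<otimes> d|\<psi>\<rangle>\<close>, with the Kronecker product \<open>c \<otimes> d\<close> written out.\<close>

definition schmidt_expectation :: "rat list \<Rightarrow> complex mat \<Rightarrow> complex mat \<Rightarrow> complex" where
  "schmidt_expectation xs c d = (let I = {..<length xs} \<times> {..<length xs}; \<psi> = schmidt_vector xs in
     \<Sum>p\<in>I. \<Sum>q\<in>I. cnj (\<psi> p) * (c $$ (fst p, fst q) * d $$ (snd p, snd q)) * \<psi> q)"

definition schmidt_state :: "rat list \<Rightarrow> (complex mat, complex mat) tensor \<Rightarrow> complex" where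
  "schmidt_state xs = (let M = matrix_algebra (length xs) in
     THE g. g \<in> states (max_tensor M M) \<and>
       (\<forall>c\<in>carrier M. \<forall>d\<in>carrier M. g (max_pure M M c d) = schmidt_expectation xs c d))"


text \<open>The \<open>(i, k)\<close>-th factor is the \<open>k\<close>-th copy of the matrix algebra belonging to \<open>\<psi> i\<close>; it is the
  same for both parties.\<close>

definition schmidt_factors :: "(nat \<Rightarrow> rat list) \<Rightarrow> nat \<times> nat \<Rightarrow> complex mat normed_star_algebra" where
  "schmidt_factors \<psi> = (\<lambda>(i, k). matrix_algebra (length (\<psi> i)))"


section \<open>Products and involutions of elementary tensors\<close>

lemma (in cstar_algebra) complex_smult_closed:
  "x \<in> carrier A \<Longrightarrow> c \<odot> x \<in> carrier A"
  by (rule scalar.smult_closed) (simp_all add: ring_of_type_algebra_def)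

lemma alg_tensor_mult_pure:
  assumes "cstar_algebra A" "cstar_algebra B"
    and "a \<in> carrier A" "a' \<in> carrier A" "b \<in> carrier B" "b' \<in> carrier B"
  shows "pure_tensor A B a b \<otimes>\<^bsub>alg_tensor A B\<^esub> pure_tensor A B a' b' =
    pure_tensor A B (a \<otimes>\<^bsub>A\<^esub> a') (b \<otimes>\<^bsub>B\<^esub> b')"
proof -
  interpret A: cstar_algebra A by fact
  interpret B: cstar_algebra B by fact
  have inner: "(\<lambda>u v. \<beta> (x \<otimes>\<^bsub>A\<^esub> u) (y \<otimes>\<^bsub>B\<^esub> v)) \<in> bilinear_forms A B"
    if "\<beta> \<in> bilinear_forms A B" "x \<in> carrier A" "y \<in> carrier B" for \<beta> x y
    using that
    by (auto simp: bilinear_forms_def linear_functional_def A.r_distr B.r_distr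
        A.smult_mult_right B.smult_mult_right)
  have outer: "(\<lambda>u v. \<beta> (u \<otimes>\<^bsub>A\<^esub> a') (v \<otimes>\<^bsub>B\<^esub> b')) \<in> bilinear_forms A B"
    if "\<beta> \<in> bilinear_forms A B" for \<beta>
    using that assms
    by (auto simp: bilinear_forms_def linear_functional_def A.l_distr B.l_distr
        A.smult_mult_left B.smult_mult_left)
  have outer': "(\<lambda>u v. pure_tensor A B a' b' (\<lambda>x y. \<beta> (u \<otimes>\<^bsub>A\<^esub> x) (v \<otimes>\<^bsub>B\<^esub> y))) \<in> bilinear_forms A B"
    if \<beta>: "\<beta> \<in> bilinear_forms A B" for \<beta>
    using outer[OF \<beta>] inner[OF \<beta>]
    by (simp add: bilinear_forms_def[of A B] linear_functional_def pure_tensor_def A.complex_smult_closed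
        B.complex_smult_closed A.add.m_closed)
  show ?thesis
    using inner outer' assms by (auto simp: alg_tensor_def pure_tensor_def fun_eq_iff)
qed

lemma alg_tensor_star_pure:
  assumes "cstar_algebra A" "cstar_algebra B"
    and "a \<in> carrier A" "b \<in> carrier B"
  shows "star (alg_tensor A B) (pure_tensor A B a b) = pure_tensor A B (star A a) (star B b)"
proof -
  interpret A: cstar_algebra A by fact
  interpret B: cstar_algebra B by fact
  have "(\<lambda>x y. cnj (\<beta> (star A x) (star B y))) \<in> bilinear_forms A B"
    if "\<beta> \<in> bilinear_forms A B" for \<beta>
    using that
    by (auto simp: bilinear_forms_def linear_functional_def A.star_closed B.star_closed
        A.star_add B.star_add A.star_smult B.star_smult)
  then show ?thesis
    by (auto simp: alg_tensor_def pure_tensor_def fun_eq_iff)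
qed

lemma restr_prod_upd:
  assumes "c \<in> restr_prod J C" "j \<in> J" "v \<in> carrier (C j)"
  shows "c(j := v) \<in> restr_prod J C"
proof -
  have "finite (insert j {i\<in>J. c i \<noteq> \<one>\<^bsub>C i\<^esub>})"
    using assms by (simp add: restr_prod_def)
  then have "finite {i\<in>J. (c(j := v)) i \<noteq> \<one>\<^bsub>C i\<^esub>}"
    by (rule rev_finite_subset) auto
  with assms show ?thesis
    by (auto simp: restr_prod_def PiE_def extensional_def)
qed

lemma restr_prod_mult:
  assumes "\<And>j. j \<in> J \<Longrightarrow> cstar_algebra (C j)" "c \<in> restr_prod J C" "d \<in> restr_prod J C"
  shows "(\<lambda>j\<in>J. c j \<otimes>\<^bsub>C j\<^esub> d j) \<in> restr_prod J C"
proof -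
  have ring: "ring (C j)" if "j \<in> J" for j
    using assms(1)[OF that] by (simp add: cstar_algebra_def)
  have "finite ({j\<in>J. c j \<noteq> \<one>\<^bsub>C j\<^esub>} \<union> {j\<in>J. d j \<noteq> \<one>\<^bsub>C j\<^esub>})"
    using assms by (simp add: restr_prod_def)
  then have "finite {j\<in>J. (\<lambda>j\<in>J. c j \<otimes>\<^bsub>C j\<^esub> d j) j \<noteq> \<one>\<^bsub>C j\<^esub>}"
    by (rule rev_finite_subset) (auto simp: ring.ring_simprules[OF ring])
  moreover have "c j \<otimes>\<^bsub>C j\<^esub> d j \<in> carrier (C j)" if "j \<in> J" for j
    using assms that by (auto simp: restr_prod_def PiE_def Pi_def intro: ring.ring_simprules ring)
  ultimately show ?thesis
    by (auto simp: restr_prod_def)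
qed

lemma restr_prod_star:
  assumes "\<And>j. j \<in> J \<Longrightarrow> cstar_algebra (C j)" "c \<in> restr_prod J C"
  shows "(\<lambda>j\<in>J. star (C j) (c j)) \<in> restr_prod J C"
proof -
  have star1: "star (C j) \<one>\<^bsub>C j\<^esub> = \<one>\<^bsub>C j\<^esub>" if "j \<in> J" for j
  proof -
    interpret cstar_algebra "C j" by (rule assms(1)[OF that])
    have "\<one>\<^bsub>C j\<^esub> = star (C j) (star (C j) \<one>\<^bsub>C j\<^esub> \<otimes>\<^bsub>C j\<^esub> \<one>\<^bsub>C j\<^esub>)"
      by (simp add: star_closed star_star)
    also have "\<dots> = star (C j) \<one>\<^bsub>C j\<^esub> \<otimes>\<^bsub>C j\<^esub> star (C j) (star (C j) \<one>\<^bsub>C j\<^esub>)"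
      by (rule star_mult) (simp_all add: star_closed)
    also have "\<dots> = star (C j) \<one>\<^bsub>C j\<^esub>"
      by (simp add: star_closed star_star)
    finally show ?thesis ..
  qed
  have "finite {j\<in>J. (\<lambda>j\<in>J. star (C j) (c j)) j \<noteq> \<one>\<^bsub>C j\<^esub>}"
    by (rule finite_subset[of _ "{j\<in>J. c j \<noteq> \<one>\<^bsub>C j\<^esub>}"])
      (use assms in \<open>auto simp: restr_prod_def star1\<close>)
  moreover have "star (C j) (c j) \<in> carrier (C j)" if "j \<in> J" for j
    using assms that
    by (auto simp: restr_prod_def PiE_def Pi_def intro: cstar_algebra.star_closed)
  ultimately show ?thesis
    by (auto simp: restr_prod_def)
qed

lemma alg_inf_tensor_mult_pure:
  assumes C: "\<And>j. j \<in> J \<Longrightarrow> cstar_algebra (C j)"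
    and c: "c \<in> restr_prod J C" and d: "d \<in> restr_prod J C"
  shows "pure_inf_tensor J C c \<otimes>\<^bsub>alg_inf_tensor J C\<^esub> pure_inf_tensor J C d =
    pure_inf_tensor J C (\<lambda>j\<in>J. c j \<otimes>\<^bsub>C j\<^esub> d j)"
proof -
  have ml: "linear_functional (C j) (\<lambda>v. \<beta> (e(j := v)))"
    if "\<beta> \<in> multilinear_forms J C" "e \<in> restr_prod J C" "j \<in> J" for \<beta> e j
    using that by (auto simp: multilinear_forms_def)
  have car: "e j \<in> carrier (C j)" if "e \<in> restr_prod J C" "j \<in> J" for e j
    using that by (auto simp: restr_prod_def)
  have updr: "(\<lambda>i\<in>J. x i \<otimes>\<^bsub>C i\<^esub> (y(j := v)) i) = (\<lambda>i\<in>J. x i \<otimes>\<^bsub>C i\<^esub> y i)(j := x j \<otimes>\<^bsub>C j\<^esub> v)"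
    and updl: "(\<lambda>i\<in>J. (x(j := v)) i \<otimes>\<^bsub>C i\<^esub> y i) = (\<lambda>i\<in>J. x i \<otimes>\<^bsub>C i\<^esub> y i)(j := v \<otimes>\<^bsub>C j\<^esub> y j)"
    if "j \<in> J" for x y j v
    using that by (auto simp: restrict_def)
  have inner: "(\<lambda>y. \<beta> (\<lambda>j\<in>J. x j \<otimes>\<^bsub>C j\<^esub> y j)) \<in> multilinear_forms J C"
    if \<beta>: "\<beta> \<in> multilinear_forms J C" and x: "x \<in> restr_prod J C" for \<beta> x
    unfolding multilinear_forms_def
  proof (intro CollectI ballI)
    fix y j assume y: "y \<in> restr_prod J C" and j: "j \<in> J"
    interpret cstar_algebra "C j" by (rule C[OF j])
    show "linear_functional (C j) (\<lambda>v. \<beta> (\<lambda>i\<in>J. x i \<otimes>\<^bsub>C i\<^esub> (y(j := v)) i))"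
      using ml[OF \<beta> restr_prod_mult[OF C x y] j] car[OF x j]
      unfolding updr[OF j] linear_functional_def
      by (simp add: r_distr smult_mult_right)
  qed
  have outer: "(\<lambda>x. \<beta> (\<lambda>j\<in>J. x j \<otimes>\<^bsub>C j\<^esub> d j)) \<in> multilinear_forms J C"
    if \<beta>: "\<beta> \<in> multilinear_forms J C" for \<beta>
    unfolding multilinear_forms_def
  proof (intro CollectI ballI)
    fix x j assume x: "x \<in> restr_prod J C" and j: "j \<in> J"
    interpret cstar_algebra "C j" by (rule C[OF j])
    show "linear_functional (C j) (\<lambda>v. \<beta> (\<lambda>i\<in>J. (x(j := v)) i \<otimes>\<^bsub>C i\<^esub> d i))"
      using ml[OF \<beta> restr_prod_mult[OF C x d] j] car[OF d j]
      unfolding updl[OF j] linear_functional_def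
      by (simp add: l_distr smult_mult_left)
  qed
  have "(\<lambda>x. pure_inf_tensor J C d (\<lambda>y. \<beta> (\<lambda>j\<in>J. x j \<otimes>\<^bsub>C j\<^esub> y j))) \<in> multilinear_forms J C"
    if \<beta>: "\<beta> \<in> multilinear_forms J C" for \<beta>
    unfolding multilinear_forms_def
  proof (intro CollectI ballI)
    fix x j assume x: "x \<in> restr_prod J C" and j: "j \<in> J"
    interpret cstar_algebra "C j" by (rule C[OF j])
    have "pure_inf_tensor J C d (\<lambda>y. \<beta> (\<lambda>i\<in>J. (x(j := v)) i \<otimes>\<^bsub>C i\<^esub> y i)) =
        \<beta> (\<lambda>i\<in>J. (x(j := v)) i \<otimes>\<^bsub>C i\<^esub> d i)" if "v \<in> carrier (C j)" for v
      using inner[OF \<beta> restr_prod_upd[OF x j that]] by (simp add: pure_inf_tensor_def)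
    then show "linear_functional (C j)
        (\<lambda>v. pure_inf_tensor J C d (\<lambda>y. \<beta> (\<lambda>i\<in>J. (x(j := v)) i \<otimes>\<^bsub>C i\<^esub> y i)))"
      using ml[OF outer[OF \<beta>] x j] by (simp add: linear_functional_def complex_smult_closed)
  qed
  then show ?thesis
    using inner c by (auto simp: alg_inf_tensor_def pure_inf_tensor_def fun_eq_iff)
qed

lemma alg_inf_tensor_star_pure:
  assumes C: "\<And>j. j \<in> J \<Longrightarrow> cstar_algebra (C j)" and c: "c \<in> restr_prod J C"
  shows "star (alg_inf_tensor J C) (pure_inf_tensor J C c) =
    pure_inf_tensor J C (\<lambda>j\<in>J. star (C j) (c j))"
proof -
  have "(\<lambda>x. cnj (\<beta> (\<lambda>j\<in>J. star (C j) (x j)))) \<in> multilinear_forms J C"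
    if \<beta>: "\<beta> \<in> multilinear_forms J C" for \<beta>
    unfolding multilinear_forms_def
  proof (intro CollectI ballI)
    fix x j assume x: "x \<in> restr_prod J C" and j: "j \<in> J"
    interpret cstar_algebra "C j" by (rule C[OF j])
    have upd: "(\<lambda>i\<in>J. star (C i) ((x(j := v)) i)) = (\<lambda>i\<in>J. star (C i) (x i))(j := star (C j) v)" for v
      using j by (auto simp: restrict_def)
    have "linear_functional (C j) (\<lambda>v. \<beta> ((\<lambda>i\<in>J. star (C i) (x i))(j := v)))"
      using \<beta> restr_prod_star[OF C x] j by (auto simp: multilinear_forms_def)
    then show "linear_functional (C j) (\<lambda>v. cnj (\<beta> (\<lambda>i\<in>J. star (C i) ((x(j := v)) i))))"
      unfolding upd linear_functional_def by (simp add: star_closed star_add star_smult)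
  qed
  then show ?thesis
    by (auto simp: alg_inf_tensor_def pure_inf_tensor_def fun_eq_iff)
qed

end

theory Submission
  imports Defs "HOL-Library.Nat_Bijection"
begin

text \<open>Enumerate the pairs \<open>(i, k)\<close> as \<open>j\<^sub>0, j\<^sub>1, \<dots>\<close> and let \<open>\<Phi>\<^sub>m : A \<otimes> C\<^sub>m \<rightarrow> A\<close>, \<open>\<Psi>\<^sub>m : B \<otimes> C\<^sub>m \<rightarrow> B\<close> be
  the isomorphisms that embezzle the state belonging to \<open>j\<^sub>m\<close>. The nested maps
  \<open>c \<mapsto> \<Phi>\<^sub>0(\<Phi>\<^sub>1(\<dots>\<Phi>\<^sub>m(1 \<otimes> c\<^sub>m)\<dots> \<otimes> c\<^sub>1) \<otimes> c\<^sub>0)\<close> are compatible as \<open>m\<close> grows, because \<open>\<Phi>\<^sub>m(1 \<otimes> 1) = 1\<close>, and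
  define a *-homomorphism from the algebraic infinite tensor product into \<open>A\<close>; peeling off one
  isomorphism after the other shows that \<open>s\<close> restricts to the product state. A finite tensor product of
  matrix algebras carries only one C*-seminorm that does not vanish at 1, so the homomorphism is
  isometric and extends to an embedding of the infinite tensor product. The two embeddings induce a
  homomorphism of the maximal tensor products, since the maximal norm dominates every C*-seminorm, and
  \<open>s\<close> pulls back along it to a state, which is the product state.\<close>

section \<open>Star algebras and C*-seminorms\<close>

text \<open>The norms of the construction are bare suprema and infima, so nothing about them is
  free: finiteness and the C*-identity have to be derived before any completion is a C*-algebra. The
  analysis rests on one tool, a square root of \<open>\<one> \<ominus> x\<close> for self-adjoint
  \<open>x\<close> with \<open>nrm A x < 1\<close>: it makes every C*-seminorm on a C*-algebra
  smaller than the norm, and every positive functional bounded. Positivity of product functionals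
  comes from Schur products of positive kernels. The norm of the infinite tensor product is never
  computed: comparison with the norm pulled back from \<open>A\<close> identifies it, and only then
  is it known to be a C*-seminorm. Elementary tensors are evaluations of scalar forms, so a map into
  \<open>A\<close> has to be recovered from its compositions with linear functionals. The product
  state is a definite description, for which existence and uniqueness have to be shown. That a
  factor state is 1 at the unit is obtained by embezzling with units in every place.\<close>

locale star_alg = ring T for T :: "('a, 'm) star_algebra_scheme" (structure) +
  assumes smult_closed [simp, intro]: "x \<in> carrier T \<Longrightarrow> c \<odot> x \<in> carrier T"
    and smult_l_distr: "x \<in> carrier T \<Longrightarrow> (a + b) \<odot> x = a \<odot> x \<oplus> b \<odot> x"
    and smult_r_distr: "\<lbrakk>x \<in> carrier T; y \<in> carrier T\<rbrakk> \<Longrightarrow> a \<odot> (x \<oplus> y) = a \<odot> x \<oplus> a \<odot> y"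
    and smult_smult: "x \<in> carrier T \<Longrightarrow> a \<odot> (b \<odot> x) = (a * b) \<odot> x"
    and smult_one [simp]: "x \<in> carrier T \<Longrightarrow> 1 \<odot> x = x"
    and smult_mult_left: "\<lbrakk>x \<in> carrier T; y \<in> carrier T\<rbrakk> \<Longrightarrow> (c \<odot> x) \<otimes> y = c \<odot> (x \<otimes> y)"
    and smult_mult_right: "\<lbrakk>x \<in> carrier T; y \<in> carrier T\<rbrakk> \<Longrightarrow> x \<otimes> (c \<odot> y) = c \<odot> (x \<otimes> y)"
    and star_closed [simp, intro]: "x \<in> carrier T \<Longrightarrow> star T x \<in> carrier T"
    and star_star [simp]: "x \<in> carrier T \<Longrightarrow> star T (star T x) = x"
    and star_add: "\<lbrakk>x \<in> carrier T; y \<in> carrier T\<rbrakk> \<Longrightarrow> star T (x \<oplus> y) = star T x \<oplus> star T y"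
    and star_smult: "x \<in> carrier T \<Longrightarrow> star T (c \<odot> x) = cnj c \<odot> star T x"
    and star_mult: "\<lbrakk>x \<in> carrier T; y \<in> carrier T\<rbrakk> \<Longrightarrow> star T (x \<otimes> y) = star T y \<otimes> star T x"
begin

lemma smult_zero_left [simp]: "x \<in> carrier T \<Longrightarrow> 0 \<odot> x = \<zero>"
  using smult_l_distr[of x 0 0] by (simp add: add.l_cancel_one')

lemma smult_zero_right [simp]: "c \<odot> \<zero> = \<zero>"
  using smult_r_distr[of \<zero> \<zero> c] by (simp add: add.l_cancel_one')

lemma uminus_eq_smult: "x \<in> carrier T \<Longrightarrow> \<ominus> x = (-1) \<odot> x"
  using smult_l_distr[of x 1 "-1"] by (simp add: minus_equality a_comm)

lemma minus_eq_smult: "\<lbrakk>x \<in> carrier T; y \<in> carrier T\<rbrakk> \<Longrightarrow> x \<ominus> y = x \<oplus> (-1) \<odot> y"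
  by (simp add: minus_eq uminus_eq_smult)

lemma star_one [simp]: "star T \<one> = \<one>"
  using star_mult[of "star T \<one>" \<one>] by simp

lemma star_zero [simp]: "star T \<zero> = \<zero>"
  using star_smult[of \<zero> 0] by simp

lemma star_minus: "\<lbrakk>x \<in> carrier T; y \<in> carrier T\<rbrakk> \<Longrightarrow> star T (x \<ominus> y) = star T x \<ominus> star T y"
  by (simp add: minus_eq_smult star_add star_smult)

lemma minus_add_telescope:
  "\<lbrakk>x \<in> carrier T; y \<in> carrier T; z \<in> carrier T\<rbrakk> \<Longrightarrow> (x \<ominus> y) \<oplus> (y \<ominus> z) = x \<ominus> z"
  by (simp add: minus_eq a_assoc[symmetric]) (simp add: a_assoc l_neg)

lemma minus_add_cancel: "\<lbrakk>x \<in> carrier T; y \<in> carrier T\<rbrakk> \<Longrightarrow> (x \<ominus> y) \<oplus> y = x"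
  by (simp add: minus_eq a_assoc l_neg)

lemma minus_eq_zeroD: "\<lbrakk>x \<in> carrier T; y \<in> carrier T; x \<ominus> y = \<zero>\<rbrakk> \<Longrightarrow> x = y"
  using minus_add_cancel[of x y] by simp

lemma commute_mult:
  assumes "x \<in> carrier T" "y \<in> carrier T" "z \<in> carrier T" "z \<otimes> x = x \<otimes> z" "z \<otimes> y = y \<otimes> z"
  shows "z \<otimes> (x \<otimes> y) = (x \<otimes> y) \<otimes> z"
  by (metis assms m_assoc)

end

lemma cstar_algebra_imp_star_alg: "cstar_algebra A \<Longrightarrow> star_alg A"
proof -
  assume "cstar_algebra A"
  then interpret cstar_algebra A .
  show ?thesis
    using scalar.smult_l_distr scalar.smult_r_distr scalar.smult_assoc1 scalar.smult_one
    by unfold_locales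
      (auto simp: ring_of_type_algebra_def smult_mult_left smult_mult_right star_closed star_star
        star_add star_smult star_mult)
qed

section \<open>Consequences of the C*-identity\<close>

locale cstar_seminormed = star_alg +
  fixes p assumes seminorm: "cstar_seminorm T p"
begin

lemma
  shows p_nonneg [simp]: "x \<in> carrier T \<Longrightarrow> 0 \<le> p x"
    and p_triangle: "\<lbrakk>x \<in> carrier T; y \<in> carrier T\<rbrakk> \<Longrightarrow> p (x \<oplus> y) \<le> p x + p y"
    and p_smult [simp]: "x \<in> carrier T \<Longrightarrow> p (c \<odot> x) = cmod c * p x"
    and p_mult_le: "\<lbrakk>x \<in> carrier T; y \<in> carrier T\<rbrakk> \<Longrightarrow> p (x \<otimes> y) \<le> p x * p y"
    and p_cstar: "x \<in> carrier T \<Longrightarrow> p (star T x \<otimes> x) = (p x)\<^sup>2"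
  using seminorm by (auto simp: cstar_seminorm_def)

lemma p_zero [simp]: "p \<zero> = 0"
  using p_smult[of \<zero> 0] by simp

text \<open>\<open>cstar_seminorm\<close> does not contain invariance under the involution. It
  follows from the C*-identity and submultiplicativity after cancelling \<open>p x\<close>.\<close>

lemma p_star [simp]:
  assumes "x \<in> carrier T" shows "p (star T x) = p x"
proof -
  have le: "p x \<le> p (star T x)" if x: "x \<in> carrier T" for x
  proof (cases "p x = 0")
    case False
    have "p x * p x \<le> p (star T x) * p x"
      using p_cstar[OF x] p_mult_le[of "star T x" x] x by (simp add: power2_eq_square)
    with False p_nonneg[OF x] show ?thesis by (simp add: mult_le_cancel_right)
  qed (use x in auto)
  show ?thesis using le[OF assms] le[of "star T x"] assms by simp
qed

text \<open>The C*-identity at \<open>\<one>\<close> makes \<open>p \<one>\<close> an idempotent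
  real. The value 0 occurs exactly for the seminorm that vanishes on the whole algebra, which is why
  \<open>p \<one> \<noteq> 0\<close> is the nondegeneracy condition in the uniqueness
  results.\<close>

lemma p_one: "p \<one> = 0 \<or> p \<one> = 1"
  using p_cstar[of \<one>] by (simp add: power2_eq_square)

lemma p_one_le: "p \<one> \<le> 1"
  using p_one by auto

lemma p_minus_commute: "\<lbrakk>x \<in> carrier T; y \<in> carrier T\<rbrakk> \<Longrightarrow> p (x \<ominus> y) = p (y \<ominus> x)"
proof -
  assume xy: "x \<in> carrier T" "y \<in> carrier T"
  have "x \<ominus> y = (-1) \<odot> (y \<ominus> x)"
    using xy by (simp add: minus_eq_smult smult_r_distr smult_smult a_comm)
  then show ?thesis using xy by simp
qed

lemma p_minus_triangle:
  "\<lbrakk>x \<in> carrier T; y \<in> carrier T; z \<in> carrier T\<rbrakk> \<Longrightarrow> p (x \<ominus> z) \<le> p (x \<ominus> y) + p (y \<ominus> z)"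
  using p_triangle[of "x \<ominus> y" "y \<ominus> z"] by (simp add: minus_add_telescope)

lemma p_le_minus: "\<lbrakk>x \<in> carrier T; y \<in> carrier T\<rbrakk> \<Longrightarrow> p x \<le> p (x \<ominus> y) + p y"
  using p_triangle[of "x \<ominus> y" y] by (simp add: minus_add_cancel)

lemma p_abs_diff_le:
  assumes "x \<in> carrier T" "y \<in> carrier T" shows "\<bar>p x - p y\<bar> \<le> p (x \<ominus> y)"
  using p_le_minus[of x y] p_le_minus[of y x] p_minus_commute[of x y] assms by linarith

text \<open>The C*-identity turns squaring of a self-adjoint element into squaring of
  \<open>p\<close>, and the exponents \<open>2 ^ n\<close> arise by repeated squaring. This replaces
  the spectral radius formula when two seminorms are compared.\<close>

lemma p_pow_selfadjoint:
  assumes "x \<in> carrier T" "star T x = x"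
  shows "p (x [^] ((2::nat) ^ n)) = p x ^ (2 ^ n) \<and> star T (x [^] ((2::nat) ^ n)) = x [^] ((2::nat) ^ n)"
proof (induction n)
  case 0 then show ?case using assms by simp
next
  case (Suc n)
  let ?y = "x [^] ((2::nat) ^ n)"
  have y: "?y \<in> carrier T" using assms by simp
  have e: "x [^] ((2::nat) ^ Suc n) = ?y \<otimes> ?y"
    using assms by (simp add: nat_pow_mult mult_2)
  show ?case using Suc p_cstar[OF y] star_mult[OF y y]
    unfolding e by (simp add: power_even_eq mult.commute)
qed

subsection \<open>Sequences\<close>

definition null_equiv :: "(nat \<Rightarrow> 'a) \<Rightarrow> (nat \<Rightarrow> 'a) \<Rightarrow> bool" where
  "null_equiv s t \<longleftrightarrow> (\<lambda>n. p (s n \<ominus> t n)) \<longlonglongrightarrow> 0"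

definition cauchy :: "(nat \<Rightarrow> 'a) \<Rightarrow> bool" where
  "cauchy s \<longleftrightarrow> (\<forall>n. s n \<in> carrier T) \<and> (\<forall>e>0. \<exists>N. \<forall>m\<ge>N. \<forall>n\<ge>N. p (s m \<ominus> s n) < e)"

lemma cauchy_closed [simp]: "cauchy s \<Longrightarrow> s n \<in> carrier T"
  by (simp add: cauchy_def)

lemma cauchy_const: "x \<in> carrier T \<Longrightarrow> cauchy (\<lambda>_. x)"
  by (simp add: cauchy_def minus_eq r_neg)

lemma null_equivI:
  assumes "\<And>n. s n \<in> carrier T" "\<And>n. t n \<in> carrier T" "\<And>n. p (s n \<ominus> t n) \<le> f n" "f \<longlonglongrightarrow> 0"
  shows "null_equiv s t"
  unfolding null_equiv_def
  by (rule tendsto_sandwich[OF _ _ tendsto_const assms(4)]) (use assms in auto)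

lemma null_equiv_refl [simp]: "(\<And>n. s n \<in> carrier T) \<Longrightarrow> null_equiv s s"
  by (simp add: null_equiv_def minus_eq r_neg)

lemma null_equiv_sym:
  assumes "\<And>n. s n \<in> carrier T" "\<And>n. t n \<in> carrier T" "null_equiv s t" shows "null_equiv t s"
  using assms p_minus_commute[of "s _" "t _"] by (simp add: null_equiv_def)

lemma null_equiv_trans:
  assumes "\<And>n. s n \<in> carrier T" "\<And>n. t n \<in> carrier T" "\<And>n. u n \<in> carrier T"
    "null_equiv s t" "null_equiv t u"
  shows "null_equiv s u"
  by (rule null_equivI[where f = "\<lambda>n. p (s n \<ominus> t n) + p (t n \<ominus> u n)"])
    (use assms in \<open>auto simp: null_equiv_def intro: p_minus_triangle tendsto_add_zero\<close>)

lemma cauchy_bounded: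
  assumes "cauchy s" obtains K where "0 < K" "\<And>n. p (s n) \<le> K"
proof -
  have "0 < (1::real)" by simp
  with assms obtain N where N: "\<forall>m\<ge>N. \<forall>n\<ge>N. p (s m \<ominus> s n) < 1"
    unfolding cauchy_def by blast
  let ?K = "1 + p (s N) + (\<Sum>n<N. p (s n))"
  show thesis
  proof
    have S: "0 \<le> (\<Sum>n<N. p (s n))" using assms by (intro sum_nonneg) simp
    then show "0 < ?K" using assms p_nonneg[of "s N"] by (smt (verit) cauchy_closed)
    fix n show "p (s n) \<le> ?K"
    proof (cases "n < N")
      case True
      then have "p (s n) \<le> (\<Sum>n<N. p (s n))" using assms by (intro member_le_sum) auto
      then show ?thesis using assms p_nonneg[of "s N"] by (smt (verit) cauchy_closed)
    next
      case False
      then show ?thesis using N[rule_format, of n N] p_le_minus[of "s n" "s N"] assms S by simp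
    qed
  qed
qed

lemma p_add_minus_le:
  assumes "x \<in> carrier T" "y \<in> carrier T" "x' \<in> carrier T" "y' \<in> carrier T"
  shows "p ((x \<oplus> y) \<ominus> (x' \<oplus> y')) \<le> p (x \<ominus> x') + p (y \<ominus> y')"
proof -
  have "(x \<oplus> y) \<ominus> (x' \<oplus> y') = (x \<ominus> x') \<oplus> (y \<ominus> y')"
    using assms by (simp add: minus_eq minus_add a_ac)
  then show ?thesis using assms p_triangle[of "x \<ominus> x'" "y \<ominus> y'"] by simp
qed

lemma p_mult_minus_le:
  assumes "x \<in> carrier T" "y \<in> carrier T" "x' \<in> carrier T" "y' \<in> carrier T"
  shows "p ((x \<otimes> y) \<ominus> (x' \<otimes> y')) \<le> p (x \<ominus> x') * p y + p x' * p (y \<ominus> y')"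
proof -
  have "(x \<otimes> y) \<ominus> (x' \<otimes> y') = ((x \<ominus> x') \<otimes> y) \<oplus> (x' \<otimes> (y \<ominus> y'))"
    using assms minus_add_telescope[of "x \<otimes> y" "x' \<otimes> y" "x' \<otimes> y'"]
    by (simp add: minus_eq l_distr r_distr l_minus r_minus)
  then show ?thesis
    using assms p_triangle[of "(x \<ominus> x') \<otimes> y" "x' \<otimes> (y \<ominus> y')"]
      p_mult_le[of "x \<ominus> x'" y] p_mult_le[of x' "y \<ominus> y'"] by simp
qed

lemma p_smult_minus: "\<lbrakk>x \<in> carrier T; y \<in> carrier T\<rbrakk> \<Longrightarrow> p (c \<odot> x \<ominus> c \<odot> y) = cmod c * p (x \<ominus> y)"
proof -
  assume xy: "x \<in> carrier T" "y \<in> carrier T"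
  then have "c \<odot> x \<ominus> c \<odot> y = c \<odot> (x \<ominus> y)"
    by (simp add: minus_eq_smult smult_r_distr smult_smult)
  then show ?thesis using xy by simp
qed

lemma p_star_minus: "\<lbrakk>x \<in> carrier T; y \<in> carrier T\<rbrakk> \<Longrightarrow> p (star T x \<ominus> star T y) = p (x \<ominus> y)"
  by (simp flip: star_minus)

lemma null_equiv_add:
  assumes "\<And>n. s n \<in> carrier T" "\<And>n. t n \<in> carrier T" "\<And>n. s' n \<in> carrier T" "\<And>n. t' n \<in> carrier T"
    "null_equiv s s'" "null_equiv t t'"
  shows "null_equiv (\<lambda>n. s n \<oplus> t n) (\<lambda>n. s' n \<oplus> t' n)"
  by (rule null_equivI[where f = "\<lambda>n. p (s n \<ominus> s' n) + p (t n \<ominus> t' n)"])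
    (use assms in \<open>auto simp: null_equiv_def intro: p_add_minus_le tendsto_add_zero\<close>)

lemma null_equiv_smult:
  assumes "\<And>n. s n \<in> carrier T" "\<And>n. t n \<in> carrier T" "null_equiv s t"
  shows "null_equiv (\<lambda>n. c \<odot> s n) (\<lambda>n. c \<odot> t n)"
  using assms unfolding null_equiv_def by (simp add: p_smult_minus tendsto_mult_right_zero)

lemma null_equiv_star:
  assumes "\<And>n. s n \<in> carrier T" "\<And>n. t n \<in> carrier T" "null_equiv s t"
  shows "null_equiv (\<lambda>n. star T (s n)) (\<lambda>n. star T (t n))"
  using assms by (simp add: null_equiv_def p_star_minus)

lemma null_equiv_mult:
  assumes "cauchy s" "cauchy t" "cauchy s'" "cauchy t'" "null_equiv s s'" "null_equiv t t'"
  shows "null_equiv (\<lambda>n. s n \<otimes> t n) (\<lambda>n. s' n \<otimes> t' n)"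
proof -
  obtain K where K: "0 < K" "\<And>n. p (t n) \<le> K" using cauchy_bounded[OF assms(2)] by blast
  obtain L where L: "0 < L" "\<And>n. p (s' n) \<le> L" using cauchy_bounded[OF assms(3)] by blast
  show ?thesis
  proof (rule null_equivI[where f = "\<lambda>n. p (s n \<ominus> s' n) * K + L * p (t n \<ominus> t' n)"])
    show "(\<lambda>n. p (s n \<ominus> s' n) * K + L * p (t n \<ominus> t' n)) \<longlonglongrightarrow> 0"
      using assms(5,6) unfolding null_equiv_def
      by (intro tendsto_add_zero tendsto_mult_left_zero tendsto_mult_right_zero)
    fix n
    have "p (s n \<ominus> s' n) * p (t n) \<le> p (s n \<ominus> s' n) * K"
      by (rule mult_left_mono) (use K assms in auto)
    moreover have "p (s' n) * p (t n \<ominus> t' n) \<le> L * p (t n \<ominus> t' n)"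
      by (rule mult_right_mono) (use L assms in auto)
    ultimately show "p ((s n \<otimes> t n) \<ominus> (s' n \<otimes> t' n)) \<le> p (s n \<ominus> s' n) * K + L * p (t n \<ominus> t' n)"
      using p_mult_minus_le[of "s n" "t n" "s' n" "t' n"] assms by simp
  qed (use assms in auto)
qed

lemma cauchyI:
  assumes "\<And>n. s n \<in> carrier T"
    "\<And>e. 0 < e \<Longrightarrow> \<exists>N. \<forall>m\<ge>N. \<forall>n\<ge>N. p (s m \<ominus> s n) < e"
  shows "cauchy s"
  using assms by (auto simp: cauchy_def)

lemma cauchyD:
  assumes "cauchy s" "0 < e" obtains N where "\<And>m n. m \<ge> N \<Longrightarrow> n \<ge> N \<Longrightarrow> p (s m \<ominus> s n) < e"
  using assms unfolding cauchy_def by metis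

lemma cauchy_add:
  assumes "cauchy s" "cauchy t" shows "cauchy (\<lambda>n. s n \<oplus> t n)"
proof (rule cauchyI)
  fix e :: real assume "0 < e"
  then have e: "0 < e/2" by simp
  obtain M where M: "\<And>m n. m \<ge> M \<Longrightarrow> n \<ge> M \<Longrightarrow> p (s m \<ominus> s n) < e/2" using cauchyD[OF assms(1) e] by blast
  obtain N where N: "\<And>m n. m \<ge> N \<Longrightarrow> n \<ge> N \<Longrightarrow> p (t m \<ominus> t n) < e/2" using cauchyD[OF assms(2) e] by blast
  have "p ((s m \<oplus> t m) \<ominus> (s n \<oplus> t n)) < e" if "m \<ge> max M N" "n \<ge> max M N" for m n
    using M[of m n] N[of m n] p_add_minus_le[of "s m" "t m" "s n" "t n"] assms that by simp
  then show "\<exists>N. \<forall>m\<ge>N. \<forall>n\<ge>N. p ((s m \<oplus> t m) \<ominus> (s n \<oplus> t n)) < e" by blast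
qed (use assms in simp)

lemma cauchy_smult:
  assumes "cauchy s" shows "cauchy (\<lambda>n. c \<odot> s n)"
proof (rule cauchyI)
  fix e :: real assume e: "0 < e"
  have pos: "0 < e / (cmod c + 1)" using e by (simp add: add_nonneg_pos)
  obtain M where M: "\<And>m n. m \<ge> M \<Longrightarrow> n \<ge> M \<Longrightarrow> p (s m \<ominus> s n) < e / (cmod c + 1)"
    using cauchyD[OF assms pos] by blast
  have "p (c \<odot> s m \<ominus> c \<odot> s n) < e" if "m \<ge> M" "n \<ge> M" for m n
  proof -
    have "cmod c * p (s m \<ominus> s n) \<le> (cmod c + 1) * p (s m \<ominus> s n)"
      using assms by (intro mult_right_mono) auto
    also have "\<dots> < (cmod c + 1) * (e / (cmod c + 1))"
      using M[OF that] by (intro mult_strict_left_mono) (auto simp: add_nonneg_pos)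
    also have "\<dots> = e" using add_nonneg_pos[of "cmod c" 1] by simp
    finally show ?thesis using assms by (simp add: p_smult_minus)
  qed
  then show "\<exists>N. \<forall>m\<ge>N. \<forall>n\<ge>N. p (c \<odot> s m \<ominus> c \<odot> s n) < e" by blast
qed (use assms in simp)

lemma cauchy_star: "cauchy s \<Longrightarrow> cauchy (\<lambda>n. star T (s n))"
  by (simp add: cauchy_def p_star_minus)

lemma cauchy_mult:
  assumes "cauchy s" "cauchy t" shows "cauchy (\<lambda>n. s n \<otimes> t n)"
proof (rule cauchyI)
  fix e :: real assume "0 < e"
  obtain K where K: "0 < K" "\<And>n. p (t n) \<le> K" using cauchy_bounded[OF assms(2)] by blast
  obtain L where L: "0 < L" "\<And>n. p (s n) \<le> L" using cauchy_bounded[OF assms(1)] by blast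
  have eK: "0 < e/2/K" "0 < e/2/L" using \<open>0 < e\<close> K L by auto
  obtain M where M: "\<And>m n. m \<ge> M \<Longrightarrow> n \<ge> M \<Longrightarrow> p (s m \<ominus> s n) < e/2/K" using cauchyD[OF assms(1) eK(1)] by blast
  obtain N where N: "\<And>m n. m \<ge> N \<Longrightarrow> n \<ge> N \<Longrightarrow> p (t m \<ominus> t n) < e/2/L" using cauchyD[OF assms(2) eK(2)] by blast
  have "p ((s m \<otimes> t m) \<ominus> (s n \<otimes> t n)) < e" if "m \<ge> max M N" "n \<ge> max M N" for m n
  proof -
    have "p (s m \<ominus> s n) * p (t m) \<le> p (s m \<ominus> s n) * K"
      by (rule mult_left_mono) (use K assms in auto)
    moreover have "p (s m \<ominus> s n) * K < e/2" using M[of m n] K that by (simp add: less_divide_eq)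
    moreover have "p (s n) * p (t m \<ominus> t n) \<le> L * p (t m \<ominus> t n)"
      by (rule mult_right_mono) (use L assms in auto)
    moreover have "L * p (t m \<ominus> t n) < e/2" using N[of m n] L that by (simp add: less_divide_eq mult.commute)
    ultimately show ?thesis
      using p_mult_minus_le[of "s m" "t m" "s n" "t n"] assms by simp
  qed
  then show "\<exists>N. \<forall>m\<ge>N. \<forall>n\<ge>N. p ((s m \<otimes> t m) \<ominus> (s n \<otimes> t n)) < e" by blast
qed (use assms in simp)

lemma cauchy_norm_convergent:
  assumes "cauchy s" shows "(\<lambda>n. p (s n)) \<longlonglongrightarrow> lim (\<lambda>n. p (s n))"
proof -
  have "Cauchy (\<lambda>n. p (s n))"
  proof (rule metric_CauchyI)
    fix e :: real assume "0 < e"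
    then obtain M where M: "\<And>m n. m \<ge> M \<Longrightarrow> n \<ge> M \<Longrightarrow> p (s m \<ominus> s n) < e" using cauchyD[OF assms] by blast
    have "dist (p (s m)) (p (s n)) < e" if "m \<ge> M" "n \<ge> M" for m n
      using M[OF that] p_abs_diff_le[of "s m" "s n"] assms by (simp add: dist_real_def)
    then show "\<exists>M. \<forall>m\<ge>M. \<forall>n\<ge>M. dist (p (s m)) (p (s n)) < e" by blast
  qed
  then have "convergent (\<lambda>n. p (s n))" by (simp add: real_Cauchy_convergent)
  then show ?thesis by (subst (asm) convergent_LIMSEQ_iff)
qed

lemma null_equiv_norm_tendsto:
  assumes "\<And>n. s n \<in> carrier T" "\<And>n. t n \<in> carrier T" "null_equiv s t" "(\<lambda>n. p (s n)) \<longlonglongrightarrow> l"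
  shows "(\<lambda>n. p (t n)) \<longlonglongrightarrow> l"
proof -
  have "(\<lambda>n. p (s n) - p (t n)) \<longlonglongrightarrow> 0"
    by (rule tendsto_sandwich[of "\<lambda>n. - p (s n \<ominus> t n)" _ _ "\<lambda>n. p (s n \<ominus> t n)"])
      (use assms(3) p_abs_diff_le[OF assms(1) assms(2)] in
        \<open>auto simp: null_equiv_def abs_le_iff intro!: always_eventually tendsto_eq_intros\<close>,
       metis abs_le_iff minus_diff_eq neg_le_iff_le add.inverse_inverse)
  from tendsto_diff[OF assms(4) this] show ?thesis by simp
qed

end

subsection \<open>Introduction rules\<close>

text \<open>Additive inverses come from scalar multiplication by -1, so no premise speaks of
  them.\<close>

lemma star_algI:
  fixes T :: "('a, 'm) star_algebra_scheme" (structure)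
  assumes "\<And>x y. \<lbrakk>x \<in> carrier T; y \<in> carrier T\<rbrakk> \<Longrightarrow> x \<oplus> y \<in> carrier T"
    and "\<zero> \<in> carrier T" and "\<one> \<in> carrier T"
    and "\<And>x y. \<lbrakk>x \<in> carrier T; y \<in> carrier T\<rbrakk> \<Longrightarrow> x \<otimes> y \<in> carrier T"
    and smult: "\<And>c x. x \<in> carrier T \<Longrightarrow> c \<odot> x \<in> carrier T"
    and "\<And>x y z. \<lbrakk>x \<in> carrier T; y \<in> carrier T; z \<in> carrier T\<rbrakk> \<Longrightarrow> (x \<oplus> y) \<oplus> z = x \<oplus> (y \<oplus> z)"
    and comm: "\<And>x y. \<lbrakk>x \<in> carrier T; y \<in> carrier T\<rbrakk> \<Longrightarrow> x \<oplus> y = y \<oplus> x"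
    and "\<And>x. x \<in> carrier T \<Longrightarrow> \<zero> \<oplus> x = x"
    and smult_0: "\<And>x. x \<in> carrier T \<Longrightarrow> 0 \<odot> x = \<zero>"
    and "\<And>x y z. \<lbrakk>x \<in> carrier T; y \<in> carrier T; z \<in> carrier T\<rbrakk> \<Longrightarrow> (x \<otimes> y) \<otimes> z = x \<otimes> (y \<otimes> z)"
    and "\<And>x. x \<in> carrier T \<Longrightarrow> \<one> \<otimes> x = x" and "\<And>x. x \<in> carrier T \<Longrightarrow> x \<otimes> \<one> = x"
    and "\<And>x y z. \<lbrakk>x \<in> carrier T; y \<in> carrier T; z \<in> carrier T\<rbrakk> \<Longrightarrow> (x \<oplus> y) \<otimes> z = x \<otimes> z \<oplus> y \<otimes> z"
    and "\<And>x y z. \<lbrakk>x \<in> carrier T; y \<in> carrier T; z \<in> carrier T\<rbrakk> \<Longrightarrow> z \<otimes> (x \<oplus> y) = z \<otimes> x \<oplus> z \<otimes> y"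
    and smult_l: "\<And>a b x. x \<in> carrier T \<Longrightarrow> (a + b) \<odot> x = a \<odot> x \<oplus> b \<odot> x"
    and "\<And>a x y. \<lbrakk>x \<in> carrier T; y \<in> carrier T\<rbrakk> \<Longrightarrow> a \<odot> (x \<oplus> y) = a \<odot> x \<oplus> a \<odot> y"
    and "\<And>a b x. x \<in> carrier T \<Longrightarrow> a \<odot> (b \<odot> x) = (a * b) \<odot> x"
    and smult_1: "\<And>x. x \<in> carrier T \<Longrightarrow> 1 \<odot> x = x"
    and "\<And>c x y. \<lbrakk>x \<in> carrier T; y \<in> carrier T\<rbrakk> \<Longrightarrow> (c \<odot> x) \<otimes> y = c \<odot> (x \<otimes> y)"
    and "\<And>c x y. \<lbrakk>x \<in> carrier T; y \<in> carrier T\<rbrakk> \<Longrightarrow> x \<otimes> (c \<odot> y) = c \<odot> (x \<otimes> y)"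
    and "\<And>x. x \<in> carrier T \<Longrightarrow> star T x \<in> carrier T"
    and "\<And>x. x \<in> carrier T \<Longrightarrow> star T (star T x) = x"
    and "\<And>x y. \<lbrakk>x \<in> carrier T; y \<in> carrier T\<rbrakk> \<Longrightarrow> star T (x \<oplus> y) = star T x \<oplus> star T y"
    and "\<And>c x. x \<in> carrier T \<Longrightarrow> star T (c \<odot> x) = cnj c \<odot> star T x"
    and "\<And>x y. \<lbrakk>x \<in> carrier T; y \<in> carrier T\<rbrakk> \<Longrightarrow> star T (x \<otimes> y) = star T y \<otimes> star T x"
  shows "star_alg T"
proof -
  have inv: "\<exists>y\<in>carrier T. y \<oplus> x = \<zero>" if "x \<in> carrier T" for x
    using smult_l[OF that, of "-1" 1] smult[OF that, of "-1"] smult_0[OF that] smult_1[OF that]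
    by (intro bexI[of _ "(-1) \<odot> x"]) auto
  have "ring T"
    by (intro ringI abelian_groupI monoidI) (use assms inv in auto)
  then show ?thesis
    by (intro star_alg.intro star_alg_axioms.intro) (use assms in auto)
qed

lemma cstar_algebraI:
  assumes "star_alg A" "cstar_seminorm A (nrm A)"
    and "\<And>x. \<lbrakk>x \<in> carrier A; nrm A x = 0\<rbrakk> \<Longrightarrow> x = \<zero>\<^bsub>A\<^esub>"
    and "\<And>s. s \<in> cauchy_seqs A \<Longrightarrow> \<exists>x\<in>carrier A. (\<lambda>n. nrm A (s n \<ominus>\<^bsub>A\<^esub> x)) \<longlonglongrightarrow> 0"
  shows "cstar_algebra A"
proof -
  interpret star_alg A by fact
  have cr: "cring (ring_of_type_algebra :: complex ring)"
    by (rule cring_from_type_algebra)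
  interpret module "ring_of_type_algebra :: complex ring" A
    by (intro moduleI cr is_abelian_group)
      (auto simp: ring_of_type_algebra_def smult_l_distr smult_r_distr smult_smult)
  show ?thesis
    by unfold_locales
      (use assms in \<open>auto simp: smult_mult_left smult_mult_right star_add star_smult star_mult\<close>)
qed

locale pre_cstar = cstar_seminormed N "nrm N" for N :: "'a normed_star_algebra" (structure)

lemma pre_cstarI: "star_alg N \<Longrightarrow> cstar_seminorm N (nrm N) \<Longrightarrow> pre_cstar N"
  by (simp add: pre_cstar_def cstar_seminormed_def cstar_seminormed_axioms_def)

lemma cstar_algebra_imp_pre_cstar: "cstar_algebra A \<Longrightarrow> pre_cstar A"
  by (intro pre_cstarI cstar_algebra_imp_star_alg cstar_algebra.cstar_norm)

lemma (in pre_cstar) limit_unique: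
  assumes "cstar_algebra N" "\<And>n. s n \<in> carrier N" "a \<in> carrier N" "b \<in> carrier N"
    and "null_equiv s (\<lambda>_. a)" "null_equiv s (\<lambda>_. b)"
  shows "a = b"
proof -
  have s: "null_equiv (\<lambda>_. a) s"
    by (rule null_equiv_sym[OF assms(2) assms(3) assms(5)])
  have "null_equiv (\<lambda>_. a) (\<lambda>_. b)"
    by (rule null_equiv_trans[OF assms(3) assms(2) assms(4) s assms(6)])
  then have "nrm N (a \<ominus> b) = 0" by (simp add: null_equiv_def LIMSEQ_const_iff)
  then have "a \<ominus> b = \<zero>"
    using cstar_algebra.norm_definite[OF assms(1) minus_closed[OF assms(3,4)]] by blast
  then show ?thesis by (rule minus_eq_zeroD[OF assms(3,4)])
qed

section \<open>Completions\<close>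

context pre_cstar
begin

lemma cauchy_seqs_iff: "s \<in> cauchy_seqs N \<longleftrightarrow> cauchy s"
  by (simp add: cauchy_seqs_def cauchy_def)

abbreviation cls where "cls \<equiv> completion_class N"

abbreviation K where "K \<equiv> completion N"

lemma cls_def: "cls x = {y. cauchy y \<and> null_equiv x y}"
  by (simp add: completion_class_def cauchy_seqs_iff null_equiv_def)

lemma cls_eq_iff:
  assumes "cauchy x" "cauchy y" shows "cls x = cls y \<longleftrightarrow> null_equiv x y"
proof
  assume "cls x = cls y"
  moreover have "y \<in> cls y" using assms by (simp add: cls_def)
  ultimately have "y \<in> cls x" by simp
  then show "null_equiv x y" by (simp add: cls_def)
next
  assume e: "null_equiv x y"
  then have "null_equiv y x" using assms by (auto intro: null_equiv_sym)
  with e assms show "cls x = cls y"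
    unfolding cls_def by (auto intro: null_equiv_trans[of x y] null_equiv_trans[of y x])
qed

lemma completion_rep_cls:
  assumes "cauchy x"
  shows "cauchy (completion_rep (cls x))" "null_equiv x (completion_rep (cls x))"
proof -
  have "x \<in> cls x" using assms by (simp add: cls_def)
  then have "completion_rep (cls x) \<in> cls x" unfolding completion_rep_def by (rule someI[of "\<lambda>z. z \<in> cls x"])
  then show "cauchy (completion_rep (cls x))" "null_equiv x (completion_rep (cls x))"
    by (auto simp: cls_def)
qed

lemma completion_rep_cls':
  assumes "cauchy x" shows "null_equiv (completion_rep (cls x)) x"
  using completion_rep_cls[OF assms] assms by (auto intro: null_equiv_sym)

lemma carrier_K: "carrier K = cls ` Collect cauchy"
  by (auto simp: completion_def cauchy_seqs_iff)

lemma cls_in_K [simp]: "cauchy x \<Longrightarrow> cls x \<in> carrier K"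
  by (simp add: carrier_K)

lemma cls_cases [consumes 1]:
  assumes "U \<in> carrier K" obtains x where "cauchy x" "U = cls x"
  using assms by (auto simp: carrier_K)

lemma zero_K: "\<zero>\<^bsub>K\<^esub> = cls (\<lambda>_. \<zero>)" and one_K: "\<one>\<^bsub>K\<^esub> = cls (\<lambda>_. \<one>)"
  by (simp_all add: completion_def)

text \<open>\<open>completion\<close> computes with a chosen representative of each class. The
  chosen sequence differs from \<open>x\<close> by a null sequence and addition respects null
  sequences, so the choice is invisible; the other operations follow the same pattern.\<close>

lemma add_K:
  assumes "cauchy x" "cauchy y" shows "cls x \<oplus>\<^bsub>K\<^esub> cls y = cls (\<lambda>n. x n \<oplus> y n)"
  using assms completion_rep_cls completion_rep_cls'
  by (simp add: completion_def cls_eq_iff cauchy_add null_equiv_add)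

lemma mult_K:
  assumes "cauchy x" "cauchy y" shows "cls x \<otimes>\<^bsub>K\<^esub> cls y = cls (\<lambda>n. x n \<otimes> y n)"
  using assms completion_rep_cls completion_rep_cls'
  by (simp add: completion_def cls_eq_iff cauchy_mult null_equiv_mult)

lemma smult_K:
  assumes "cauchy x" shows "c \<odot>\<^bsub>K\<^esub> cls x = cls (\<lambda>n. c \<odot> x n)"
  using assms completion_rep_cls completion_rep_cls'
  by (simp add: completion_def cls_eq_iff cauchy_smult null_equiv_smult)

lemma star_K:
  assumes "cauchy x" shows "star K (cls x) = cls (\<lambda>n. star N (x n))"
  using assms completion_rep_cls completion_rep_cls'
  by (simp add: completion_def cls_eq_iff cauchy_star null_equiv_star)

lemma nrm_K_tendsto:
  assumes "cauchy x" shows "(\<lambda>n. nrm N (x n)) \<longlonglongrightarrow> nrm K (cls x)"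
  using null_equiv_norm_tendsto[OF _ _ completion_rep_cls'[OF assms]
      cauchy_norm_convergent[OF completion_rep_cls(1)[OF assms]]]
    assms completion_rep_cls(1)[OF assms]
  by (simp add: completion_def)

lemmas ops_K = zero_K one_K add_K mult_K smult_K star_K

lemma completion_star_alg: "star_alg K"
  by (rule star_algI; (elim cls_cases)?)
    (simp_all add: cauchy_const[OF zero_closed] cauchy_const[OF one_closed] ops_K cauchy_add cauchy_mult cauchy_smult cauchy_star a_assoc m_assoc l_distr r_distr
      smult_l_distr smult_r_distr smult_smult smult_mult_left smult_mult_right star_add star_smult star_mult,
     simp add: a_comm)

text \<open>Every law is an equation or a weak inequality between norms, hence survives the limit
  along representatives.\<close>

lemma completion_seminorm: "cstar_seminorm K (nrm K)"
  unfolding cstar_seminorm_def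
proof (intro conjI ballI allI)
  fix U assume U: "U \<in> carrier K"
  then obtain x where x: "cauchy x" "U = cls x" by (rule cls_cases)
  note lx = nrm_K_tendsto[OF x(1)]
  show "0 \<le> nrm K U" unfolding x using x by (intro LIMSEQ_le_const[OF lx]) auto
  show "nrm K (c \<odot>\<^bsub>K\<^esub> U) = cmod c * nrm K U" for c
    using x nrm_K_tendsto[OF cauchy_smult[OF x(1)], of c]
    by (simp add: smult_K) (metis LIMSEQ_unique lx tendsto_mult_left)
  have "(\<lambda>n. nrm N (star N (x n) \<otimes> x n)) \<longlonglongrightarrow> nrm K (star K U \<otimes>\<^bsub>K\<^esub> U)"
    using x nrm_K_tendsto[OF cauchy_mult[OF cauchy_star x(1)], of x] by (simp add: star_K mult_K cauchy_star)
  moreover have "(\<lambda>n. nrm N (star N (x n) \<otimes> x n)) \<longlonglongrightarrow> (nrm K U)\<^sup>2"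
    using x lx by (simp add: p_cstar tendsto_power)
  ultimately show "nrm K (star K U \<otimes>\<^bsub>K\<^esub> U) = (nrm K U)\<^sup>2" by (rule LIMSEQ_unique)
  fix V assume V: "V \<in> carrier K"
  then obtain y where y: "cauchy y" "V = cls y" by (rule cls_cases)
  note ly = nrm_K_tendsto[OF y(1)]
  show "nrm K (U \<oplus>\<^bsub>K\<^esub> V) \<le> nrm K U + nrm K V"
    using x y by (auto simp: add_K intro!: LIMSEQ_le[OF nrm_K_tendsto tendsto_add[OF lx ly]]
      cauchy_add exI[of _ 0] p_triangle)
  show "nrm K (U \<otimes>\<^bsub>K\<^esub> V) \<le> nrm K U * nrm K V"
    using x y by (auto simp: mult_K intro!: LIMSEQ_le[OF nrm_K_tendsto tendsto_mult[OF lx ly]]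
      cauchy_mult exI[of _ 0] p_mult_le)
qed

lemma completion_pre_cstar: "pre_cstar K"
  by (intro pre_cstarI completion_star_alg completion_seminorm)

lemma minus_K:
  assumes "cauchy x" "cauchy y"
  shows "cls x \<ominus>\<^bsub>K\<^esub> cls y = cls (\<lambda>n. x n \<ominus> y n)" "cauchy (\<lambda>n. x n \<ominus> y n)"
proof -
  interpret K: star_alg K by (rule completion_star_alg)
  have e: "(\<lambda>n. x n \<ominus> y n) = (\<lambda>n. x n \<oplus> (-1) \<odot> y n)"
    using assms by (simp add: minus_eq_smult)
  show "cauchy (\<lambda>n. x n \<ominus> y n)" unfolding e using assms by (intro cauchy_add cauchy_smult)
  show "cls x \<ominus>\<^bsub>K\<^esub> cls y = cls (\<lambda>n. x n \<ominus> y n)"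
    unfolding e using assms by (simp add: K.minus_eq_smult smult_K add_K cauchy_smult)
qed

lemma
  assumes "x \<in> carrier N"
  shows to_completion_closed [simp]: "to_completion N x \<in> carrier K"
    and nrm_to_completion [simp]: "nrm K (to_completion N x) = nrm N x"
  using cauchy_const[OF assms] nrm_K_tendsto[of "\<lambda>_. x"] by (auto simp: to_completion_def LIMSEQ_const_iff)

lemma to_completion_star_hom: "star_hom N K (to_completion N)"
  by (auto simp: star_hom_def Ring.ring_hom_def to_completion_def ops_K cauchy_const)

lemma to_completion_dense:
  assumes "cauchy x"
  shows "(\<lambda>n. nrm K (to_completion N (x n) \<ominus>\<^bsub>K\<^esub> cls x)) \<longlonglongrightarrow> 0"
proof (rule LIMSEQ_I)
  interpret K: pre_cstar K by (rule completion_pre_cstar)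
  fix e :: real assume "0 < e"
  then have "0 < e/2" by simp
  then obtain M where M: "\<And>m n. m \<ge> M \<Longrightarrow> n \<ge> M \<Longrightarrow> nrm N (x m \<ominus> x n) < e/2"
    using cauchyD[OF assms] by blast
  have "nrm K (to_completion N (x m) \<ominus>\<^bsub>K\<^esub> cls x) \<le> e/2" if "m \<ge> M" for m
  proof -
    \<comment> \<open>With \<open>m\<close> fixed, the distance from \<open>x m\<close> to the class
      is the limit in \<open>n\<close> of the distances to \<open>x n\<close>. The Cauchy condition
      bounds these by \<open>e/2\<close>; the limit keeps only a weak inequality, hence the halving
      of \<open>e\<close>.\<close>
    have "(\<lambda>n. nrm N (x m \<ominus> x n)) \<longlonglongrightarrow> nrm K (to_completion N (x m) \<ominus>\<^bsub>K\<^esub> cls x)"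
      using cauchy_const[of "x m"] minus_K[of "\<lambda>_. x m" x] nrm_K_tendsto[of "\<lambda>n. x m \<ominus> x n"] assms by (simp add: to_completion_def)
    then show ?thesis
      by (rule LIMSEQ_le_const2) (use M that in \<open>auto intro!: exI[of _ M] less_imp_le\<close>)
  qed
  then show "\<exists>M. \<forall>m\<ge>M. norm (nrm K (to_completion N (x m) \<ominus>\<^bsub>K\<^esub> cls x) - 0) < e"
    using \<open>0 < e\<close> assms by (intro exI[of _ M]) (fastforce intro: le_less_trans[of _ "e/2"])
qed

lemma completion_approx:
  assumes "U \<in> carrier K" "0 < e"
  obtains x where "x \<in> carrier N" "nrm K (U \<ominus>\<^bsub>K\<^esub> to_completion N x) < e"
proof -
  interpret K: pre_cstar K by (rule completion_pre_cstar)
  obtain x where x: "cauchy x" "U = cls x" using assms(1) by (rule cls_cases)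
  have "\<forall>\<^sub>F n in sequentially. nrm K (to_completion N (x n) \<ominus>\<^bsub>K\<^esub> U) < e"
    using order_tendstoD(2)[OF to_completion_dense[OF x(1)] assms(2)] x by simp
  then obtain n where "nrm K (to_completion N (x n) \<ominus>\<^bsub>K\<^esub> U) < e"
    by (auto simp: eventually_sequentially)
  with that[of "x n"] show thesis
    using x assms K.p_minus_commute[of "to_completion N (x n)" U] by simp
qed

text \<open>Completeness by a diagonal choice: each member \<open>s k\<close> of a Cauchy sequence
  of classes is replaced by an element \<open>y k\<close> of \<open>N\<close> at distance below
  \<open>1 / (k + 1)\<close>. Then \<open>y\<close> is Cauchy in \<open>N\<close>, and its class is
  the limit of \<open>s\<close>.\<close>

theorem completion_cstar_algebra: "cstar_algebra K"
proof (rule cstar_algebraI[OF completion_star_alg completion_seminorm])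
  interpret K: pre_cstar K by (rule completion_pre_cstar)
  show "U = \<zero>\<^bsub>K\<^esub>" if U: "U \<in> carrier K" "nrm K U = 0" for U
  proof -
    obtain x where x: "cauchy x" "U = cls x" using U(1) by (rule cls_cases)
    then have "null_equiv x (\<lambda>_. \<zero>)"
      using nrm_K_tendsto[OF x(1)] U by (simp add: null_equiv_def minus_eq)
    then show ?thesis using x cauchy_const[OF zero_closed] by (simp add: zero_K cls_eq_iff)
  qed
  fix s assume "s \<in> cauchy_seqs K"
  then have s: "K.cauchy s" by (simp add: K.cauchy_seqs_iff)
  have "\<exists>y. y \<in> carrier N \<and> nrm K (s k \<ominus>\<^bsub>K\<^esub> to_completion N y) < inverse (real (Suc k))" for k
    using completion_approx[of "s k" "inverse (real (Suc k))"] s by (metis K.cauchy_closed inverse_positive_iff_positive of_nat_0_less_iff zero_less_Suc)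
  then obtain y where y: "\<And>k. y k \<in> carrier N"
      "\<And>k. nrm K (s k \<ominus>\<^bsub>K\<^esub> to_completion N (y k)) < inverse (real (Suc k))"
    by metis
  have eqv: "K.null_equiv s (\<lambda>k. to_completion N (y k))"
    by (rule K.null_equivI[OF _ _ _ LIMSEQ_inverse_real_of_nat]) (use s y in \<open>auto intro: less_imp_le\<close>)
  have "cauchy y"
  proof (rule cauchyI)
    fix e :: real assume "0 < e"
    then have e3: "0 < e/3" by simp
    obtain M where M: "\<And>m n. m \<ge> M \<Longrightarrow> n \<ge> M \<Longrightarrow> nrm K (s m \<ominus>\<^bsub>K\<^esub> s n) < e/3"
      using K.cauchyD[OF s e3] by blast
    obtain L where L: "\<And>n. n \<ge> L \<Longrightarrow> nrm K (s n \<ominus>\<^bsub>K\<^esub> to_completion N (y n)) < e/3"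
      using order_tendstoD(2)[OF eqv[unfolded K.null_equiv_def] e3] by (auto simp: eventually_sequentially)
    have "nrm N (y m \<ominus> y n) < e" if "m \<ge> max L M" "n \<ge> max L M" for m n
    proof -
      let ?t = "\<lambda>k. to_completion N (y k)"
      have "nrm N (y m \<ominus> y n) = nrm K (?t m \<ominus>\<^bsub>K\<^esub> ?t n)"
        using y cauchy_const[of "y m"] cauchy_const[of "y n"] minus_K[of "\<lambda>_. y m" "\<lambda>_. y n"] nrm_to_completion[of "y m \<ominus> y n"]
        by (simp add: to_completion_def)
      also have "\<dots> \<le> nrm K (?t m \<ominus>\<^bsub>K\<^esub> s m) + nrm K (s m \<ominus>\<^bsub>K\<^esub> ?t n)"
        using s y by (intro K.p_minus_triangle) auto
      also have "nrm K (s m \<ominus>\<^bsub>K\<^esub> ?t n) \<le> nrm K (s m \<ominus>\<^bsub>K\<^esub> s n) + nrm K (s n \<ominus>\<^bsub>K\<^esub> ?t n)"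
        using s y by (intro K.p_minus_triangle) auto
      also have "nrm K (?t m \<ominus>\<^bsub>K\<^esub> s m) = nrm K (s m \<ominus>\<^bsub>K\<^esub> ?t m)"
        using s y by (intro K.p_minus_commute) auto
      finally show ?thesis using L[of m] L[of n] M[of m n] that by simp
    qed
    then show "\<exists>N'. \<forall>m\<ge>N'. \<forall>n\<ge>N'. nrm N (y m \<ominus> y n) < e" by blast
  qed (rule y)
  moreover have "K.null_equiv s (\<lambda>_. cls y)"
    using K.null_equiv_trans[OF _ _ _ eqv] to_completion_dense[OF \<open>cauchy y\<close>] s y \<open>cauchy y\<close>
    unfolding K.null_equiv_def by simp
  ultimately show "\<exists>U\<in>carrier K. (\<lambda>n. nrm K (s n \<ominus>\<^bsub>K\<^esub> U)) \<longlonglongrightarrow> 0"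
    unfolding K.null_equiv_def by auto
qed

text \<open>Elements of \<open>N\<close> are dense in the completion; the bound with constant 1 is
  the one that \<open>states\<close> provides.\<close>

lemma bounded_functionals_eqI:
  assumes h: "linear_functional K h" "\<And>U. U \<in> carrier K \<Longrightarrow> cmod (h U) \<le> nrm K U"
    and h': "linear_functional K h'" "\<And>U. U \<in> carrier K \<Longrightarrow> cmod (h' U) \<le> nrm K U"
    and eq: "\<And>x. x \<in> carrier N \<Longrightarrow> h (to_completion N x) = h' (to_completion N x)"
    and U: "U \<in> carrier K"
  shows "h U = h' U"
proof -
  interpret K: pre_cstar K by (rule completion_pre_cstar)
  have diff: "h (V \<ominus>\<^bsub>K\<^esub> W) = h V - h W" "h' (V \<ominus>\<^bsub>K\<^esub> W) = h' V - h' W"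
    if "V \<in> carrier K" "W \<in> carrier K" for V W
    using that h(1) h'(1) by (simp_all add: K.minus_eq_smult linear_functional_def)
  have "cmod (h U - h' U) \<le> 0 + e" if "0 < e" for e
  proof -
    have "0 < e/2" using that by simp
    then obtain x where x: "x \<in> carrier N" "nrm K (U \<ominus>\<^bsub>K\<^esub> to_completion N x) < e/2"
      using completion_approx[OF U] by blast
    have "h U - h' U = h (U \<ominus>\<^bsub>K\<^esub> to_completion N x) - h' (U \<ominus>\<^bsub>K\<^esub> to_completion N x)"
      using x U eq by (simp add: diff)
    also have "cmod \<dots> \<le> nrm K (U \<ominus>\<^bsub>K\<^esub> to_completion N x) + nrm K (U \<ominus>\<^bsub>K\<^esub> to_completion N x)"
      using x U h(2) h'(2) by (intro order_trans[OF norm_triangle_ineq4] add_mono) auto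
    finally show ?thesis using x by simp
  qed
  then have "cmod (h U - h' U) \<le> 0" by (rule field_le_epsilon)
  then show ?thesis by simp
qed

end

section \<open>Homomorphisms and their extension to completions\<close>

lemma star_homD:
  assumes "star_hom A B h"
  shows "x \<in> carrier A \<Longrightarrow> h x \<in> carrier B"
    and "\<lbrakk>x \<in> carrier A; y \<in> carrier A\<rbrakk> \<Longrightarrow> h (x \<oplus>\<^bsub>A\<^esub> y) = h x \<oplus>\<^bsub>B\<^esub> h y"
    and "\<lbrakk>x \<in> carrier A; y \<in> carrier A\<rbrakk> \<Longrightarrow> h (x \<otimes>\<^bsub>A\<^esub> y) = h x \<otimes>\<^bsub>B\<^esub> h y"
    and "h \<one>\<^bsub>A\<^esub> = \<one>\<^bsub>B\<^esub>"
    and "x \<in> carrier A \<Longrightarrow> h (c \<odot>\<^bsub>A\<^esub> x) = c \<odot>\<^bsub>B\<^esub> h x"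
    and "x \<in> carrier A \<Longrightarrow> h (star A x) = star B (h x)"
  using assms by (auto simp: star_hom_def Ring.ring_hom_def)

lemma star_homI:
  assumes "\<And>x. x \<in> carrier A \<Longrightarrow> h x \<in> carrier B"
    and "\<And>x y. \<lbrakk>x \<in> carrier A; y \<in> carrier A\<rbrakk> \<Longrightarrow> h (x \<oplus>\<^bsub>A\<^esub> y) = h x \<oplus>\<^bsub>B\<^esub> h y"
    and "\<And>x y. \<lbrakk>x \<in> carrier A; y \<in> carrier A\<rbrakk> \<Longrightarrow> h (x \<otimes>\<^bsub>A\<^esub> y) = h x \<otimes>\<^bsub>B\<^esub> h y"
    and "h \<one>\<^bsub>A\<^esub> = \<one>\<^bsub>B\<^esub>"
    and "\<And>c x. x \<in> carrier A \<Longrightarrow> h (c \<odot>\<^bsub>A\<^esub> x) = c \<odot>\<^bsub>B\<^esub> h x"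
    and "\<And>x. x \<in> carrier A \<Longrightarrow> h (star A x) = star B (h x)"
  shows "star_hom A B h"
  using assms by (auto simp: star_hom_def Ring.ring_hom_def)

text \<open>A contraction preserves Cauchy sequences and null equivalence, so the limit of the
  images depends on the class alone. Injectivity is a conditional conclusion because the lemma
  serves both an isometry, the embedding of the infinite tensor product, and a mere contraction, the
  map between maximal tensor products.\<close>

lemma star_hom_extends_to_completion:
  fixes N :: "'a normed_star_algebra" and A :: "'b normed_star_algebra"
  assumes "pre_cstar N" "cstar_algebra A" and f: "star_hom N A f"
    and contr: "\<And>x. x \<in> carrier N \<Longrightarrow> nrm A (f x) \<le> nrm N x"
  obtains F where "star_hom (completion N) A F"
    and "\<And>x. x \<in> carrier N \<Longrightarrow> F (to_completion N x) = f x"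
    and "\<And>U. U \<in> carrier (completion N) \<Longrightarrow> nrm A (F U) \<le> nrm (completion N) U"
    and "(\<And>x. x \<in> carrier N \<Longrightarrow> nrm A (f x) = nrm N x) \<Longrightarrow> inj_on F (carrier (completion N))"
proof -
  interpret N: pre_cstar N by fact
  interpret A: pre_cstar A by (rule cstar_algebra_imp_pre_cstar) fact
  interpret K: pre_cstar "completion N" by (rule N.completion_pre_cstar)
  note fs = star_homD[OF f]
  have f_minus: "f (x \<ominus>\<^bsub>N\<^esub> y) = f x \<ominus>\<^bsub>A\<^esub> f y" if "x \<in> carrier N" "y \<in> carrier N" for x y
    using that by (simp add: N.minus_eq_smult A.minus_eq_smult fs)
  have fc: "f (x n) \<in> carrier A" if "N.cauchy x" for x n
    using that by (simp add: fs)
  have f_cauchy: "A.cauchy (\<lambda>n. f (x n))" if x: "N.cauchy x" for x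
  proof (rule A.cauchyI)
    fix e :: real assume "0 < e"
    then obtain M where M: "\<And>m n. m \<ge> M \<Longrightarrow> n \<ge> M \<Longrightarrow> nrm N (x m \<ominus>\<^bsub>N\<^esub> x n) < e"
      using N.cauchyD[OF x] by blast
    have "nrm A (f (x m) \<ominus>\<^bsub>A\<^esub> f (x n)) < e" if "m \<ge> M" "n \<ge> M" for m n
      using M[OF that] contr[of "x m \<ominus>\<^bsub>N\<^esub> x n"] x by (simp add: f_minus)
    then show "\<exists>M. \<forall>m\<ge>M. \<forall>n\<ge>M. nrm A (f (x m) \<ominus>\<^bsub>A\<^esub> f (x n)) < e" by blast
  qed (use x fs in auto)
  have f_equiv: "A.null_equiv (\<lambda>n. f (x n)) (\<lambda>n. f (y n))"
    if "N.cauchy x" "N.cauchy y" "N.null_equiv x y" for x y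
    by (rule A.null_equivI[where f = "\<lambda>n. nrm N (x n \<ominus>\<^bsub>N\<^esub> y n)"])
      (use that fs contr f_minus in \<open>auto simp: N.null_equiv_def simp flip: f_minus\<close>)
  define F where "F U = (SOME a. a \<in> carrier A \<and> A.null_equiv (\<lambda>n. f (completion_rep U n)) (\<lambda>_. a))" for U
  have F_lim: "F (completion_class N x) \<in> carrier A \<and>
      A.null_equiv (\<lambda>n. f (x n)) (\<lambda>_. F (completion_class N x))" if x: "N.cauchy x" for x
  proof -
    let ?r = "completion_rep (completion_class N x)"
    have r: "N.cauchy ?r" "N.null_equiv x ?r" using N.completion_rep_cls[OF x] .
    have ex: "\<exists>a. a \<in> carrier A \<and> A.null_equiv (\<lambda>n. f (?r n)) (\<lambda>_. a)"
      using cstar_algebra.norm_complete[OF assms(2), of "\<lambda>n. f (?r n)"] f_cauchy[OF r(1)]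
      by (auto simp: A.cauchy_seqs_iff A.null_equiv_def)
    have F: "F (completion_class N x) \<in> carrier A"
        "A.null_equiv (\<lambda>n. f (?r n)) (\<lambda>_. F (completion_class N x))"
      by (rule conjunct1[OF someI_ex[OF ex, folded F_def]], rule conjunct2[OF someI_ex[OF ex, folded F_def]])
    then show ?thesis
      using A.null_equiv_trans[OF _ _ _ f_equiv[OF x r] F(2)] x r fs by simp
  qed
  \<comment> \<open>Uniqueness of limits reduces each homomorphism law for \<open>F\<close> to
    compatibility of an operation with null equivalence.\<close>
  have F_unique: "F (completion_class N x) = a"
    if x: "N.cauchy x" and a: "a \<in> carrier A" "A.null_equiv (\<lambda>n. f (x n)) (\<lambda>_. a)" for x a
    using A.limit_unique[OF assms(2) fc[OF x] conjunct1[OF F_lim[OF x]] a(1) conjunct2[OF F_lim[OF x]] a(2)] .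
  have F_nrm: "(\<lambda>n. nrm A (f (x n))) \<longlonglongrightarrow> nrm A (F (completion_class N x))" if x: "N.cauchy x" for x
  proof -
    have s: "A.null_equiv (\<lambda>_. F (completion_class N x)) (\<lambda>n. f (x n))"
      by (rule A.null_equiv_sym[OF _ _ conjunct2[OF F_lim[OF x]]]) (rule F_lim[OF x, THEN conjunct1] fc[OF x])+
    show ?thesis
      by (rule A.null_equiv_norm_tendsto[OF _ _ s tendsto_const]) (rule F_lim[OF x, THEN conjunct1] fc[OF x])+
  qed
  have hom: "star_hom (completion N) A F"
  proof (rule star_homI)
    fix U assume "U \<in> carrier (completion N)"
    then obtain x where x: "N.cauchy x" "U = completion_class N x" by (rule N.cls_cases)
    note Fx = F_lim[OF x(1)]
    show "F U \<in> carrier A" using Fx x by simp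
    show "F (c \<odot>\<^bsub>completion N\<^esub> U) = c \<odot>\<^bsub>A\<^esub> F U" for c
      using x Fx fs A.null_equiv_smult[of "\<lambda>n. f (x n)" "\<lambda>_. F U" c]
      by (simp add: N.smult_K F_unique N.cauchy_smult)
    show "F (star (completion N) U) = star A (F U)"
      using x Fx fs A.null_equiv_star[of "\<lambda>n. f (x n)" "\<lambda>_. F U"]
      by (simp add: N.star_K F_unique N.cauchy_star)
    fix V assume "V \<in> carrier (completion N)"
    then obtain y where y: "N.cauchy y" "V = completion_class N y" by (rule N.cls_cases)
    note Fy = F_lim[OF y(1)]
    show "F (U \<oplus>\<^bsub>completion N\<^esub> V) = F U \<oplus>\<^bsub>A\<^esub> F V"
      using x Fx y Fy fs A.null_equiv_add[of "\<lambda>n. f (x n)" "\<lambda>n. f (y n)" "\<lambda>_. F U" "\<lambda>_. F V"]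
      by (simp add: N.add_K F_unique N.cauchy_add)
    show "F (U \<otimes>\<^bsub>completion N\<^esub> V) = F U \<otimes>\<^bsub>A\<^esub> F V"
      using x Fx y Fy fs f_cauchy A.cauchy_const[of "F U"] A.cauchy_const[of "F V"] A.null_equiv_mult[of "\<lambda>n. f (x n)" "\<lambda>n. f (y n)" "\<lambda>_. F U" "\<lambda>_. F V"]
      by (simp add: N.mult_K F_unique N.cauchy_mult)
  next
    show "F \<one>\<^bsub>completion N\<^esub> = \<one>\<^bsub>A\<^esub>"
      using fs N.cauchy_const[OF N.one_closed] by (simp add: N.one_K F_unique)
  qed
  show thesis
  proof (rule that[OF hom])
    show "F (to_completion N x) = f x" if "x \<in> carrier N" for x
      unfolding to_completion_def by (intro F_unique N.cauchy_const A.null_equiv_refl fs(1) that)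
    show "nrm A (F U) \<le> nrm (completion N) U" if U: "U \<in> carrier (completion N)" for U
    proof -
      obtain x where x: "N.cauchy x" "U = completion_class N x" using U by (rule N.cls_cases)
      show ?thesis unfolding x(2)
        by (rule LIMSEQ_le[OF F_nrm[OF x(1)] N.nrm_K_tendsto[OF x(1)]]) (use x contr in auto)
    qed
    assume iso: "\<And>x. x \<in> carrier N \<Longrightarrow> nrm A (f x) = nrm N x"
    have nrm_eq: "nrm A (F U) = nrm (completion N) U" if U: "U \<in> carrier (completion N)" for U
    proof -
      obtain x where x: "N.cauchy x" "U = completion_class N x" using U by (rule N.cls_cases)
      show ?thesis unfolding x(2)
        using F_nrm[OF x(1)] N.nrm_K_tendsto[OF x(1)] x iso by (simp add: LIMSEQ_unique)
    qed
    show "inj_on F (carrier (completion N))"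
    proof (rule inj_onI)
      fix U V assume UV: "U \<in> carrier (completion N)" "V \<in> carrier (completion N)" "F U = F V"
      have "F (U \<ominus>\<^bsub>completion N\<^esub> V) = F U \<ominus>\<^bsub>A\<^esub> F V"
        using UV star_homD[OF hom] by (simp add: K.minus_eq_smult A.minus_eq_smult)
      also have "\<dots> = \<zero>\<^bsub>A\<^esub>" using UV star_homD(1)[OF hom] by (simp add: A.minus_eq A.r_neg)
      finally have "nrm (completion N) (U \<ominus>\<^bsub>completion N\<^esub> V) = 0"
        using nrm_eq[of "U \<ominus>\<^bsub>completion N\<^esub> V"] UV by simp
      then have "U \<ominus>\<^bsub>completion N\<^esub> V = \<zero>\<^bsub>completion N\<^esub>"
        using cstar_algebra.norm_definite[OF N.completion_cstar_algebra K.minus_closed[OF UV(1,2)]] by blast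
      then show "U = V" by (rule K.minus_eq_zeroD[OF UV(1,2)])
    qed
  qed
qed

section \<open>Positive functionals\<close>

text \<open>Neither normalised nor bounded, in contrast to \<open>states\<close>. On complex numbers
  \<open>0 \<le>\<close> includes that the value is real.\<close>

definition positive_functional :: "('a, 'm) star_algebra_scheme \<Rightarrow> ('a \<Rightarrow> complex) \<Rightarrow> bool" where
  "positive_functional T \<omega> \<longleftrightarrow>
     linear_functional T \<omega> \<and> (\<forall>x\<in>carrier T. 0 \<le> \<omega> (star T x \<otimes>\<^bsub>T\<^esub> x))"

definition gns_seminorm :: "('a, 'm) star_algebra_scheme \<Rightarrow> ('a \<Rightarrow> complex) \<Rightarrow> 'a \<Rightarrow> real" where
  "gns_seminorm T \<omega> x = sqrt (Re (\<omega> (star T x \<otimes>\<^bsub>T\<^esub> x)))"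

text \<open>Polarisation: \<open>l = 1\<close> gives opposite imaginary parts and
  \<open>l = \<i>\<close> equal real parts.\<close>

lemma hermitian_pair:
  fixes z w :: complex
  assumes "\<And>l. Im (l * z + cnj l * w) = 0" shows "w = cnj z"
  using assms[of 1] assms[of \<i>] by (simp add: complex_eq_iff)

text \<open>For \<open>l = - (t * cnj z)\<close> with real \<open>t\<close> the assumption says that
  a real quadratic polynomial in \<open>t\<close> is nonnegative. Its value at
  \<open>t = 1 / b\<close> is the inequality; for \<open>b = 0\<close> the polynomial is affine,
  which forces \<open>z = 0\<close>.\<close>

lemma cauchy_schwarz_pair:
  fixes z :: complex
  assumes "0 \<le> a" "0 \<le> b" "\<And>l. 0 \<le> a + Re (l * z + cnj l * cnj z) + (cmod l)\<^sup>2 * b"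
  shows "(cmod z)\<^sup>2 \<le> a * b"
proof -
  have q: "0 \<le> a - 2 * t * (cmod z)\<^sup>2 + t\<^sup>2 * (cmod z)\<^sup>2 * b" for t :: real
  proof -
    let ?l = "- (of_real t * cnj z)"
    have "Re (?l * z + cnj ?l * cnj z) = - 2 * t * (cmod z)\<^sup>2"
      unfolding cmod_power2 by (simp add: algebra_simps power2_eq_square)
    moreover have "(cmod ?l)\<^sup>2 = t\<^sup>2 * (cmod z)\<^sup>2" by (simp add: norm_mult power_mult_distrib)
    ultimately show ?thesis using assms(3)[of ?l] by simp
  qed
  show ?thesis
  proof (cases "b = 0")
    case True
    have "z = 0"
    proof (rule ccontr)
      assume "z \<noteq> 0"
      \<comment> \<open>At this \<open>t\<close> the affine function takes the value -1.\<close>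
      then show False using q[of "(a + 1) / (2 * (cmod z)\<^sup>2)"] True by simp
    qed
    then show ?thesis using True by simp
  next
    case False
    then have "0 \<le> a - (cmod z)\<^sup>2 / b"
      using q[of "1 / b"] by (simp add: power2_eq_square)
    then show ?thesis using False assms(2) by (simp add: field_simps)
  qed
qed

context star_alg
begin

lemma linear_functional_add:
  "\<lbrakk>linear_functional T \<phi>; x \<in> carrier T; y \<in> carrier T\<rbrakk> \<Longrightarrow> \<phi> (x \<oplus> y) = \<phi> x + \<phi> y"
  and linear_functional_smult:
  "\<lbrakk>linear_functional T \<phi>; x \<in> carrier T\<rbrakk> \<Longrightarrow> \<phi> (c \<odot> x) = c * \<phi> x"
  by (auto simp: linear_functional_def)

lemma linear_functional_zero: "linear_functional T \<phi> \<Longrightarrow> \<phi> \<zero> = 0"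
  using linear_functional_smult[of \<phi> \<zero> 0] by simp

context
  fixes \<omega> assumes \<omega>: "positive_functional T \<omega>"
begin

lemma positive_linear: "linear_functional T \<omega>"
  using \<omega> by (simp add: positive_functional_def)

lemma positive_nonneg: "x \<in> carrier T \<Longrightarrow> 0 \<le> \<omega> (star T x \<otimes> x)"
  using \<omega> by (simp add: positive_functional_def)

lemma positive_expand:
  assumes "x \<in> carrier T" "y \<in> carrier T"
  shows "\<omega> (star T (x \<oplus> l \<odot> y) \<otimes> (x \<oplus> l \<odot> y)) =
    \<omega> (star T x \<otimes> x) + (l * \<omega> (star T x \<otimes> y) + cnj l * \<omega> (star T y \<otimes> x)) + (cmod l)\<^sup>2 * \<omega> (star T y \<otimes> y)"
proof -
  have "star T (x \<oplus> l \<odot> y) \<otimes> (x \<oplus> l \<odot> y) =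
      (star T x \<otimes> x \<oplus> l \<odot> (star T x \<otimes> y)) \<oplus> (cnj l \<odot> (star T y \<otimes> x) \<oplus> (cnj l * l) \<odot> (star T y \<otimes> y))"
    using assms by (simp add: star_add star_smult l_distr r_distr smult_mult_left smult_mult_right
        smult_r_distr smult_smult a_ac mult.commute)
  then show ?thesis using assms
    by (simp add: linear_functional_add[OF positive_linear] linear_functional_smult[OF positive_linear]
        complex_norm_square mult.commute del: of_real_power)
qed

text \<open>Compatibility with the involution is a consequence of positivity: the values
  \<open>\<omega> (star T z \<otimes> z)\<close> are real for every
  \<open>z = x \<oplus> l \<odot> y\<close>.\<close>

lemma positive_hermitian:
  assumes "x \<in> carrier T" "y \<in> carrier T"
  shows "\<omega> (star T y \<otimes> x) = cnj (\<omega> (star T x \<otimes> y))"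
proof (rule hermitian_pair)
  fix l
  have "Im (\<omega> (star T (x \<oplus> l \<odot> y) \<otimes> (x \<oplus> l \<odot> y))) = 0"
    "Im (\<omega> (star T x \<otimes> x)) = 0" "Im (\<omega> (star T y \<otimes> y)) = 0"
    using assms positive_nonneg by (simp_all add: less_eq_complex_def)
  then show "Im (l * \<omega> (star T x \<otimes> y) + cnj l * \<omega> (star T y \<otimes> x)) = 0"
    using positive_expand[OF assms, of l] by (simp del: of_real_power)
qed

lemma gns_seminorm_nonneg: "x \<in> carrier T \<Longrightarrow> 0 \<le> gns_seminorm T \<omega> x"
  using positive_nonneg by (simp add: gns_seminorm_def less_eq_complex_def)

lemma gns_seminorm_power2: "x \<in> carrier T \<Longrightarrow> (gns_seminorm T \<omega> x)\<^sup>2 = Re (\<omega> (star T x \<otimes> x))"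
  using positive_nonneg by (simp add: gns_seminorm_def less_eq_complex_def)

lemma positive_eq_gns_seminorm: "x \<in> carrier T \<Longrightarrow> \<omega> (star T x \<otimes> x) = of_real ((gns_seminorm T \<omega> x)\<^sup>2)"
  using positive_nonneg[of x] by (simp add: gns_seminorm_power2 complex_eq_iff less_eq_complex_def)

lemma gns_cauchy_schwarz:
  assumes "x \<in> carrier T" "y \<in> carrier T"
  shows "cmod (\<omega> (star T x \<otimes> y)) \<le> gns_seminorm T \<omega> x * gns_seminorm T \<omega> y"
proof (rule power2_le_imp_le)
  show "(cmod (\<omega> (star T x \<otimes> y)))\<^sup>2 \<le> (gns_seminorm T \<omega> x * gns_seminorm T \<omega> y)\<^sup>2"
    unfolding power_mult_distrib gns_seminorm_power2[OF assms(1)] gns_seminorm_power2[OF assms(2)]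
  proof (rule cauchy_schwarz_pair)
    show "0 \<le> Re (\<omega> (star T x \<otimes> x))" "0 \<le> Re (\<omega> (star T y \<otimes> y))"
      using assms positive_nonneg by (simp_all add: less_eq_complex_def)
    fix l
    have "0 \<le> Re (\<omega> (star T (x \<oplus> l \<odot> y) \<otimes> (x \<oplus> l \<odot> y)))"
      using assms positive_nonneg[of "x \<oplus> l \<odot> y"] by (simp add: less_eq_complex_def)
    then show "0 \<le> Re (\<omega> (star T x \<otimes> x)) +
        Re (l * \<omega> (star T x \<otimes> y) + cnj l * cnj (\<omega> (star T x \<otimes> y))) + (cmod l)\<^sup>2 * Re (\<omega> (star T y \<otimes> y))"
      unfolding positive_expand[OF assms] positive_hermitian[OF assms] by (simp del: of_real_power)
  qed
qed (use assms gns_seminorm_nonneg in simp)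

lemma gns_seminorm_triangle:
  assumes "x \<in> carrier T" "y \<in> carrier T"
  shows "gns_seminorm T \<omega> (x \<oplus> y) \<le> gns_seminorm T \<omega> x + gns_seminorm T \<omega> y"
proof (rule power2_le_imp_le)
  have "(gns_seminorm T \<omega> (x \<oplus> y))\<^sup>2 =
      (gns_seminorm T \<omega> x)\<^sup>2 + 2 * Re (\<omega> (star T x \<otimes> y)) + (gns_seminorm T \<omega> y)\<^sup>2"
    using positive_expand[OF assms, of 1] assms by (simp add: gns_seminorm_power2 positive_hermitian[OF assms])
  also have "Re (\<omega> (star T x \<otimes> y)) \<le> gns_seminorm T \<omega> x * gns_seminorm T \<omega> y"
    by (rule order_trans[OF complex_Re_le_cmod gns_cauchy_schwarz[OF assms]])
  finally show "(gns_seminorm T \<omega> (x \<oplus> y))\<^sup>2 \<le> (gns_seminorm T \<omega> x + gns_seminorm T \<omega> y)\<^sup>2"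
    by (simp add: power2_sum)
qed (use assms gns_seminorm_nonneg in simp)

lemma gns_seminorm_smult:
  assumes "x \<in> carrier T"
  shows "gns_seminorm T \<omega> (c \<odot> x) = cmod c * gns_seminorm T \<omega> x"
proof -
  have "\<omega> (star T (c \<odot> x) \<otimes> (c \<odot> x)) = (cmod c)\<^sup>2 * \<omega> (star T x \<otimes> x)"
    using assms by (simp add: star_smult smult_mult_left smult_mult_right smult_smult
        linear_functional_smult[OF positive_linear] complex_norm_square mult_ac del: of_real_power)
  then show ?thesis by (simp add: gns_seminorm_def real_sqrt_mult del: of_real_power)
qed

end
end

subsection \<open>Square roots in C*-algebras\<close>

text \<open>The square root is \<open>1 - v\<close> for the fixed point \<open>v\<close> of the contraction \<open>v \<mapsto> (x + v\<^sup>2) / 2\<close>.\<close>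

lemma cstar_sqrt_one_minus:
  fixes A :: "'a normed_star_algebra" (structure)
  assumes A: "cstar_algebra A" and x: "x \<in> carrier A" "star A x = x" "nrm A x < 1"
  obtains k where "k \<in> carrier A" "star A k = k" "k \<otimes> k = \<one> \<ominus> x"
    "\<And>z. \<lbrakk>z \<in> carrier A; z \<otimes> x = x \<otimes> z\<rbrakk> \<Longrightarrow> z \<otimes> k = k \<otimes> z"
proof -
  interpret pre_cstar A by (rule cstar_algebra_imp_pre_cstar[OF A])
  define y where "y = (\<lambda>n. ((\<lambda>v. (1/2) \<odot> (x \<oplus> v \<otimes> v)) ^^ n) \<zero>)"
  have y0: "y 0 = \<zero>" and ySuc: "y (Suc n) = (1/2) \<odot> (x \<oplus> y n \<otimes> y n)" for n
    by (simp_all add: y_def)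
  \<comment> \<open>The smaller root of \<open>q = (nrm A x + q * q) / 2\<close>, so the iteration
    maps the ball of radius \<open>q\<close> to itself. It is below 1 because
    \<open>nrm A x < 1\<close>, and it is also the contraction factor.\<close>
  define q where "q = 1 - sqrt (1 - nrm A x)"
  have r: "0 \<le> nrm A x" "nrm A x < 1" using x by auto
  have q: "0 \<le> q" "q < 1" using r by (auto simp: q_def)
  have qfix: "(nrm A x + q * q) / 2 = q"
  proof -
    have "sqrt (1 - nrm A x) * sqrt (1 - nrm A x) = 1 - nrm A x" using r by simp
    then show ?thesis by (simp add: q_def algebra_simps)
  qed
  have yc [simp]: "y n \<in> carrier A" for n
    by (induction n) (use x in \<open>auto simp: y0 ySuc\<close>)
  have ystar: "star A (y n) = y n" for n
    by (induction n) (use x in \<open>auto simp: y0 ySuc star_smult star_add star_mult\<close>)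
  have ycomm: "z \<otimes> y n = y n \<otimes> z" if "z \<in> carrier A" "z \<otimes> x = x \<otimes> z" for z n
    by (induction n) (use x that in \<open>simp_all add: y0 ySuc smult_mult_left smult_mult_right l_distr r_distr commute_mult\<close>)
  have ynorm: "nrm A (y n) \<le> q" for n
  proof (induction n)
    case 0 then show ?case using q by (simp add: y0)
  next
    case (Suc n)
    have "nrm A (y n \<otimes> y n) \<le> q * q"
      by (rule order_trans[OF p_mult_le mult_mono]) (use Suc q in auto)
    then have "nrm A (x \<oplus> y n \<otimes> y n) \<le> nrm A x + q * q"
      using p_triangle[of x "y n \<otimes> y n"] x by simp
    then show ?case using x qfix by (simp add: ySuc)
  qed
  have step: "nrm A (y (Suc n) \<ominus> y n) \<le> q ^ n" for n
  proof (induction n)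
    case 0 then show ?case using x by (simp add: y0 ySuc minus_eq)
  next
    case (Suc n)
    let ?u = "y (Suc n)" and ?v = "y n"
    \<comment> \<open>Both iterates are polynomials in \<open>x\<close> and therefore commute, so
      the difference of their squares factors.\<close>
    have uv: "?v \<otimes> ?u = ?u \<otimes> ?v"
      using ycomm[of "?v" "Suc n"] ycomm[of x n] x by simp
    have e: "y (Suc (Suc n)) \<ominus> ?u = (1/2) \<odot> ((?u \<ominus> ?v) \<otimes> (?u \<oplus> ?v))"
    proof -
      have "(?u \<ominus> ?v) \<otimes> (?u \<oplus> ?v) = (?u \<otimes> ?u) \<ominus> (?v \<otimes> ?v)"
        by (simp add: minus_eq l_distr r_distr l_minus minus_add uv a_assoc r_neg1 r_neg2)
      also have "\<dots> = (x \<oplus> ?u \<otimes> ?u) \<ominus> (x \<oplus> ?v \<otimes> ?v)"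
        using x by (simp add: minus_eq minus_add a_ac r_neg1 r_neg2)
      finally show ?thesis
        using x by (simp add: ySuc[of "Suc n"] ySuc[of n] minus_eq_smult smult_r_distr smult_smult)
    qed
    have "nrm A ((?u \<ominus> ?v) \<otimes> (?u \<oplus> ?v)) \<le> q ^ n * (q + q)"
      by (intro order_trans[OF p_mult_le] mult_mono order_trans[OF p_triangle] add_mono ynorm Suc)
        (use q in auto)
    then show ?case unfolding e by (simp add: mult_ac)
  qed
  \<comment> \<open>Multiplied by \<open>1 - q\<close>, the geometric sum of the step bounds
    telescopes.\<close>
  have dist: "nrm A (y (n + k) \<ominus> y n) * (1 - q) \<le> q ^ n - q ^ (n + k)" for n k
  proof (induction k)
    case 0 then show ?case by (simp add: minus_eq r_neg)
  next
    case (Suc k)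
    have "nrm A (y (n + Suc k) \<ominus> y n) \<le> q ^ (n + k) + nrm A (y (n + k) \<ominus> y n)"
      using p_minus_triangle[of "y (Suc (n + k))" "y (n + k)" "y n"] step[of "n + k"] by simp
    then have "nrm A (y (n + Suc k) \<ominus> y n) * (1 - q) \<le> (q ^ (n + k) + nrm A (y (n + k) \<ominus> y n)) * (1 - q)"
      using q by (intro mult_right_mono) auto
    also have "\<dots> \<le> q ^ n - q ^ (n + Suc k)" using Suc by (simp add: algebra_simps)
    finally show ?case .
  qed
  have dist': "nrm A (y m \<ominus> y n) \<le> q ^ n / (1 - q)" if "n \<le> m" for m n
  proof -
    have "nrm A (y m \<ominus> y n) * (1 - q) \<le> q ^ n"
      using dist[of n "m - n"] that zero_le_power[OF q(1), of "n + (m - n)"] by simp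
    then show ?thesis using q by (simp add: pos_le_divide_eq)
  qed
  have "cauchy y"
  proof (rule cauchyI)
    fix e :: real assume "0 < e"
    then have "0 < e * (1 - q) / 2" using q by simp
    from real_arch_pow_inv[OF this q(2)] obtain M where "q ^ M < e * (1 - q) / 2" by blast
    then have M: "q ^ M / (1 - q) < e / 2" using q by (simp add: divide_simps)
    have "nrm A (y m \<ominus> y n) < e" if "m \<ge> M" "n \<ge> M" for m n
      using dist'[OF that(1)] dist'[OF that(2)] M p_minus_triangle[of "y m" "y M" "y n"]
        p_minus_commute[OF yc yc, of M n] yc by (smt (verit) field_sum_of_halves)
    then show "\<exists>M. \<forall>m\<ge>M. \<forall>n\<ge>M. nrm A (y m \<ominus> y n) < e" by blast
  qed simp
  then obtain v where v: "v \<in> carrier A" "null_equiv y (\<lambda>_. v)"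
    using cstar_algebra.norm_complete[OF A, of y] by (auto simp: cauchy_seqs_iff null_equiv_def)
  have vstar: "star A v = v"
    using null_equiv_star[OF _ _ v(2)] v
    by (intro limit_unique[OF A yc _ _ _ v(2)]) (auto simp: ystar)
  have cv: "cauchy (\<lambda>_. z)" if "z \<in> carrier A" for z by (rule cauchy_const[OF that])
  \<comment> \<open>Commutation with everything that commutes with \<open>x\<close> survives the
    limit. Without it the square root could not be combined with other elements into a
    unitary.\<close>
  have vcomm: "z \<otimes> v = v \<otimes> z" if z: "z \<in> carrier A" "z \<otimes> x = x \<otimes> z" for z
  proof (rule limit_unique[OF A, of "\<lambda>n. z \<otimes> y n"])
    have "null_equiv (\<lambda>n. z \<otimes> y n) (\<lambda>n. z \<otimes> v)"
      by (intro null_equiv_mult cv \<open>cauchy y\<close> v z null_equiv_refl)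
    then show "null_equiv (\<lambda>n. z \<otimes> y n) (\<lambda>n. z \<otimes> v)" .
    have "null_equiv (\<lambda>n. y n \<otimes> z) (\<lambda>n. v \<otimes> z)"
      by (intro null_equiv_mult cv \<open>cauchy y\<close> v z null_equiv_refl)
    then show "null_equiv (\<lambda>n. z \<otimes> y n) (\<lambda>n. v \<otimes> z)" using ycomm[OF z] by simp
  qed (use z v in auto)
  have vfix: "v = (1/2) \<odot> (x \<oplus> v \<otimes> v)"
  proof (rule limit_unique[OF A, of "\<lambda>n. y (Suc n)"])
    show "null_equiv (\<lambda>n. y (Suc n)) (\<lambda>_. v)"
      using v(2) unfolding null_equiv_def by (rule LIMSEQ_Suc)
    show "null_equiv (\<lambda>n. y (Suc n)) (\<lambda>_. (1/2) \<odot> (x \<oplus> v \<otimes> v))"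
      unfolding ySuc
      by (intro null_equiv_smult null_equiv_add null_equiv_mult null_equiv_refl cv \<open>cauchy y\<close> v x
          a_closed m_closed yc)
  qed (use x v in auto)
  have "v \<oplus> v = 2 \<odot> v" using v smult_l_distr[of v 1 1] by simp
  also have "\<dots> = x \<oplus> v \<otimes> v"
    by (subst vfix) (use x v in \<open>simp add: smult_smult\<close>)
  \<comment> \<open>The fixed point equation solved for the square of \<open>v\<close>: it equals
    twice \<open>v\<close> minus \<open>x\<close>, so that squaring
    \<open>\<one> \<ominus> v\<close> leaves \<open>\<one> \<ominus> x\<close>.\<close>
  finally have vv: "v \<otimes> v = v \<oplus> (v \<oplus> \<ominus> x)"
    using x v by (simp add: a_assoc[symmetric]) (simp add: a_ac r_neg1 r_neg2)
  show thesis
  proof (rule that[of "\<one> \<ominus> v"])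
    show "(\<one> \<ominus> v) \<otimes> (\<one> \<ominus> v) = \<one> \<ominus> x"
      using v x by (simp add: minus_eq l_distr r_distr l_minus r_minus vv minus_add a_assoc r_neg1 r_neg2)
    show "star A (\<one> \<ominus> v) = \<one> \<ominus> v" using v vstar by (simp add: star_minus)
    show "z \<otimes> (\<one> \<ominus> v) = (\<one> \<ominus> v) \<otimes> z" if "z \<in> carrier A" "z \<otimes> x = x \<otimes> z" for z
      using v vcomm[OF that] that by (simp add: minus_eq l_distr r_distr l_minus r_minus)
  qed (use v in simp)
qed

text \<open>A self-adjoint \<open>h\<close> of norm less than 1 is the mean of the unitaries \<open>h \<plusminus> \<i>k\<close>,
  \<open>k\<^sup>2 = 1 - h\<^sup>2\<close>.\<close>

lemma cstar_seminorm_le_nrm: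
  fixes A :: "'a normed_star_algebra" (structure)
  assumes A: "cstar_algebra A" and p: "cstar_seminorm A p" and x: "x \<in> carrier A"
  shows "p x \<le> nrm A x"
proof -
  interpret pre_cstar A by (rule cstar_algebra_imp_pre_cstar[OF A])
  interpret p: cstar_seminormed A p by unfold_locales (rule p)
  have unit_ball: "p h \<le> 1" if h: "h \<in> carrier A" "star A h = h" "nrm A h < 1" for h
  proof -
    have "nrm A (h \<otimes> h) = (nrm A h)\<^sup>2" using p_cstar[OF h(1)] h by simp
    then have "nrm A (h \<otimes> h) < 1" using h by (simp add: power_less_one_iff)
    moreover have "h \<otimes> h \<in> carrier A" "star A (h \<otimes> h) = h \<otimes> h" using h by (simp_all add: star_mult)
    ultimately obtain k where k: "k \<in> carrier A" "star A k = k" "k \<otimes> k = \<one> \<ominus> h \<otimes> h"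
        and comm: "\<And>z. \<lbrakk>z \<in> carrier A; z \<otimes> (h \<otimes> h) = (h \<otimes> h) \<otimes> z\<rbrakk> \<Longrightarrow> z \<otimes> k = k \<otimes> z"
      using cstar_sqrt_one_minus[OF A, of "h \<otimes> h"] by blast
    \<comment> \<open>\<open>h\<close> commutes with its own square, hence with the root
      \<open>k\<close>.\<close>
    have hk: "h \<otimes> k = k \<otimes> h" using comm[of h] h by (simp add: m_assoc)
    let ?u = "h \<oplus> \<i> \<odot> k"
    have us: "star A ?u = h \<oplus> (-\<i>) \<odot> k" using h k by (simp add: star_add star_smult)
    have "star A ?u \<otimes> ?u = \<one>"
    proof -
      have "star A ?u \<otimes> ?u = (h \<otimes> h \<oplus> (-\<i>) \<odot> (k \<otimes> h)) \<oplus> (\<i> \<odot> (h \<otimes> k) \<oplus> 1 \<odot> (k \<otimes> k))"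
        unfolding us using h(1) k(1)
        by (simp add: l_distr r_distr smult_mult_left smult_mult_right smult_smult smult_r_distr)
      also have "\<dots> = (h \<otimes> h \<oplus> \<i> \<odot> (k \<otimes> h)) \<oplus> ((-\<i>) \<odot> (k \<otimes> h) \<oplus> (\<one> \<ominus> h \<otimes> h))"
        unfolding hk k(3) using h(1) k(1) by (simp add: a_ac)
      also have "\<dots> = h \<otimes> h \<oplus> ((\<i> \<odot> (k \<otimes> h) \<oplus> (-\<i>) \<odot> (k \<otimes> h)) \<oplus> (\<one> \<ominus> h \<otimes> h))"
        using h k by (simp add: a_assoc)
      also have "\<i> \<odot> (k \<otimes> h) \<oplus> (-\<i>) \<odot> (k \<otimes> h) = \<zero>"
        using h k smult_l_distr[of "k \<otimes> h" \<i> "-\<i>"] by simp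
      finally show ?thesis using h by (simp add: minus_eq a_ac r_neg r_neg1 r_neg2)
    qed
    \<comment> \<open>By unitarity and the C*-identity the square of \<open>p ?u\<close> is
      \<open>p \<one>\<close>, which is at most 1.\<close>
    then have "(p ?u)\<^sup>2 \<le> 1"
      using p.p_cstar[of ?u] p.p_one_le h k by simp
    then have pu: "p ?u \<le> 1" by (simp add: power2_le_iff_abs_le[of 1, simplified])
    have "star A ?u \<oplus> ?u = (h \<oplus> h) \<oplus> (\<i> \<odot> k \<oplus> (-\<i>) \<odot> k)"
      unfolding us using h k by (simp add: a_ac)
    also have "\<dots> = 2 \<odot> h" using h k smult_l_distr[of k \<i> "-\<i>"] smult_l_distr[of h 1 1] by simp
    finally have "2 * p h \<le> p (star A ?u) + p ?u"
      using p.p_triangle[of "star A ?u" ?u] h k by simp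
    then show ?thesis using pu p.p_star[of ?u] h k by simp
  qed
  have sa: "p h \<le> nrm A h" if h: "h \<in> carrier A" "star A h = h" for h
  proof (rule dense_ge)
    \<comment> \<open>The square root needs a norm strictly below 1, so \<open>h\<close> is scaled
      by \<open>1 / r\<close> for every \<open>r\<close> above its norm.\<close>
    fix r assume r: "nrm A h < r"
    then have r0: "0 < r" using p_nonneg[OF h(1)] by linarith
    have "p (of_real (1/r) \<odot> h) \<le> 1"
      by (rule unit_ball) (use h r r0 in \<open>auto simp: star_smult norm_divide\<close>)
    then show "p h \<le> r" using h r0 by (simp add: norm_divide divide_simps)
  qed
  \<comment> \<open>A general \<open>x\<close> reduces to the self-adjoint
    \<open>star A x \<otimes> x\<close> by the C*-identity on both sides.\<close>
  have "(p x)\<^sup>2 \<le> (nrm A x)\<^sup>2"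
    using sa[of "star A x \<otimes> x"] p_cstar[OF x] p.p_cstar[OF x] x by (simp add: star_mult)
  then show ?thesis by (rule power2_le_imp_le) (use x in simp)
qed

text \<open>Automatic continuity of positive functionals. For \<open>r\<close> above the squared
  norm, \<open>\<one> \<ominus> of_real (1/r) \<odot> (star A x \<otimes> x)\<close> is the square
  of a self-adjoint element, so \<open>f\<close> is nonnegative there; then \<open>r\<close>
  decreases to the squared norm.\<close>

lemma positive_functional_bound:
  fixes A :: "'a normed_star_algebra" (structure)
  assumes A: "cstar_algebra A" and f: "positive_functional A f" and x: "x \<in> carrier A"
  shows "Re (f (star A x \<otimes> x)) \<le> (nrm A x)\<^sup>2 * Re (f \<one>)"
proof -
  interpret pre_cstar A by (rule cstar_algebra_imp_pre_cstar[OF A])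
  note lin = positive_linear[OF f]
  have f1: "0 \<le> Re (f \<one>)" using positive_nonneg[OF f, of \<one>] by (simp add: less_eq_complex_def)
  let ?h = "star A x \<otimes> x"
  have bound: "Re (f ?h) \<le> r * Re (f \<one>)" if r: "(nrm A x)\<^sup>2 < r" for r
  proof -
    have r0: "0 < r" using r by (meson le_less_trans zero_le_power2)
    have "nrm A (of_real (1/r) \<odot> ?h) < 1" using r r0 x by (simp add: p_cstar norm_divide)
    moreover have "star A (of_real (1/r) \<odot> ?h) = of_real (1/r) \<odot> ?h"
      using x by (simp add: star_smult star_mult)
    ultimately obtain k where k: "k \<in> carrier A" "star A k = k" "k \<otimes> k = \<one> \<ominus> of_real (1/r) \<odot> ?h"
      using cstar_sqrt_one_minus[OF A, of "of_real (1/r) \<odot> ?h"] x by blast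
    have "0 \<le> f (\<one> \<ominus> of_real (1/r) \<odot> ?h)"
      using positive_nonneg[OF f k(1)] k by simp
    also have "\<dots> = f \<one> - of_real (1/r) * f ?h"
      using x by (simp add: minus_eq_smult smult_smult linear_functional_add[OF lin] linear_functional_smult[OF lin])
    finally show ?thesis using r0 by (simp add: less_eq_complex_def field_simps)
  qed
  show ?thesis
  \<comment> \<open>The limit in \<open>r\<close> is taken after division by
    \<open>f \<one>\<close>; when that vanishes, a single \<open>r\<close> is enough.\<close>
  proof (cases "Re (f \<one>) = 0")
    case True then show ?thesis using bound[of "(nrm A x)\<^sup>2 + 1"] by simp
  next
    case False
    then have pos: "0 < Re (f \<one>)" using f1 by simp
    have "Re (f ?h) / Re (f \<one>) \<le> (nrm A x)\<^sup>2"
      by (rule dense_ge) (use bound pos in \<open>simp add: pos_divide_le_eq\<close>)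
    then show ?thesis using pos by (simp add: pos_divide_le_eq)
  qed
qed

section \<open>Spatial seminorms\<close>

text \<open>Subalgebras stay inside the record: \<open>T\<close> with its carrier replaced by
  \<open>Y\<close> is again a \<open>star_alg\<close>, and a seminorm on a finite stage is a
  seminorm of that record.\<close>

definition star_subalgebra :: "('a, 'm) star_algebra_scheme \<Rightarrow> 'a set \<Rightarrow> bool" where
  "star_subalgebra T Y \<longleftrightarrow> Y \<subseteq> carrier T \<and> \<zero>\<^bsub>T\<^esub> \<in> Y \<and> \<one>\<^bsub>T\<^esub> \<in> Y \<and>
     (\<forall>x\<in>Y. \<forall>y\<in>Y. x \<oplus>\<^bsub>T\<^esub> y \<in> Y \<and> x \<otimes>\<^bsub>T\<^esub> y \<in> Y) \<and> (\<forall>x\<in>Y. star T x \<in> Y \<and> (\<forall>c. c \<odot>\<^bsub>T\<^esub> x \<in> Y))"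

lemma (in star_alg) star_subalgebra_star_alg:
  assumes "star_subalgebra T Y" shows "star_alg (T\<lparr>carrier := Y\<rparr>)"
proof -
  have sub: "x \<in> carrier T" if "x \<in> Y" for x using assms that by (auto simp: star_subalgebra_def)
  have c: "\<zero> \<in> Y" "\<one> \<in> Y" "x \<in> Y \<Longrightarrow> y \<in> Y \<Longrightarrow> x \<oplus> y \<in> Y" "x \<in> Y \<Longrightarrow> y \<in> Y \<Longrightarrow> x \<otimes> y \<in> Y"
    "x \<in> Y \<Longrightarrow> star T x \<in> Y" "x \<in> Y \<Longrightarrow> c \<odot> x \<in> Y" for x y c
    using assms by (auto simp: star_subalgebra_def)
  show ?thesis
    by (rule star_algI; (fact a_comm[OF sub sub])?; simp add: c sub a_assoc m_assoc l_distr r_distr smult_l_distr smult_r_distr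
        smult_smult smult_mult_left smult_mult_right star_add star_smult star_mult;
      simp add: a_comm sub)
qed

lemma cstar_seminorm_cong:
  assumes "cstar_seminorm T p" "\<And>x. x \<in> carrier T \<Longrightarrow> q x = p x" "star_alg T"
  shows "cstar_seminorm T q"
proof -
  interpret star_alg T by fact
  show ?thesis using assms(1) by (simp add: cstar_seminorm_def assms(2))
qed

lemma cstar_seminorm_subset:
  "cstar_seminorm T p \<Longrightarrow> Y \<subseteq> carrier T \<Longrightarrow> cstar_seminorm (T\<lparr>carrier := Y\<rparr>) p"
  by (auto simp: cstar_seminorm_def subset_iff)

lemma cstar_seminorm_pullback:
  assumes "cstar_seminorm T q"
    and "\<And>x. x \<in> carrier R \<Longrightarrow> f x \<in> carrier T"
    and "\<And>x y. \<lbrakk>x \<in> carrier R; y \<in> carrier R\<rbrakk> \<Longrightarrow> f (x \<oplus>\<^bsub>R\<^esub> y) = f x \<oplus>\<^bsub>T\<^esub> f y"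
    and "\<And>x y. \<lbrakk>x \<in> carrier R; y \<in> carrier R\<rbrakk> \<Longrightarrow> f (x \<otimes>\<^bsub>R\<^esub> y) = f x \<otimes>\<^bsub>T\<^esub> f y"
    and "\<And>c x. x \<in> carrier R \<Longrightarrow> f (c \<odot>\<^bsub>R\<^esub> x) = c \<odot>\<^bsub>T\<^esub> f x"
    and "\<And>x. x \<in> carrier R \<Longrightarrow> f (star R x) = star T (f x)"
    and "\<And>x. x \<in> carrier R \<Longrightarrow> star R x \<in> carrier R"
  shows "cstar_seminorm R (\<lambda>x. q (f x))"
  using assms by (simp add: cstar_seminorm_def)

context star_alg
begin

text \<open>\<open>p x\<^sup>2 = p h\<close> and \<open>p h ^ 2\<^sup>n = p (h ^ 2\<^sup>n) \<le> K q h ^ 2\<^sup>n\<close> for \<open>h = x\<^sup>* x\<close>.\<close>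

lemma cstar_seminorm_le_if_dominated:
  assumes p: "cstar_seminorm T p" and q: "cstar_seminorm T q"
    and K: "\<And>x. x \<in> carrier T \<Longrightarrow> p x \<le> K * q x" and x: "x \<in> carrier T"
  shows "p x \<le> q x"
proof -
  interpret p: cstar_seminormed T p by unfold_locales (rule p)
  interpret q: cstar_seminormed T q by unfold_locales (rule q)
  define h where "h = star T x \<otimes> x"
  have h: "h \<in> carrier T" "star T h = h" using x by (simp_all add: h_def star_mult)
  have pow: "p h ^ 2 ^ n \<le> K * q h ^ 2 ^ n" for n
    using K[of "h [^] ((2::nat) ^ n)"] p.p_pow_selfadjoint[OF h, of n] q.p_pow_selfadjoint[OF h, of n] h
    by simp
  have "p h \<le> q h"
  proof (rule ccontr)
    assume "\<not> p h \<le> q h"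
    then have lt: "q h < p h" by simp
    have qh: "0 \<le> q h" using h by simp
    show False
    proof (cases "q h = 0")
      case True then show False using pow[of 0] lt by simp
    next
      case False
      define r where "r = p h / q h"
      have r: "1 < r" using lt qh False by (simp add: r_def)
      have rK: "r ^ 2 ^ n \<le> K" for n
        using pow[of n] qh False by (simp add: r_def power_divide pos_divide_le_eq)
      obtain m where "K < r ^ m" using real_arch_pow[OF r] by blast
      also have "r ^ m \<le> r ^ 2 ^ m" using r by (intro power_increasing) (auto simp: less_imp_le)
      finally show False using rK[of m] by simp
    qed
  qed
  then have "(p x)\<^sup>2 \<le> (q x)\<^sup>2" by (simp add: h_def p.p_cstar q.p_cstar x)
  then show ?thesis by (rule power2_le_imp_le) (use x in simp)
qed

context
  fixes \<Omega> Y
  assumes sub: "star_subalgebra T Y" and pos: "\<And>\<omega>. \<omega> \<in> \<Omega> \<Longrightarrow> positive_functional T \<omega>"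
    and bdd: "\<And>x. x \<in> Y \<Longrightarrow> \<exists>K. \<forall>\<omega>\<in>\<Omega>. \<forall>y\<in>Y. gns_seminorm T \<omega> (x \<otimes> y) \<le> K * gns_seminorm T \<omega> y"
begin

lemma subalgebraD: "x \<in> Y \<Longrightarrow> x \<in> carrier T" "x \<in> Y \<Longrightarrow> y \<in> Y \<Longrightarrow> x \<oplus> y \<in> Y"
  "x \<in> Y \<Longrightarrow> y \<in> Y \<Longrightarrow> x \<otimes> y \<in> Y" "x \<in> Y \<Longrightarrow> star T x \<in> Y" "x \<in> Y \<Longrightarrow> c \<odot> x \<in> Y"
  using sub by (auto simp: star_subalgebra_def)

lemma gns_norm_eq:
  "gns_norm T \<Omega> Y x = Sup (insert 0 {gns_seminorm T \<omega> (x \<otimes> y) | \<omega> y. \<omega> \<in> \<Omega> \<and> y \<in> Y \<and> \<omega> (star T y \<otimes> y) = 1})"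
  by (simp add: gns_norm_def gns_seminorm_def)

lemma gns_seminorm_unit_vector: "\<omega> (star T y \<otimes> y) = 1 \<Longrightarrow> gns_seminorm T \<omega> y = 1"
  by (simp add: gns_seminorm_def)

text \<open>\<open>bdd\<close> says that \<open>x\<close> acts as a bounded operator, uniformly over
  the GNS spaces of \<open>\<Omega>\<close>. A real supremum carries information only under such a
  bound.\<close>

lemma bdd_above_gns:
  assumes x: "x \<in> Y"
  shows "bdd_above (insert 0 {gns_seminorm T \<omega> (x \<otimes> y) | \<omega> y. \<omega> \<in> \<Omega> \<and> y \<in> Y \<and> \<omega> (star T y \<otimes> y) = 1})"
proof -
  obtain K where K: "\<forall>\<omega>\<in>\<Omega>. \<forall>y\<in>Y. gns_seminorm T \<omega> (x \<otimes> y) \<le> K * gns_seminorm T \<omega> y"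
    using bdd[OF x] by blast
  show ?thesis by (rule bdd_aboveI[of _ "max 0 K"]) (use K gns_seminorm_unit_vector in fastforce)
qed

lemma gns_norm_nonneg: "x \<in> Y \<Longrightarrow> 0 \<le> gns_norm T \<Omega> Y x"
  unfolding gns_norm_eq by (rule cSup_upper[OF _ bdd_above_gns]) auto

text \<open>The supremum ranges over unit vectors. Other vectors are reached by scaling, and null
  vectors by \<open>bdd\<close>, which sends them to null vectors.\<close>

lemma gns_seminorm_le_gns_norm:
  assumes x: "x \<in> Y" and \<omega>: "\<omega> \<in> \<Omega>" and y: "y \<in> Y"
  shows "gns_seminorm T \<omega> (x \<otimes> y) \<le> gns_norm T \<Omega> Y x * gns_seminorm T \<omega> y"
proof (cases "gns_seminorm T \<omega> y = 0")
  case True then show ?thesis using bdd[OF x] \<omega> y by fastforce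
next
  case False
  note \<omega>p = pos[OF \<omega>]
  let ?r = "gns_seminorm T \<omega> y"
  let ?y = "complex_of_real (1 / ?r) \<odot> y"
  have r: "0 < ?r" using gns_seminorm_nonneg[OF \<omega>p subalgebraD(1)[OF y]] False by simp
  have "gns_seminorm T \<omega> ?y = 1"
    using r y by (simp add: gns_seminorm_smult[OF \<omega>p] subalgebraD norm_divide)
  then have one: "\<omega> (star T ?y \<otimes> ?y) = 1"
    using positive_eq_gns_seminorm[OF \<omega>p, of ?y] y by (simp add: subalgebraD)
  have "gns_seminorm T \<omega> (x \<otimes> ?y) \<le> gns_norm T \<Omega> Y x"
    unfolding gns_norm_eq
    by (rule cSup_upper[OF _ bdd_above_gns[OF x]], rule insertI2, rule CollectI, rule exI[of _ \<omega>],
        rule exI[of _ ?y]) (intro conjI refl \<omega> subalgebraD y one)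
  also have "x \<otimes> ?y = complex_of_real (1 / ?r) \<odot> (x \<otimes> y)"
    using x y by (simp add: smult_mult_right subalgebraD)
  finally show ?thesis
    using r x y by (simp add: gns_seminorm_smult[OF \<omega>p] subalgebraD norm_divide pos_divide_le_eq)
qed

text \<open>Together with \<open>gns_seminorm_le_gns_norm\<close> this characterises
  \<open>gns_norm\<close> as the least operator bound; the seminorm laws are proved from this pair
  and no longer refer to the supremum.\<close>

lemma gns_norm_least:
  assumes "0 \<le> M" "\<And>\<omega> y. \<lbrakk>\<omega> \<in> \<Omega>; y \<in> Y\<rbrakk> \<Longrightarrow> gns_seminorm T \<omega> (x \<otimes> y) \<le> M * gns_seminorm T \<omega> y"
  shows "gns_norm T \<Omega> Y x \<le> M"
  unfolding gns_norm_eq by (rule cSup_least) (use assms gns_seminorm_unit_vector in fastforce)+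

lemma gns_norm_cstar_seminorm: "cstar_seminorm (T\<lparr>carrier := Y\<rparr>) (gns_norm T \<Omega> Y)"
proof -
  let ?N = "gns_norm T \<Omega> Y"
  have nonneg: "0 \<le> gns_seminorm T \<omega> y" if "\<omega> \<in> \<Omega>" "y \<in> Y" for \<omega> y
    using gns_seminorm_nonneg[OF pos] that subalgebraD(1) by blast
  have add: "?N (x \<oplus> y) \<le> ?N x + ?N y" if xy: "x \<in> Y" "y \<in> Y" for x y
  proof (rule gns_norm_least)
    fix \<omega> z assume z: "\<omega> \<in> \<Omega>" "z \<in> Y"
    have "gns_seminorm T \<omega> ((x \<oplus> y) \<otimes> z) \<le> gns_seminorm T \<omega> (x \<otimes> z) + gns_seminorm T \<omega> (y \<otimes> z)"
      using gns_seminorm_triangle[OF pos[OF z(1)], of "x \<otimes> z" "y \<otimes> z"] xy z by (simp add: l_distr subalgebraD)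
    also have "\<dots> \<le> (?N x + ?N y) * gns_seminorm T \<omega> z"
      unfolding distrib_right by (intro add_mono gns_seminorm_le_gns_norm xy z)
    finally show "gns_seminorm T \<omega> ((x \<oplus> y) \<otimes> z) \<le> (?N x + ?N y) * gns_seminorm T \<omega> z" .
  qed (use gns_norm_nonneg xy in simp)
  have smult_le: "?N (c \<odot> x) \<le> cmod c * ?N x" if x: "x \<in> Y" for c x
  proof (rule gns_norm_least)
    fix \<omega> z assume z: "\<omega> \<in> \<Omega>" "z \<in> Y"
    then show "gns_seminorm T \<omega> ((c \<odot> x) \<otimes> z) \<le> cmod c * ?N x * gns_seminorm T \<omega> z"
      using gns_seminorm_le_gns_norm[OF x z] x
      by (simp add: smult_mult_left subalgebraD gns_seminorm_smult[OF pos[OF z(1)]] mult.assoc mult_left_mono)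
  qed (use gns_norm_nonneg x in simp)
  have smult: "?N (c \<odot> x) = cmod c * ?N x" if x: "x \<in> Y" for c x
  proof (cases "c = 0")
    case True
    then show ?thesis using smult_le[OF x, of 0] gns_norm_nonneg[OF subalgebraD(5)[OF x, of 0]] by simp
  next
    case False
    then have "cmod c * ?N x \<le> ?N (c \<odot> x)"
      using smult_le[OF subalgebraD(5)[OF x, of c], of "1 / c"] x
      by (simp add: smult_smult subalgebraD norm_divide field_simps)
    then show ?thesis using smult_le[OF x] by (simp add: order_antisym)
  qed
  have mult: "?N (x \<otimes> y) \<le> ?N x * ?N y" if xy: "x \<in> Y" "y \<in> Y" for x y
  proof (rule gns_norm_least)
    fix \<omega> z assume z: "\<omega> \<in> \<Omega>" "z \<in> Y"
    have "gns_seminorm T \<omega> ((x \<otimes> y) \<otimes> z) \<le> ?N x * gns_seminorm T \<omega> (y \<otimes> z)"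
      using gns_seminorm_le_gns_norm[OF xy(1) z(1) subalgebraD(3)[OF xy(2) z(2)]] xy z by (simp add: m_assoc subalgebraD)
    also have "\<dots> \<le> ?N x * (?N y * gns_seminorm T \<omega> z)"
      by (intro mult_left_mono gns_seminorm_le_gns_norm gns_norm_nonneg xy z)
    finally show "gns_seminorm T \<omega> ((x \<otimes> y) \<otimes> z) \<le> ?N x * ?N y * gns_seminorm T \<omega> z" by (simp add: mult.assoc)
  qed (use gns_norm_nonneg xy in simp)
  \<comment> \<open>The squared length of \<open>star T x \<otimes> z\<close> is the inner product
    of \<open>z\<close> with \<open>x \<otimes> (star T x \<otimes> z)\<close>. Cauchy-Schwarz and
    the bound for \<open>x\<close> leave that length as a factor on both sides, and one copy
    cancels.\<close>
  have star_le: "?N (star T x) \<le> ?N x" if x: "x \<in> Y" for x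
  proof (rule gns_norm_least)
    fix \<omega> z assume z: "\<omega> \<in> \<Omega>" "z \<in> Y"
    let ?g = "gns_seminorm T \<omega>" and ?w = "star T x \<otimes> z"
    have w: "?w \<in> Y" using x z by (simp add: subalgebraD)
    have "(?g ?w)\<^sup>2 = Re (\<omega> (star T z \<otimes> (x \<otimes> ?w)))"
      using x z by (simp add: gns_seminorm_power2[OF pos[OF z(1)]] subalgebraD star_mult m_assoc)
    also have "\<dots> \<le> ?g z * ?g (x \<otimes> ?w)"
      using x z w by (intro order_trans[OF complex_Re_le_cmod gns_cauchy_schwarz[OF pos[OF z(1)]]]) (auto simp: subalgebraD)
    also have "\<dots> \<le> ?g z * (?N x * ?g ?w)"
      by (intro mult_left_mono gns_seminorm_le_gns_norm x z w nonneg)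
    finally have "?g ?w * ?g ?w \<le> (?N x * ?g z) * ?g ?w" by (simp add: power2_eq_square mult_ac)
    then show "?g ?w \<le> ?N x * ?g z"
      using nonneg[OF z(1) w] nonneg[OF z] gns_norm_nonneg[OF x] by (cases "?g ?w = 0") auto
  qed (use gns_norm_nonneg x in simp)
  \<comment> \<open>Cauchy-Schwarz for \<open>z\<close> and
    \<open>(star T x \<otimes> x) \<otimes> z\<close> bounds the squared length of
    \<open>x \<otimes> z\<close>. The opposite inequality comes from submultiplicativity and
    \<open>star_le\<close>.\<close>
  have cstar_ge: "(?N x)\<^sup>2 \<le> ?N (star T x \<otimes> x)" if x: "x \<in> Y" for x
  proof -
    let ?h = "star T x \<otimes> x"
    have h: "?h \<in> Y" using x by (simp add: subalgebraD)
    have "?N x \<le> sqrt (?N ?h)"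
    proof (rule gns_norm_least)
      fix \<omega> z assume z: "\<omega> \<in> \<Omega>" "z \<in> Y"
      let ?g = "gns_seminorm T \<omega>"
      have "(?g (x \<otimes> z))\<^sup>2 = Re (\<omega> (star T z \<otimes> (?h \<otimes> z)))"
        using x z by (simp add: gns_seminorm_power2[OF pos[OF z(1)]] subalgebraD star_mult m_assoc)
      also have "\<dots> \<le> ?g z * ?g (?h \<otimes> z)"
        using x z h by (intro order_trans[OF complex_Re_le_cmod gns_cauchy_schwarz[OF pos[OF z(1)]]]) (auto simp: subalgebraD)
      also have "\<dots> \<le> ?g z * (?N ?h * ?g z)"
        by (intro mult_left_mono gns_seminorm_le_gns_norm h z nonneg)
      also have "\<dots> = (sqrt (?N ?h) * ?g z)\<^sup>2"
        using gns_norm_nonneg[OF h] by (simp add: power2_eq_square algebra_simps)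
      finally show "?g (x \<otimes> z) \<le> sqrt (?N ?h) * ?g z"
        by (rule power2_le_imp_le) (use gns_norm_nonneg[OF h] nonneg[OF z] in simp)
    qed (use gns_norm_nonneg[OF h] in simp)
    then have "(?N x)\<^sup>2 \<le> (sqrt (?N ?h))\<^sup>2" by (rule power_mono) (rule gns_norm_nonneg[OF x])
    then show ?thesis using gns_norm_nonneg[OF h] by simp
  qed
  have "?N (star T x \<otimes> x) = (?N x)\<^sup>2" if x: "x \<in> Y" for x
  proof (rule antisym)
    have "?N (star T x) * ?N x \<le> ?N x * ?N x"
      by (intro mult_right_mono star_le gns_norm_nonneg x)
    then show "?N (star T x \<otimes> x) \<le> (?N x)\<^sup>2"
      using mult[OF subalgebraD(4)[OF x] x] by (simp add: power2_eq_square)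
  qed (rule cstar_ge[OF x])
  then show ?thesis
    using gns_norm_nonneg add smult mult by (simp add: cstar_seminorm_def)
qed

end

subsection \<open>Bounded elements\<close>

text \<open>The test vectors range over all of \<open>T\<close> rather than over a subalgebra, so
  one verification serves every stage. These elements are closed under the algebra operations, and
  boundedness need only be checked on generators.\<close>

definition bounded_elements :: "('a \<Rightarrow> complex) set \<Rightarrow> 'a set" where
  "bounded_elements \<Omega> = {x \<in> carrier T. \<exists>K\<ge>0. \<forall>\<omega>\<in>\<Omega>. \<forall>y\<in>carrier T.
     gns_seminorm T \<omega> (x \<otimes> y) \<le> K * gns_seminorm T \<omega> y}"

lemma bounded_elementsE:
  assumes "x \<in> bounded_elements \<Omega>"
  obtains K where "\<And>\<omega> y. \<lbrakk>\<omega> \<in> \<Omega>; y \<in> carrier T\<rbrakk> \<Longrightarrow> gns_seminorm T \<omega> (x \<otimes> y) \<le> K * gns_seminorm T \<omega> y"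
  using assms by (auto simp: bounded_elements_def)

context
  fixes \<Omega> assumes pos: "\<And>\<omega>. \<omega> \<in> \<Omega> \<Longrightarrow> positive_functional T \<omega>"
begin

lemma bounded_elements_add:
  assumes "x \<in> bounded_elements \<Omega>" "y \<in> bounded_elements \<Omega>"
  shows "x \<oplus> y \<in> bounded_elements \<Omega>"
proof -
  obtain K where x: "x \<in> carrier T" "K \<ge> 0" and K: "\<And>\<omega> z. \<lbrakk>\<omega> \<in> \<Omega>; z \<in> carrier T\<rbrakk> \<Longrightarrow>
      gns_seminorm T \<omega> (x \<otimes> z) \<le> K * gns_seminorm T \<omega> z"
    using assms(1) by (auto simp: bounded_elements_def)
  obtain L where y: "y \<in> carrier T" "L \<ge> 0" and L: "\<And>\<omega> z. \<lbrakk>\<omega> \<in> \<Omega>; z \<in> carrier T\<rbrakk> \<Longrightarrow>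
      gns_seminorm T \<omega> (y \<otimes> z) \<le> L * gns_seminorm T \<omega> z"
    using assms(2) by (auto simp: bounded_elements_def)
  have "gns_seminorm T \<omega> ((x \<oplus> y) \<otimes> z) \<le> (K + L) * gns_seminorm T \<omega> z"
    if z: "\<omega> \<in> \<Omega>" "z \<in> carrier T" for \<omega> z
    using gns_seminorm_triangle[OF pos[OF z(1)], of "x \<otimes> z" "y \<otimes> z"] K[OF z] L[OF z] x y z
    by (simp add: l_distr distrib_right)
  then show ?thesis using x y by (auto simp: bounded_elements_def intro!: exI[of _ "K + L"])
qed

lemma bounded_elements_mult:
  assumes "x \<in> bounded_elements \<Omega>" "y \<in> bounded_elements \<Omega>"
  shows "x \<otimes> y \<in> bounded_elements \<Omega>"
proof -
  obtain K where x: "x \<in> carrier T" "K \<ge> 0" and K: "\<And>\<omega> z. \<lbrakk>\<omega> \<in> \<Omega>; z \<in> carrier T\<rbrakk> \<Longrightarrow>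
      gns_seminorm T \<omega> (x \<otimes> z) \<le> K * gns_seminorm T \<omega> z"
    using assms(1) by (auto simp: bounded_elements_def)
  obtain L where y: "y \<in> carrier T" "L \<ge> 0" and L: "\<And>\<omega> z. \<lbrakk>\<omega> \<in> \<Omega>; z \<in> carrier T\<rbrakk> \<Longrightarrow>
      gns_seminorm T \<omega> (y \<otimes> z) \<le> L * gns_seminorm T \<omega> z"
    using assms(2) by (auto simp: bounded_elements_def)
  have "gns_seminorm T \<omega> ((x \<otimes> y) \<otimes> z) \<le> (K * L) * gns_seminorm T \<omega> z"
    if z: "\<omega> \<in> \<Omega>" "z \<in> carrier T" for \<omega> z
    using K[of \<omega> "y \<otimes> z"] mult_left_mono[OF L[OF z] x(2)] x y z by (simp add: m_assoc mult.assoc)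
  then show ?thesis using x y by (auto simp: bounded_elements_def intro!: exI[of _ "K * L"])
qed

lemma bounded_elements_smult:
  assumes "x \<in> bounded_elements \<Omega>" shows "c \<odot> x \<in> bounded_elements \<Omega>"
proof -
  obtain K where x: "x \<in> carrier T" "K \<ge> 0" and K: "\<And>\<omega> z. \<lbrakk>\<omega> \<in> \<Omega>; z \<in> carrier T\<rbrakk> \<Longrightarrow>
      gns_seminorm T \<omega> (x \<otimes> z) \<le> K * gns_seminorm T \<omega> z"
    using assms(1) by (auto simp: bounded_elements_def)
  have "gns_seminorm T \<omega> ((c \<odot> x) \<otimes> z) \<le> (cmod c * K) * gns_seminorm T \<omega> z"
    if z: "\<omega> \<in> \<Omega>" "z \<in> carrier T" for \<omega> z
    using K[OF z] x z by (simp add: smult_mult_left gns_seminorm_smult[OF pos[OF z(1)]] mult.assoc mult_left_mono)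
  then show ?thesis using x by (auto simp: bounded_elements_def intro!: exI[of _ "cmod c * K"])
qed

text \<open>For fixed \<open>\<omega>\<close> and \<open>y\<close> the functional
  \<open>\<lambda>b. \<omega> (star T y \<otimes> (f b \<otimes> y))\<close> is positive on the
  C*-algebra \<open>A\<close>. Its bound by the value at the unit says that \<open>f a\<close>
  stretches \<open>y\<close> by at most \<open>nrm A a\<close>.\<close>

lemma bounded_elements_image:
  fixes A :: "'b normed_star_algebra"
  assumes A: "cstar_algebra A"
    and f: "\<And>a. a \<in> carrier A \<Longrightarrow> f a \<in> carrier T"
      "\<And>a b. \<lbrakk>a \<in> carrier A; b \<in> carrier A\<rbrakk> \<Longrightarrow> f (a \<oplus>\<^bsub>A\<^esub> b) = f a \<oplus> f b"
      "\<And>a b. \<lbrakk>a \<in> carrier A; b \<in> carrier A\<rbrakk> \<Longrightarrow> f (a \<otimes>\<^bsub>A\<^esub> b) = f a \<otimes> f b"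
      "f \<one>\<^bsub>A\<^esub> = \<one>"
      "\<And>c a. a \<in> carrier A \<Longrightarrow> f (c \<odot>\<^bsub>A\<^esub> a) = c \<odot> f a"
      "\<And>a. a \<in> carrier A \<Longrightarrow> f (star A a) = star T (f a)"
    and a: "a \<in> carrier A"
  shows "f a \<in> bounded_elements \<Omega>"
proof -
  interpret A: pre_cstar A by (rule cstar_algebra_imp_pre_cstar[OF A])
  have "gns_seminorm T \<omega> (f a \<otimes> y) \<le> nrm A a * gns_seminorm T \<omega> y"
    if y: "\<omega> \<in> \<Omega>" "y \<in> carrier T" for \<omega> y
  proof -
    note \<omega>p = pos[OF y(1)]
    let ?g = "\<lambda>b. \<omega> (star T y \<otimes> (f b \<otimes> y))"
    have lin: "linear_functional A ?g"
      using y by (simp add: linear_functional_def f l_distr r_distr smult_mult_left smult_mult_right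
          linear_functional_add[OF positive_linear[OF \<omega>p]] linear_functional_smult[OF positive_linear[OF \<omega>p]])
    have g_star: "?g (star A b \<otimes>\<^bsub>A\<^esub> b) = \<omega> (star T (f b \<otimes> y) \<otimes> (f b \<otimes> y))" if "b \<in> carrier A" for b
      using y that by (simp add: f star_mult m_assoc)
    have "positive_functional A ?g"
      unfolding positive_functional_def
    proof (intro conjI ballI lin)
      fix b assume b: "b \<in> carrier A"
      show "0 \<le> ?g (star A b \<otimes>\<^bsub>A\<^esub> b)"
        unfolding g_star[OF b] by (rule positive_nonneg[OF \<omega>p]) (simp add: b y f(1))
    qed
    from positive_functional_bound[OF A this a]
    have "(gns_seminorm T \<omega> (f a \<otimes> y))\<^sup>2 \<le> (nrm A a)\<^sup>2 * (gns_seminorm T \<omega> y)\<^sup>2"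
      using y a by (simp only: g_star gns_seminorm_power2[OF \<omega>p] f m_closed) (simp add: f)
    then have "(gns_seminorm T \<omega> (f a \<otimes> y))\<^sup>2 \<le> (nrm A a * gns_seminorm T \<omega> y)\<^sup>2"
      by (simp add: power_mult_distrib)
    then show ?thesis
      by (rule power2_le_imp_le)
        (rule mult_nonneg_nonneg[OF A.p_nonneg[OF a] gns_seminorm_nonneg[OF \<omega>p y(2)]])
  qed
  then show ?thesis using a f(1) by (auto simp: bounded_elements_def intro!: exI[of _ "nrm A a"])
qed

end
end

subsection \<open>Schur products of positive kernels\<close>

definition psd_on :: "'i set \<Rightarrow> ('i \<Rightarrow> 'i \<Rightarrow> complex) \<Rightarrow> bool" where
  "psd_on S K \<longleftrightarrow> (\<forall>I c. finite I \<longrightarrow> I \<subseteq> S \<longrightarrow> 0 \<le> (\<Sum>i\<in>I. \<Sum>j\<in>I. cnj (c i) * c j * K i j))"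

lemma psd_onD: "\<lbrakk>psd_on S K; finite I; I \<subseteq> S\<rbrakk> \<Longrightarrow> 0 \<le> (\<Sum>i\<in>I. \<Sum>j\<in>I. cnj (c i) * c j * K i j)"
  by (simp add: psd_on_def)

lemma psd_on_subset: "\<lbrakk>psd_on S K; S' \<subseteq> S\<rbrakk> \<Longrightarrow> psd_on S' K"
  by (auto simp: psd_on_def)

lemma psd_on_diag: "psd_on S K \<Longrightarrow> i \<in> S \<Longrightarrow> 0 \<le> K i i"
  using psd_onD[of S K "{i}" "\<lambda>_. 1"] by simp

lemma psd_on_pair:
  fixes K :: "'i \<Rightarrow> 'i \<Rightarrow> complex"
  assumes "psd_on S K" "i \<in> S" "j \<in> S" "i \<noteq> j"
  shows "0 \<le> K i i + (l * K i j + cnj l * K j i) + (cmod l)\<^sup>2 * K j j"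
proof -
  have "0 \<le> K i i + l * K i j + (cnj l * K j i + cnj l * l * K j j)"
    using psd_onD[OF assms(1), of "{i, j}" "\<lambda>k. if k = i then 1 else l"] assms(2-) by (simp add: add_ac)
  then show ?thesis unfolding complex_norm_square by (simp add: algebra_simps)
qed

lemma psd_on_hermitian:
  assumes "psd_on S K" "i \<in> S" "j \<in> S" shows "K j i = cnj (K i j)"
proof (cases "i = j")
  case True
  then show ?thesis using psd_on_diag[OF assms(1,2)] by (simp add: complex_eq_iff less_eq_complex_def)
next
  case False
  show ?thesis
  proof (rule hermitian_pair)
    fix l
    show "Im (l * K i j + cnj l * K j i) = 0"
      using psd_on_pair[OF assms False, of l] psd_on_diag[OF assms(1,2)] psd_on_diag[OF assms(1,3)]
      by (simp add: less_eq_complex_def del: of_real_power)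
  qed
qed

text \<open>Cauchy-Schwarz for a 2 by 2 minor. This covers the case in which no Cholesky step is
  possible.\<close>

lemma psd_on_diag_zero:
  assumes "psd_on S K" "i \<in> S" "j \<in> S" "K i i = 0" shows "K i j = 0"
proof (cases "i = j")
  case False
  have "(cmod (K i j))\<^sup>2 \<le> Re (K i i) * Re (K j j)"
    using psd_on_pair[OF assms(1-3) False] psd_on_diag[OF assms(1,2)] psd_on_diag[OF assms(1,3)]
    by (intro cauchy_schwarz_pair)
      (auto simp: psd_on_hermitian[OF assms(1-3)] less_eq_complex_def simp del: of_real_power)
  then show ?thesis using assms(4) by simp
qed (use assms in simp)

text \<open>One step of the Cholesky decomposition of \<open>K\<close>.\<close>

lemma psd_on_schur_complement:
  assumes psd: "psd_on (insert a I) K" and a: "a \<notin> I" "K a a \<noteq> 0"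
  shows "psd_on I (\<lambda>i j. K i j - K i a * K a j / K a a)"
  unfolding psd_on_def
proof (intro allI impI)
  fix J c assume J: "finite J" "J \<subseteq> I"
  have aJ: "a \<notin> J" using a J by blast
  define \<sigma> where "\<sigma> = (\<Sum>j\<in>J. c j * K a j)"
  \<comment> \<open>This coefficient at \<open>a\<close> minimises the quadratic form for given
    coefficients on \<open>J\<close>; the minimum is the form of the Schur complement.\<close>
  define d where "d = c(a := - \<sigma> / K a a)"
  have cK: "cnj (K a a) = K a a" using psd_on_hermitian[OF psd, of a a] by simp
  have c\<sigma>: "(\<Sum>i\<in>J. cnj (c i) * K i a) = cnj \<sigma>"
    using J psd_on_hermitian[OF psd, of a] by (simp add: \<sigma>_def subset_iff)
  have d: "d a = - \<sigma> / K a a" "\<And>j. j \<in> J \<Longrightarrow> d j = c j" using aJ by (auto simp: d_def)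
  have "0 \<le> (\<Sum>i\<in>insert a J. \<Sum>j\<in>insert a J. cnj (d i) * d j * K i j)"
    by (rule psd_onD[OF psd]) (use J in auto)
  also have "\<dots> = cnj (d a) * d a * K a a + cnj (d a) * \<sigma> + d a * cnj \<sigma> +
      (\<Sum>i\<in>J. \<Sum>j\<in>J. cnj (c i) * c j * K i j)"
  proof -
    have split: "(\<Sum>i\<in>insert a J. \<Sum>j\<in>insert a J. g i j) =
        g a a + (\<Sum>j\<in>J. g a j) + (\<Sum>i\<in>J. g i a) + (\<Sum>i\<in>J. \<Sum>j\<in>J. g i j)" for g :: "'a \<Rightarrow> 'a \<Rightarrow> complex"
      using J aJ by (simp add: sum.distrib add_ac)
    have "(\<Sum>j\<in>J. cnj (d a) * d j * K a j) = cnj (d a) * \<sigma>"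
      unfolding \<sigma>_def sum_distrib_left by (intro sum.cong refl) (simp add: d(2))
    moreover have "(\<Sum>i\<in>J. cnj (d i) * d a * K i a) = d a * cnj \<sigma>"
      unfolding c\<sigma>[symmetric] sum_distrib_left by (intro sum.cong refl) (simp add: d(2))
    moreover have "(\<Sum>i\<in>J. \<Sum>j\<in>J. cnj (d i) * d j * K i j) = (\<Sum>i\<in>J. \<Sum>j\<in>J. cnj (c i) * c j * K i j)"
      by (intro sum.cong refl) (simp add: d(2))
    ultimately show ?thesis unfolding split by simp
  qed
  also have "cnj (d a) * d a * K a a + cnj (d a) * \<sigma> + d a * cnj \<sigma> = - (cnj \<sigma> * \<sigma> / K a a)"
    using a by (simp add: d cK)
  also have "cnj \<sigma> * \<sigma> / K a a = (\<Sum>i\<in>J. \<Sum>j\<in>J. cnj (c i) * c j * (K i a * K a j / K a a))"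
    unfolding c\<sigma>[symmetric] unfolding \<sigma>_def sum_product sum_divide_distrib
    by (intro sum.cong refl) (simp add: mult_ac)
  finally show "0 \<le> (\<Sum>i\<in>J. \<Sum>j\<in>J. cnj (c i) * c j * (K i j - K i a * K a j / K a a))"
    by (simp add: algebra_simps sum_subtractf)
qed

text \<open>\<open>K\<close> is the sum of the rank-one kernel \<open>K i a * K a j / K a a\<close>
  and its Schur complement at \<open>a\<close>. The rank-one part times \<open>L\<close> is
  \<open>L\<close> with rescaled coefficients. The complement vanishes in row and column
  \<open>a\<close>, so the induction hypothesis applies to it on the smaller index set; the
  induction therefore runs with arbitrary \<open>K\<close>.\<close>

lemma psd_on_schur_product:
  assumes "psd_on S K" "psd_on S L" shows "psd_on S (\<lambda>i j. K i j * L i j)"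
proof -
  have main: "0 \<le> (\<Sum>i\<in>I. \<Sum>j\<in>I. cnj (c i) * c j * (K i j * L i j))"
    if "finite I" "psd_on I K" "psd_on I L" for I c K
    using that
  proof (induction I arbitrary: K rule: finite_induct)
    case (insert a I)
    note psdK = insert.prems(1) and psdL = insert.prems(2)
    have K_I: "psd_on I K" and L_I: "psd_on I L" using psdK psdL psd_on_subset by blast+
    show ?case
    proof (cases "K a a = 0")
      case True
      have z: "K a j = 0" "K j a = 0" if "j \<in> insert a I" for j
        using psd_on_diag_zero[OF psdK _ that True] psd_on_hermitian[OF psdK, of a j] that by auto
      show ?thesis using insert.IH[OF K_I L_I] insert.hyps by (simp add: z)
    next
      case False
      define K' where "K' = (\<lambda>i j. K i j - K i a * K a j / K a a)"
      have K'0: "K' a j = 0" "K' i a = 0" for i j using False by (simp_all add: K'_def)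
      have Kpos: "0 \<le> 1 / K a a"
        using psd_on_diag[OF psdK, of a] by (auto simp: less_eq_complex_def complex_div_gt_0 Re_divide Im_divide)
      have "0 \<le> (\<Sum>i\<in>I. \<Sum>j\<in>I. cnj (c i) * c j * (K' i j * L i j))"
        unfolding K'_def
        by (rule insert.IH[OF psd_on_schur_complement[OF psdK insert.hyps(2) False] L_I])
      also have "\<dots> = (\<Sum>i\<in>insert a I. \<Sum>j\<in>insert a I. cnj (c i) * c j * (K' i j * L i j))"
        using insert.hyps by (simp add: K'0)
      finally have 1: "0 \<le> \<dots>" .
      \<comment> \<open>Both factors of the rank-one part are absorbed into the coefficients, since
        \<open>K i a\<close> is the conjugate of \<open>K a i\<close>.\<close>
      have "0 \<le> (\<Sum>i\<in>insert a I. \<Sum>j\<in>insert a I. cnj (c i * K a i) * (c j * K a j) * L i j)"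
        by (rule psd_onD[OF psdL]) (use insert.hyps in auto)
      with Kpos have "0 \<le> 1 / K a a * (\<Sum>i\<in>insert a I. \<Sum>j\<in>insert a I. cnj (c i * K a i) * (c j * K a j) * L i j)"
        by (rule mult_nonneg_nonneg)
      also have "\<dots> = (\<Sum>i\<in>insert a I. \<Sum>j\<in>insert a I. cnj (c i) * c j * (K i a * K a j / K a a * L i j))"
        unfolding sum_distrib_left
      proof (intro sum.cong refl)
        fix i j assume "i \<in> insert a I"
        then have "cnj (K a i) = K i a" using psd_on_hermitian[OF psdK, of a i] by simp
        then show "1 / K a a * (cnj (c i * K a i) * (c j * K a j) * L i j) =
            cnj (c i) * c j * (K i a * K a j / K a a * L i j)" by simp
      qed
      finally have 2: "0 \<le> \<dots>" .
      have "(\<Sum>i\<in>insert a I. \<Sum>j\<in>insert a I. cnj (c i) * c j * (K i j * L i j)) =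
          (\<Sum>i\<in>insert a I. \<Sum>j\<in>insert a I. cnj (c i) * c j * (K' i j * L i j)) +
          (\<Sum>i\<in>insert a I. \<Sum>j\<in>insert a I. cnj (c i) * c j * (K i a * K a j / K a a * L i j))"
        unfolding sum.distrib[symmetric] by (intro sum.cong refl) (simp add: K'_def algebra_simps)
      then show ?thesis using add_nonneg_nonneg[OF 1 2] by simp
    qed
  qed simp
  show ?thesis unfolding psd_on_def
  proof (intro allI impI)
    fix I c assume "finite I" "I \<subseteq> S"
    then show "0 \<le> (\<Sum>i\<in>I. \<Sum>j\<in>I. cnj (c i) * c j * (K i j * L i j))"
      by (intro main psd_on_subset[OF assms(1)] psd_on_subset[OF assms(2)])
  qed
qed

text \<open>The form is the squared modulus of the sum of the coefficients. It is the start of the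
  induction for finite products.\<close>

lemma psd_on_const_one: "psd_on S (\<lambda>_ _. 1)"
proof -
  have "(\<Sum>i\<in>I. \<Sum>j\<in>I. cnj (c i) * c j) = (cmod (sum c I))\<^sup>2" for I :: "'a set" and c
    by (simp add: complex_norm_square sum_product mult.commute del: of_real_power)
      (subst sum.swap, simp)
  then show ?thesis by (simp add: psd_on_def less_eq_complex_def)
qed

lemma psd_on_prod:
  assumes "finite F" "\<And>f. f \<in> F \<Longrightarrow> psd_on S (K f)"
  shows "psd_on S (\<lambda>i j. \<Prod>f\<in>F. K f i j)"
  using assms by (induction F rule: finite_induct) (simp_all add: psd_on_const_one psd_on_schur_product)

text \<open>The quadratic form is \<open>\<phi> (star T x \<otimes> x)\<close> for \<open>x\<close>
  the linear combination of the \<open>v i\<close> with coefficients \<open>c i\<close>. The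
  induction builds \<open>x\<close> together with two evaluation rules, one for \<open>x\<close> as
  a right factor and one for its adjoint as a left factor; the expansion uses only these.\<close>

lemma (in star_alg) positive_functional_psd:
  assumes \<phi>: "positive_functional T \<phi>" and v: "\<And>k. k \<in> S \<Longrightarrow> v k \<in> carrier T"
  shows "psd_on S (\<lambda>k l. \<phi> (star T (v k) \<otimes> v l))"
  unfolding psd_on_def
proof (intro allI impI)
  fix I c assume I: "finite I" "I \<subseteq> S"
  note lin = positive_linear[OF \<phi>]
  have "\<exists>x\<in>carrier T. (\<forall>y\<in>carrier T. \<phi> (y \<otimes> x) = (\<Sum>l\<in>I. c l * \<phi> (y \<otimes> v l))) \<and>
      (\<forall>y\<in>carrier T. \<phi> (star T x \<otimes> y) = (\<Sum>k\<in>I. cnj (c k) * \<phi> (star T (v k) \<otimes> y)))"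
    using I
  proof (induction I rule: finite_induct)
    case empty
    show ?case by (rule bexI[of _ \<zero>]) (simp_all add: linear_functional_zero[OF lin])
  next
    case (insert a I)
    then obtain x where x: "x \<in> carrier T" "\<forall>y\<in>carrier T. \<phi> (y \<otimes> x) = (\<Sum>l\<in>I. c l * \<phi> (y \<otimes> v l))"
        "\<forall>y\<in>carrier T. \<phi> (star T x \<otimes> y) = (\<Sum>k\<in>I. cnj (c k) * \<phi> (star T (v k) \<otimes> y))"
      by auto
    have va: "v a \<in> carrier T" using insert.prems v by simp
    show ?case
    proof (rule bexI[of _ "c a \<odot> v a \<oplus> x"], intro conjI ballI)
      fix y assume y: "y \<in> carrier T"
      have "\<phi> (y \<otimes> (c a \<odot> v a \<oplus> x)) = c a * \<phi> (y \<otimes> v a) + \<phi> (y \<otimes> x)"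
        using x(1) va y by (simp add: r_distr smult_mult_right linear_functional_add[OF lin]
            linear_functional_smult[OF lin])
      then show "\<phi> (y \<otimes> (c a \<odot> v a \<oplus> x)) = (\<Sum>l\<in>insert a I. c l * \<phi> (y \<otimes> v l))"
        using bspec[OF x(2) y] insert.hyps by simp
      have "\<phi> (star T (c a \<odot> v a \<oplus> x) \<otimes> y) = cnj (c a) * \<phi> (star T (v a) \<otimes> y) + \<phi> (star T x \<otimes> y)"
        using x(1) va y by (simp add: l_distr star_add star_smult smult_mult_left linear_functional_add[OF lin]
            linear_functional_smult[OF lin])
      then show "\<phi> (star T (c a \<odot> v a \<oplus> x) \<otimes> y) = (\<Sum>k\<in>insert a I. cnj (c k) * \<phi> (star T (v k) \<otimes> y))"
        using bspec[OF x(3) y] insert.hyps by simp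
    qed (use x(1) va in simp)
  qed
  then obtain x where x: "x \<in> carrier T" "\<And>y. y \<in> carrier T \<Longrightarrow> \<phi> (y \<otimes> x) = (\<Sum>l\<in>I. c l * \<phi> (y \<otimes> v l))"
      "\<And>y. y \<in> carrier T \<Longrightarrow> \<phi> (star T x \<otimes> y) = (\<Sum>k\<in>I. cnj (c k) * \<phi> (star T (v k) \<otimes> y))"
    by auto
  have "\<phi> (star T x \<otimes> x) = (\<Sum>k\<in>I. cnj (c k) * (\<Sum>l\<in>I. c l * \<phi> (star T (v k) \<otimes> v l)))"
    unfolding x(3)[OF x(1)] using I v by (intro sum.cong refl) (simp add: x(2) subset_iff)
  also have "\<dots> = (\<Sum>i\<in>I. \<Sum>j\<in>I. cnj (c i) * c j * \<phi> (star T (v i) \<otimes> v j))"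
    by (simp add: sum_distrib_left mult_ac)
  finally show "0 \<le> (\<Sum>i\<in>I. \<Sum>j\<in>I. cnj (c i) * c j * \<phi> (star T (v i) \<otimes> v j))"
    using positive_nonneg[OF \<phi> x(1)] by simp
qed

section \<open>Algebras spanned by evaluations of forms\<close>

lemma fun_span_base: "v \<in> S \<Longrightarrow> v \<in> fun_span S"
  unfolding fun_span_def by (intro CollectI exI[of _ 1] exI[of _ "\<lambda>_. 1"] exI[of _ "\<lambda>_. v"]) simp

lemma fun_span_zero: "(\<lambda>_. 0) \<in> fun_span S"
  unfolding fun_span_def by (intro CollectI exI[of _ 0]) simp

lemma fun_span_smult:
  assumes "x \<in> fun_span S" shows "(\<lambda>\<beta>. a * x \<beta>) \<in> fun_span S"
proof -
  obtain n :: nat and c v where "x = (\<lambda>\<beta>. \<Sum>k<n. c k * v k \<beta>)" "\<forall>k<n. v k \<in> S"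
    using assms by (auto simp: fun_span_def)
  then show ?thesis
    unfolding fun_span_def
    by (intro CollectI exI[of _ n] exI[of _ "\<lambda>k. a * c k"] exI[of _ v]) (simp add: sum_distrib_left mult.assoc)
qed

lemma fun_span_add:
  assumes "x \<in> fun_span S" "y \<in> fun_span S" shows "(\<lambda>\<beta>. x \<beta> + y \<beta>) \<in> fun_span S"
proof -
  obtain n :: nat and c v where x: "x = (\<lambda>\<beta>. \<Sum>k<n. c k * v k \<beta>)" "\<forall>k<n. v k \<in> S"
    using assms(1) by (auto simp: fun_span_def)
  obtain n' :: nat and c' v' where y: "y = (\<lambda>\<beta>. \<Sum>k<n'. c' k * v' k \<beta>)" "\<forall>k<n'. v' k \<in> S"
    using assms(2) by (auto simp: fun_span_def)
  let ?c = "\<lambda>k. if k < n then c k else c' (k - n)" and ?v = "\<lambda>k. if k < n then v k else v' (k - n)"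
  have "(\<Sum>k<n + n'. ?c k * ?v k \<beta>) = x \<beta> + y \<beta>" for \<beta>
  proof -
    have "(\<Sum>k<n + n'. ?c k * ?v k \<beta>) = (\<Sum>k<n. ?c k * ?v k \<beta>) + (\<Sum>k=n..<n + n'. ?c k * ?v k \<beta>)"
      unfolding lessThan_atLeast0 by (rule sum.atLeastLessThan_concat[symmetric]) simp_all
    also have "(\<Sum>k=n..<n + n'. ?c k * ?v k \<beta>) = (\<Sum>k<n'. c' k * v' k \<beta>)"
      using sum.shift_bounds_nat_ivl[of "\<lambda>k. ?c k * ?v k \<beta>" 0 n n'] by (simp add: lessThan_atLeast0 add.commute)
    finally show ?thesis using x y by simp
  qed
  then have "(\<lambda>\<beta>. x \<beta> + y \<beta>) = (\<lambda>\<beta>. \<Sum>k<n + n'. ?c k * ?v k \<beta>)" by simp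
  moreover have "\<forall>k<n + n'. ?v k \<in> S" using x y by auto
  ultimately show ?thesis
    unfolding fun_span_def by (intro CollectI exI[of _ "n + n'"] exI[of _ ?c] exI[of _ ?v] conjI)
qed

lemma fun_span_induct:
  assumes x: "x \<in> fun_span S" and zero: "P (\<lambda>_. 0)"
    and add: "\<And>x y. \<lbrakk>x \<in> fun_span S; y \<in> fun_span S; P x; P y\<rbrakk> \<Longrightarrow> P (\<lambda>\<beta>. x \<beta> + y \<beta>)"
    and base: "\<And>c v. v \<in> S \<Longrightarrow> P (\<lambda>\<beta>. c * v \<beta>)"
  shows "P x"
proof -
  obtain n :: nat and c v where x': "x = (\<lambda>\<beta>. \<Sum>k<n. c k * v k \<beta>)" "\<forall>k<n. v k \<in> S"
    using x by (auto simp: fun_span_def)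
  from x'(2) have "(\<lambda>\<beta>. \<Sum>k<n. c k * v k \<beta>) \<in> fun_span S \<and> P (\<lambda>\<beta>. \<Sum>k<n. c k * v k \<beta>)"
  proof (induction n)
    case 0 then show ?case by (simp add: zero fun_span_zero)
  next
    case (Suc n)
    then have IH: "(\<lambda>\<beta>. \<Sum>k<n. c k * v k \<beta>) \<in> fun_span S" "P (\<lambda>\<beta>. \<Sum>k<n. c k * v k \<beta>)"
      and v: "(\<lambda>\<beta>. c n * v n \<beta>) \<in> fun_span S" "P (\<lambda>\<beta>. c n * v n \<beta>)"
      using base by (auto intro: fun_span_smult fun_span_base)
    show ?case using add[OF IH(1) v(1) IH(2) v(2)] fun_span_add[OF IH(1) v(1)] by simp
  qed
  then show ?thesis using x' by simp
qed

text \<open>\<open>alg_tensor\<close> and \<open>alg_inf_tensor\<close> share this shape; \<open>app\<close> and \<open>frm\<close> account for the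
  currying of bilinear forms.\<close>

locale span_alg =
  fixes S :: "'i set" and FF :: "'f set" and app :: "'f \<Rightarrow> 'i \<Rightarrow> complex"
    and frm :: "('i \<Rightarrow> complex) \<Rightarrow> 'f" and m :: "'i \<Rightarrow> 'i \<Rightarrow> 'i" and u :: 'i and st :: "'i \<Rightarrow> 'i"
    and T :: "('f \<Rightarrow> complex) star_algebra" (structure)
  assumes app_frm [simp]: "app (frm f) = f" and frm_app [simp]: "frm (app \<beta>) = \<beta>"
    and carrier_T: "carrier T = fun_span ((\<lambda>c \<beta>. if \<beta> \<in> FF then app \<beta> c else 0) ` S)"
    and zero_T: "\<zero> = (\<lambda>_. 0)"
    and add_T: "x \<oplus> y = (\<lambda>\<beta>. x \<beta> + y \<beta>)"
    and smult_T: "a \<odot> x = (\<lambda>\<beta>. a * x \<beta>)"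
    and mult_T: "x \<otimes> y = (\<lambda>\<beta>. if \<beta> \<in> FF then x (frm (\<lambda>c. y (frm (\<lambda>d. app \<beta> (m c d))))) else 0)"
    and one_T: "\<one> = (\<lambda>\<beta>. if \<beta> \<in> FF then app \<beta> u else 0)"
    and star_T: "star T x = (\<lambda>\<beta>. if \<beta> \<in> FF then cnj (x (frm (\<lambda>c. cnj (app \<beta> (st c))))) else 0)"
    and m_in [simp]: "\<lbrakk>c \<in> S; d \<in> S\<rbrakk> \<Longrightarrow> m c d \<in> S" and u_in [simp]: "u \<in> S"
    and st_in [simp]: "c \<in> S \<Longrightarrow> st c \<in> S"
    and m_assoc': "\<lbrakk>c \<in> S; d \<in> S; e \<in> S\<rbrakk> \<Longrightarrow> m (m c d) e = m c (m d e)"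
    and m_u: "c \<in> S \<Longrightarrow> m u c = c" "c \<in> S \<Longrightarrow> m c u = c"
    and st_st: "c \<in> S \<Longrightarrow> st (st c) = c"
    and st_m: "\<lbrakk>c \<in> S; d \<in> S\<rbrakk> \<Longrightarrow> st (m c d) = m (st d) (st c)"
    and forms_zero: "frm (\<lambda>_. 0) \<in> FF"
    and forms_add: "\<lbrakk>\<beta> \<in> FF; \<gamma> \<in> FF\<rbrakk> \<Longrightarrow> frm (\<lambda>c. app \<beta> c + app \<gamma> c) \<in> FF"
    and forms_smult: "\<beta> \<in> FF \<Longrightarrow> frm (\<lambda>c. a * app \<beta> c) \<in> FF"
    and forms_cong: "\<lbrakk>\<beta> \<in> FF; \<And>c. c \<in> S \<Longrightarrow> app \<gamma> c = app \<beta> c\<rbrakk> \<Longrightarrow> \<gamma> \<in> FF"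
    and forms_left: "\<lbrakk>\<beta> \<in> FF; c \<in> S\<rbrakk> \<Longrightarrow> frm (\<lambda>d. app \<beta> (m c d)) \<in> FF"
    and forms_right: "\<lbrakk>\<beta> \<in> FF; c \<in> S\<rbrakk> \<Longrightarrow> frm (\<lambda>d. app \<beta> (m d c)) \<in> FF"
    and forms_star: "\<beta> \<in> FF \<Longrightarrow> frm (\<lambda>d. cnj (app \<beta> (st d))) \<in> FF"
begin

definition ev :: "'i \<Rightarrow> 'f \<Rightarrow> complex" where
  "ev c = (\<lambda>\<beta>. if \<beta> \<in> FF then app \<beta> c else 0)"

lemma ev_form [simp]: "\<beta> \<in> FF \<Longrightarrow> ev c \<beta> = app \<beta> c"
  by (simp add: ev_def)

lemma carrier_span: "carrier T = fun_span (ev ` S)"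
  unfolding carrier_T ev_def[abs_def] ..

lemma span_zero_in: "\<zero> \<in> carrier T"
  unfolding carrier_span zero_T by (rule fun_span_zero)

lemma span_add_in: "\<lbrakk>x \<in> carrier T; y \<in> carrier T\<rbrakk> \<Longrightarrow> x \<oplus> y \<in> carrier T"
  unfolding carrier_span add_T by (rule fun_span_add)

lemma span_smult_in: "x \<in> carrier T \<Longrightarrow> a \<odot> x \<in> carrier T"
  unfolding carrier_span smult_T by (rule fun_span_smult)

lemma ev_in [simp]: "c \<in> S \<Longrightarrow> ev c \<in> carrier T"
  unfolding carrier_span by (rule fun_span_base) simp

lemma span_induct [consumes 1, case_names zero add ev]:
  assumes "x \<in> carrier T" "P \<zero>"
    "\<And>x y. \<lbrakk>x \<in> carrier T; y \<in> carrier T; P x; P y\<rbrakk> \<Longrightarrow> P (x \<oplus> y)"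
    "\<And>c v. v \<in> S \<Longrightarrow> P (c \<odot> ev v)"
  shows "P x"
proof (rule fun_span_induct[of x "ev ` S" P])
  show "x \<in> fun_span (ev ` S)" using assms(1) by (simp only: carrier_span)
  show "P (\<lambda>_. 0)" using assms(2) by (simp only: zero_T)
  show "P (\<lambda>\<beta>. x \<beta> + y \<beta>)" if "x \<in> fun_span (ev ` S)" "y \<in> fun_span (ev ` S)" "P x" "P y" for x y
    using assms(3)[of x y] that by (simp only: carrier_span add_T)
  show "P (\<lambda>\<beta>. c * v \<beta>)" if "v \<in> ev ` S" for c v
    using assms(4)[of _ c] that by (auto simp only: smult_T)
qed

text \<open>Elements of \<open>T\<close> are functions on forms with no linearity built in; they are
  additive on \<open>FF\<close> because they are combinations of evaluations. Right distributivity
  rests on this, whereas left distributivity is pointwise.\<close>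

lemma form_add:
  assumes "x \<in> carrier T" "\<beta> \<in> FF" "\<gamma> \<in> FF"
  shows "x (frm (\<lambda>c. app \<beta> c + app \<gamma> c)) = x \<beta> + x \<gamma>"
  using assms
  by (induction rule: span_induct) (auto simp: zero_T add_T smult_T forms_add algebra_simps)

lemma form_smult:
  assumes "x \<in> carrier T" "\<beta> \<in> FF" shows "x (frm (\<lambda>c. a * app \<beta> c)) = a * x \<beta>"
  using assms
  by (induction rule: span_induct) (auto simp: zero_T add_T smult_T forms_smult algebra_simps)

lemma form_zero:
  assumes "x \<in> carrier T" shows "x (frm (\<lambda>_. 0)) = 0"
  using assms by (induction rule: span_induct) (auto simp: zero_T add_T smult_T forms_zero)

text \<open>A product evaluates \<open>x\<close> at the form that results from evaluating
  \<open>y\<close> in the second slot. Since this is a form again, the membership test inside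
  evaluations never replaces it by 0.\<close>

lemma forms_contract:
  assumes "y \<in> carrier T" "\<beta> \<in> FF"
  shows "frm (\<lambda>c. y (frm (\<lambda>d. app \<beta> (m c d)))) \<in> FF"
  using assms(1)
proof (induction rule: span_induct)
  case zero then show ?case by (simp add: zero_T forms_zero)
next
  case (add x y)
  from forms_add[OF add.IH] show ?case by (simp add: add_T)
next
  case (ev a v)
  show ?case
    by (rule forms_cong[OF forms_smult[OF forms_right[OF assms(2) ev], of a]])
      (use assms ev forms_left in \<open>simp add: smult_T\<close>)
qed

lemma mult_form:
  "\<beta> \<in> FF \<Longrightarrow> (x \<otimes> y) \<beta> = x (frm (\<lambda>c. y (frm (\<lambda>d. app \<beta> (m c d)))))"
  by (simp add: mult_T)

lemma span_l_zero: "\<zero> \<otimes> y = \<zero>" by (simp add: mult_T zero_T)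
lemma span_l_add: "(x \<oplus> x') \<otimes> y = x \<otimes> y \<oplus> x' \<otimes> y" by (auto simp: mult_T add_T)
lemma span_l_smult: "(a \<odot> x) \<otimes> y = a \<odot> (x \<otimes> y)" by (auto simp: mult_T smult_T)

lemma span_r_zero: "x \<in> carrier T \<Longrightarrow> x \<otimes> \<zero> = \<zero>"
  by (auto simp: mult_T zero_T form_zero)

lemma span_r_add: "\<lbrakk>x \<in> carrier T; y \<in> carrier T; z \<in> carrier T\<rbrakk> \<Longrightarrow> x \<otimes> (y \<oplus> z) = x \<otimes> y \<oplus> x \<otimes> z"
  using form_add[OF _ forms_contract forms_contract, of x y _ z] by (auto simp: mult_T add_T)

lemma span_r_smult: "\<lbrakk>x \<in> carrier T; y \<in> carrier T\<rbrakk> \<Longrightarrow> x \<otimes> (a \<odot> y) = a \<odot> (x \<otimes> y)"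
  using form_smult[OF _ forms_contract, of x y] by (auto simp: mult_T smult_T)

lemma ev_mult: "\<lbrakk>c \<in> S; d \<in> S\<rbrakk> \<Longrightarrow> ev c \<otimes> ev d = ev (m c d)"
  using forms_contract[OF ev_in[of d]] forms_left by (auto simp: mult_T ev_def)

lemma ev_star: "c \<in> S \<Longrightarrow> star T (ev c) = ev (st c)"
  using forms_star by (auto simp: star_T ev_def)

lemma ev_one: "\<one> = ev u" by (simp add: one_T ev_def)

lemma span_smult_smult: "a \<odot> (b \<odot> x) = (a * b) \<odot> x" by (simp add: smult_T mult.assoc)

lemma span_star_zero: "star T \<zero> = \<zero>" by (auto simp: star_T zero_T)
lemma span_star_add: "star T (x \<oplus> y) = star T x \<oplus> star T y" by (auto simp: star_T add_T)
lemma span_star_smult: "star T (a \<odot> x) = cnj a \<odot> star T x" by (auto simp: star_T smult_T)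

lemma span_smult_add: "a \<odot> (x \<oplus> y) = a \<odot> x \<oplus> a \<odot> y"
  and span_smult_zero: "a \<odot> \<zero> = \<zero>"
  by (simp_all add: add_T zero_T smult_T algebra_simps)

lemmas span_bilin = span_smult_add span_smult_zero span_l_zero span_l_add span_l_smult span_r_zero span_r_add span_r_smult ev_mult
  span_smult_smult span_star_zero span_star_add span_star_smult ev_star

lemma span_mult_in:
  assumes "x \<in> carrier T" "y \<in> carrier T" shows "x \<otimes> y \<in> carrier T"
  using assms(1)
proof (induction rule: span_induct)
  case (ev a v)
  from assms(2) show ?case
    by (induction rule: span_induct)
      (use ev in \<open>simp_all add: span_bilin span_zero_in span_add_in span_smult_in\<close>)
qed (use assms in \<open>simp_all add: span_bilin span_zero_in span_add_in\<close>)

lemma span_star_in: "x \<in> carrier T \<Longrightarrow> star T x \<in> carrier T"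
  by (induction rule: span_induct) (simp_all add: span_bilin span_zero_in span_add_in span_smult_in)

lemma span_m_assoc:
  assumes "x \<in> carrier T" "y \<in> carrier T" "z \<in> carrier T" shows "(x \<otimes> y) \<otimes> z = x \<otimes> (y \<otimes> z)"
  using assms(1)
proof (induction rule: span_induct)
  case (ev a v)
  from assms(2) show ?case
  proof (induction rule: span_induct)
    case ev': (ev b w)
    from assms(3) show ?case
      by (induction rule: span_induct)
        (use ev ev' in \<open>simp_all add: span_bilin span_zero_in span_add_in span_smult_in span_mult_in m_assoc' mult_ac\<close>)
  qed (use ev assms in \<open>simp_all add: span_bilin span_zero_in span_add_in span_smult_in span_mult_in\<close>)
qed (use assms in \<open>simp_all add: span_bilin span_zero_in span_add_in span_mult_in\<close>)

lemma span_star_mult: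
  assumes "x \<in> carrier T" "y \<in> carrier T" shows "star T (x \<otimes> y) = star T y \<otimes> star T x"
  using assms(1)
proof (induction rule: span_induct)
  case (ev a v)
  from assms(2) show ?case
    by (induction rule: span_induct)
      (use ev in \<open>simp_all add: span_bilin span_zero_in span_add_in span_smult_in span_star_in st_m mult_ac\<close>)
qed (use assms in \<open>simp_all add: span_bilin span_zero_in span_add_in span_star_in\<close>)

lemma span_star_alg: "star_alg T"
proof (rule star_algI)
  show "\<one> \<in> carrier T" by (simp add: ev_one)
  show "star T (star T x) = x" if "x \<in> carrier T" for x
    using that by (induction rule: span_induct) (simp_all add: span_bilin st_st)
  show "\<one> \<otimes> x = x" if "x \<in> carrier T" for x
    using that by (induction rule: span_induct) (simp_all add: ev_one span_bilin m_u)
  show "x \<otimes> \<one> = x" if "x \<in> carrier T" for x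
    using that by (induction rule: span_induct) (simp_all add: ev_one span_bilin m_u)
  show "(x \<oplus> y) \<oplus> z = x \<oplus> (y \<oplus> z)" "x \<oplus> y = y \<oplus> x" "\<zero> \<oplus> x = x" "0 \<odot> x = \<zero>" "1 \<odot> x = x"
    "(a + b) \<odot> x = a \<odot> x \<oplus> b \<odot> x" for x y z a b
    by (simp_all add: add_T smult_T zero_T algebra_simps)
qed (simp_all add: span_bilin span_m_assoc span_star_mult span_zero_in span_add_in span_smult_in
    span_mult_in span_star_in)

sublocale star_alg T by (rule span_star_alg)

text \<open>Both sides of each law are additive and homogeneous, or conjugate homogeneous, in every
  argument, so agreement on evaluations suffices.\<close>

lemma hom_from_generators:
  fixes R :: "('c, 'k) star_algebra_scheme"
  assumes R: "star_alg R"
    and zero: "f \<zero> = \<zero>\<^bsub>R\<^esub>"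
    and add: "\<And>x y. \<lbrakk>x \<in> carrier T; y \<in> carrier T\<rbrakk> \<Longrightarrow> f (x \<oplus> y) = f x \<oplus>\<^bsub>R\<^esub> f y"
    and smult: "\<And>a x. x \<in> carrier T \<Longrightarrow> f (a \<odot> x) = a \<odot>\<^bsub>R\<^esub> f x"
    and ev: "\<And>c. c \<in> S \<Longrightarrow> f (ev c) \<in> carrier R"
      "\<And>c d. \<lbrakk>c \<in> S; d \<in> S\<rbrakk> \<Longrightarrow> f (ev (m c d)) = f (ev c) \<otimes>\<^bsub>R\<^esub> f (ev d)"
      "\<And>c. c \<in> S \<Longrightarrow> f (ev (st c)) = star R (f (ev c))"
  shows "x \<in> carrier T \<Longrightarrow> f x \<in> carrier R"
    and "\<lbrakk>x \<in> carrier T; y \<in> carrier T\<rbrakk> \<Longrightarrow> f (x \<otimes> y) = f x \<otimes>\<^bsub>R\<^esub> f y"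
    and "x \<in> carrier T \<Longrightarrow> f (star T x) = star R (f x)"
proof -
  interpret R: star_alg R by fact
  show closed: "f x \<in> carrier R" if "x \<in> carrier T" for x
    using that by (induction rule: span_induct) (simp_all add: zero add smult ev)
  show "f (star T x) = star R (f x)" if "x \<in> carrier T"
    using that by (induction rule: span_induct)
      (simp_all add: zero add smult ev closed star_add star_smult R.star_add R.star_smult ev_star)
  show "f (x \<otimes> y) = f x \<otimes>\<^bsub>R\<^esub> f y" if x: "x \<in> carrier T" and y: "y \<in> carrier T"
    using x
  proof (induction rule: span_induct)
    case ev': (ev a v)
    from y show ?case
    proof (induction rule: span_induct)
      case (ev b w)
      then show ?case using ev' by (simp add: smult_mult_left smult_mult_right smult_smult ev_mult smult
            R.smult_mult_left R.smult_mult_right R.smult_smult assms(5-7))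
    qed (use ev' in \<open>simp_all add: zero add closed r_distr R.r_distr\<close>)
  qed (use y in \<open>simp_all add: zero add closed l_distr R.l_distr\<close>)
qed

lemma span_rep:
  assumes "x \<in> carrier T"
  obtains n :: nat and c v where "\<And>k. k < n \<Longrightarrow> v k \<in> S" "\<And>\<beta>. \<beta> \<in> FF \<Longrightarrow> x \<beta> = (\<Sum>k<n. c k * app \<beta> (v k))"
proof -
  obtain n :: nat and c w where x: "x = (\<lambda>\<beta>. \<Sum>k<n. c k * w k \<beta>)" and w: "\<forall>k<n. w k \<in> ev ` S"
    using assms unfolding carrier_span by (auto simp: fun_span_def)
  then have "\<forall>k. \<exists>s. k < n \<longrightarrow> s \<in> S \<and> w k = ev s" by blast
  from choice[OF this] obtain v where v: "\<And>k. k < n \<Longrightarrow> v k \<in> S \<and> w k = ev (v k)" by blast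
  show thesis
  proof (rule that[of n v c])
    show "v k \<in> S" if "k < n" for k using v[OF that] ..
    show "x \<beta> = (\<Sum>k<n. c k * app \<beta> (v k))" if "\<beta> \<in> FF" for \<beta>
      unfolding x by (intro sum.cong refl) (simp add: v that)
  qed
qed

text \<open>Expanding \<open>x\<close> in generators turns
  \<open>(star T x \<otimes> x) \<beta>\<close> into a quadratic form in the coefficients of
  \<open>x\<close>, whose kernel evaluates \<beta> at the products of adjoint generators with
  generators. The kernel is indexed by positions in the expansion because a generator may occur more
  than once.\<close>

lemma positive_functional_form:
  assumes \<beta>: "\<beta> \<in> FF"
    and psd: "\<And>n v. (\<And>k. k < n \<Longrightarrow> v k \<in> S) \<Longrightarrow> psd_on {..<n::nat} (\<lambda>k l. app \<beta> (m (st (v k)) (v l)))"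
  shows "positive_functional T (\<lambda>x. x \<beta>)"
  unfolding positive_functional_def linear_functional_def
proof (intro conjI ballI allI)
  fix x assume x: "x \<in> carrier T"
  from span_rep[OF x] obtain n :: nat and c v
    where v: "\<And>k. k < n \<Longrightarrow> v k \<in> S" and rep: "\<And>\<gamma>. \<gamma> \<in> FF \<Longrightarrow> x \<gamma> = (\<Sum>k<n. c k * app \<gamma> (v k))" by metis
  have "(star T x \<otimes> x) \<beta> = (star T x) (frm (\<lambda>d. x (frm (\<lambda>d'. app \<beta> (m d d')))))"
    using \<beta> by (simp add: mult_form)
  also have "\<dots> = cnj (x (frm (\<lambda>d. cnj (x (frm (\<lambda>d'. app \<beta> (m (st d) d')))))))"
    using forms_contract[OF x \<beta>] by (simp add: star_T)
  also have "\<dots> = cnj (\<Sum>k<n. c k * cnj (x (frm (\<lambda>d'. app \<beta> (m (st (v k)) d')))))"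
    using forms_star[OF forms_contract[OF x \<beta>]] by (subst rep) simp_all
  also have "\<dots> = (\<Sum>k<n. cnj (c k) * (\<Sum>l<n. c l * app \<beta> (m (st (v k)) (v l))))"
    unfolding cnj_sum by (intro sum.cong refl) (use v \<beta> forms_left in \<open>simp add: rep\<close>)
  also have "\<dots> = (\<Sum>k<n. \<Sum>l<n. cnj (c k) * c l * app \<beta> (m (st (v k)) (v l)))"
    by (simp add: sum_distrib_left mult.assoc)
  also have "0 \<le> \<dots>"
  proof -
    have "psd_on {..<n} (\<lambda>k l. app \<beta> (m (st (v k)) (v l)))" by (rule psd) (rule v)
    then show ?thesis by (rule psd_onD) simp_all
  qed
  finally show "0 \<le> (star T x \<otimes> x) \<beta>" .
qed (simp_all add: add_T smult_T)

end

subsection \<open>The algebraic tensor products\<close>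

lemma linear_functional_const_zero: "linear_functional A (\<lambda>_. 0)"
  by (simp add: linear_functional_def)

lemma linear_functional_plus:
  "linear_functional A \<phi> \<Longrightarrow> linear_functional A \<psi> \<Longrightarrow> linear_functional A (\<lambda>x. \<phi> x + \<psi> x)"
  by (simp add: linear_functional_def algebra_simps)

lemma linear_functional_scale: "linear_functional A \<phi> \<Longrightarrow> linear_functional A (\<lambda>x. a * \<phi> x)"
  by (simp add: linear_functional_def algebra_simps)

context star_alg
begin

lemma linear_functional_cong:
  "linear_functional T \<phi> \<Longrightarrow> (\<And>x. x \<in> carrier T \<Longrightarrow> \<psi> x = \<phi> x) \<Longrightarrow> linear_functional T \<psi>"
  by (simp add: linear_functional_def)

lemma linear_functional_l_mult:
  "linear_functional T \<phi> \<Longrightarrow> a \<in> carrier T \<Longrightarrow> linear_functional T (\<lambda>x. \<phi> (a \<otimes> x))"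
  by (simp add: linear_functional_def r_distr smult_mult_right)

lemma linear_functional_r_mult:
  "linear_functional T \<phi> \<Longrightarrow> a \<in> carrier T \<Longrightarrow> linear_functional T (\<lambda>x. \<phi> (x \<otimes> a))"
  by (simp add: linear_functional_def l_distr smult_mult_left)

lemma linear_functional_star:
  "linear_functional T \<phi> \<Longrightarrow> linear_functional T (\<lambda>x. cnj (\<phi> (star T x)))"
  by (simp add: linear_functional_def star_add star_smult)

end

lemma bilinear_formsI:
  assumes "\<And>a. a \<in> carrier A \<Longrightarrow> linear_functional B (\<beta> a)"
    "\<And>b. b \<in> carrier B \<Longrightarrow> linear_functional A (\<lambda>a. \<beta> a b)"
  shows "\<beta> \<in> bilinear_forms A B"
  using assms by (simp add: bilinear_forms_def)

lemma bilinear_formsD: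
  assumes "\<beta> \<in> bilinear_forms A B"
  shows "a \<in> carrier A \<Longrightarrow> linear_functional B (\<lambda>b. \<beta> a b)"
    "b \<in> carrier B \<Longrightarrow> linear_functional A (\<lambda>a. \<beta> a b)"
  using assms by (simp_all add: bilinear_forms_def)

lemma alg_tensor_span_alg:
  assumes "star_alg A" "star_alg B"
  shows "span_alg (carrier A \<times> carrier B) (bilinear_forms A B) (\<lambda>\<beta> (a, b). \<beta> a b) (\<lambda>f a b. f (a, b))
    (\<lambda>(a, b) (a', b'). (a \<otimes>\<^bsub>A\<^esub> a', b \<otimes>\<^bsub>B\<^esub> b')) (\<one>\<^bsub>A\<^esub>, \<one>\<^bsub>B\<^esub>) (\<lambda>(a, b). (star A a, star B b)) (alg_tensor A B)"
proof -
  interpret A: star_alg A by fact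
  interpret B: star_alg B by fact
  note lfs = linear_functional_const_zero linear_functional_plus linear_functional_scale
    A.linear_functional_l_mult A.linear_functional_r_mult A.linear_functional_star
    B.linear_functional_l_mult B.linear_functional_r_mult B.linear_functional_star
  show ?thesis
  proof
    have "{pure_tensor A B a b | a b. a \<in> carrier A \<and> b \<in> carrier B} =
        (\<lambda>c \<beta>. if \<beta> \<in> bilinear_forms A B then case c of (a, b) \<Rightarrow> \<beta> a b else 0) ` (carrier A \<times> carrier B)"
      by (force simp: pure_tensor_def)
    then show "carrier (alg_tensor A B) =
        fun_span ((\<lambda>c \<beta>. if \<beta> \<in> bilinear_forms A B then case c of (a, b) \<Rightarrow> \<beta> a b else 0) ` (carrier A \<times> carrier B))"
      by (simp add: alg_tensor_def)
    fix \<beta> assume \<beta>: "\<beta> \<in> bilinear_forms A B"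
    note \<beta>' = bilinear_formsD[OF \<beta>]
    show "(\<lambda>a b. x * (case (a, b) of (a, b) \<Rightarrow> \<beta> a b)) \<in> bilinear_forms A B" for x
      using \<beta>' by (intro bilinear_formsI) (auto intro: lfs)
    show "(\<lambda>a b. cnj (case (case (a, b) of (a, b) \<Rightarrow> (star A a, star B b)) of (a, b) \<Rightarrow> \<beta> a b)) \<in> bilinear_forms A B"
      using \<beta>' by (intro bilinear_formsI) (auto intro: lfs)
    show "\<gamma> \<in> bilinear_forms A B"
      if "\<And>c. c \<in> carrier A \<times> carrier B \<Longrightarrow> (case c of (a, b) \<Rightarrow> \<gamma> a b) = (case c of (a, b) \<Rightarrow> \<beta> a b)" for \<gamma>
      by (intro bilinear_formsI A.linear_functional_cong[OF \<beta>'(2)] B.linear_functional_cong[OF \<beta>'(1)])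
        (use that in auto)
    fix c assume c: "c \<in> carrier A \<times> carrier B"
    show "(\<lambda>a b. case (case c of (a, b) \<Rightarrow> \<lambda>(a', b'). (a \<otimes>\<^bsub>A\<^esub> a', b \<otimes>\<^bsub>B\<^esub> b')) (a, b) of (a, b) \<Rightarrow> \<beta> a b) \<in> bilinear_forms A B"
      using \<beta>' c by (intro bilinear_formsI) (auto intro: lfs)
    show "(\<lambda>a b. case (case (a, b) of (a, b) \<Rightarrow> \<lambda>(a', b'). (a \<otimes>\<^bsub>A\<^esub> a', b \<otimes>\<^bsub>B\<^esub> b')) c of (a, b) \<Rightarrow> \<beta> a b) \<in> bilinear_forms A B"
      using \<beta>' c by (intro bilinear_formsI) (auto intro: lfs)
  next
    fix \<beta> \<gamma> assume "\<beta> \<in> bilinear_forms A B" "\<gamma> \<in> bilinear_forms A B"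
    then show "(\<lambda>a b. (case (a, b) of (a, b) \<Rightarrow> \<beta> a b) + (case (a, b) of (a, b) \<Rightarrow> \<gamma> a b)) \<in> bilinear_forms A B"
      by (intro bilinear_formsI) (auto intro: lfs bilinear_formsD)
  qed (auto simp: alg_tensor_def pure_tensor_def A.m_assoc B.m_assoc A.star_mult B.star_mult
      bilinear_forms_def linear_functional_const_zero)
qed

lemma multilinear_formsD:
  "\<lbrakk>\<beta> \<in> multilinear_forms J C; c \<in> restr_prod J C; j \<in> J\<rbrakk> \<Longrightarrow> linear_functional (C j) (\<lambda>v. \<beta> (c(j := v)))"
  by (auto simp: multilinear_forms_def)

lemma restr_prod_closed: "c \<in> restr_prod J C \<Longrightarrow> j \<in> J \<Longrightarrow> c j \<in> carrier (C j)"
  by (auto simp: restr_prod_def)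

lemma restr_prod_eqI:
  "\<lbrakk>c \<in> restr_prod J C; d \<in> restr_prod J C; \<And>j. j \<in> J \<Longrightarrow> c j = d j\<rbrakk> \<Longrightarrow> c = d"
  by (rule extensionalityI[of _ J]) (auto simp: restr_prod_def PiE_def)

lemma restr_prod_one:
  assumes "\<And>j. j \<in> J \<Longrightarrow> cstar_algebra (C j)"
  shows "(\<lambda>j\<in>J. \<one>\<^bsub>C j\<^esub>) \<in> restr_prod J C"
proof -
  have "ring (C j)" if "j \<in> J" for j
    using cstar_algebra_imp_star_alg[OF assms[OF that]] by (rule star_alg.axioms(1))
  then show ?thesis by (auto simp: restr_prod_def ring.ring_simprules)
qed

lemma alg_inf_tensor_span_alg:
  assumes C: "\<And>j. j \<in> J \<Longrightarrow> cstar_algebra (C j)"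
  shows "span_alg (restr_prod J C) (multilinear_forms J C) (\<lambda>\<beta>. \<beta>) (\<lambda>\<beta>. \<beta>)
    (\<lambda>c d. \<lambda>j\<in>J. c j \<otimes>\<^bsub>C j\<^esub> d j) (\<lambda>j\<in>J. \<one>\<^bsub>C j\<^esub>) (\<lambda>c. \<lambda>j\<in>J. star (C j) (c j)) (alg_inf_tensor J C)"
proof -
  have salg: "star_alg (C j)" if "j \<in> J" for j by (rule cstar_algebra_imp_star_alg[OF C[OF that]])
  note lfs = linear_functional_const_zero linear_functional_plus linear_functional_scale
  note closed = restr_prod_closed
  have mult: "(\<lambda>j\<in>J. c j \<otimes>\<^bsub>C j\<^esub> d j) \<in> restr_prod J C" if "c \<in> restr_prod J C" "d \<in> restr_prod J C" for c d
    by (rule restr_prod_mult[OF C that])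
  have str: "(\<lambda>j\<in>J. star (C j) (c j)) \<in> restr_prod J C" if "c \<in> restr_prod J C" for c
    by (rule restr_prod_star[OF C that])
  have upd: "(\<lambda>i\<in>J. x i \<otimes>\<^bsub>C i\<^esub> (y(j := v)) i) = (\<lambda>i\<in>J. x i \<otimes>\<^bsub>C i\<^esub> y i)(j := x j \<otimes>\<^bsub>C j\<^esub> v)"
    "(\<lambda>i\<in>J. (x(j := v)) i \<otimes>\<^bsub>C i\<^esub> y i) = (\<lambda>i\<in>J. x i \<otimes>\<^bsub>C i\<^esub> y i)(j := v \<otimes>\<^bsub>C j\<^esub> y j)"
    "(\<lambda>i\<in>J. star (C i) ((x(j := v)) i)) = (\<lambda>i\<in>J. star (C i) (x i))(j := star (C j) v)"
    if "j \<in> J" for x y j v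
    using that by (auto simp: restrict_def)
  show ?thesis
  proof
    show "carrier (alg_inf_tensor J C) =
        fun_span ((\<lambda>c \<beta>. if \<beta> \<in> multilinear_forms J C then \<beta> c else 0) ` restr_prod J C)"
      by (simp add: alg_inf_tensor_def pure_inf_tensor_def[abs_def])
    show one: "(\<lambda>j\<in>J. \<one>\<^bsub>C j\<^esub>) \<in> restr_prod J C" by (rule restr_prod_one[OF C])
    fix c assume c: "c \<in> restr_prod J C"
    show "(\<lambda>j\<in>J. (\<lambda>j\<in>J. \<one>\<^bsub>C j\<^esub>) j \<otimes>\<^bsub>C j\<^esub> c j) = c" "(\<lambda>j\<in>J. c j \<otimes>\<^bsub>C j\<^esub> (\<lambda>j\<in>J. \<one>\<^bsub>C j\<^esub>) j) = c"
      using closed[OF c] mult[OF one c] mult[OF c one] salg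
      by (auto intro!: restr_prod_eqI[OF _ c] simp: ring.ring_simprules star_alg.axioms(1) monoid.r_one[OF ring.is_monoid])
    show s1: "(\<lambda>j\<in>J. star (C j) (c j)) \<in> restr_prod J C" by (rule str[OF c])
    show "(\<lambda>j\<in>J. star (C j) ((\<lambda>j\<in>J. star (C j) (c j)) j)) = c"
      by (rule restr_prod_eqI[OF str[OF s1] c])
        (use closed[OF c] salg in \<open>auto simp: star_alg.star_star\<close>)
    fix d assume d: "d \<in> restr_prod J C"
    show "(\<lambda>j\<in>J. c j \<otimes>\<^bsub>C j\<^esub> d j) \<in> restr_prod J C" by (rule mult[OF c d])
    show "(\<lambda>j\<in>J. star (C j) ((\<lambda>j\<in>J. c j \<otimes>\<^bsub>C j\<^esub> d j) j)) =
        (\<lambda>j\<in>J. (\<lambda>j\<in>J. star (C j) (d j)) j \<otimes>\<^bsub>C j\<^esub> (\<lambda>j\<in>J. star (C j) (c j)) j)"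
      using closed[OF c] closed[OF d] salg by (auto simp: star_alg.star_mult restrict_def fun_eq_iff)
    fix e assume e: "e \<in> restr_prod J C"
    show "(\<lambda>j\<in>J. (\<lambda>j\<in>J. c j \<otimes>\<^bsub>C j\<^esub> d j) j \<otimes>\<^bsub>C j\<^esub> e j) = (\<lambda>j\<in>J. c j \<otimes>\<^bsub>C j\<^esub> (\<lambda>j\<in>J. d j \<otimes>\<^bsub>C j\<^esub> e j) j)"
      using closed[OF c] closed[OF d] closed[OF e] salg
      by (auto simp: ring.ring_simprules star_alg.axioms(1) restrict_def fun_eq_iff)
  next
    fix \<beta> assume \<beta>: "\<beta> \<in> multilinear_forms J C"
    note \<beta>' = multilinear_formsD[OF \<beta>]
    show "(\<lambda>c. a * \<beta> c) \<in> multilinear_forms J C" for a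
      using \<beta>' by (auto simp: multilinear_forms_def intro: lfs)
    show "\<gamma> \<in> multilinear_forms J C" if "\<And>c. c \<in> restr_prod J C \<Longrightarrow> \<gamma> c = \<beta> c" for \<gamma>
      unfolding multilinear_forms_def
      by (intro CollectI ballI star_alg.linear_functional_cong[OF salg \<beta>']) (simp_all add: that restr_prod_upd)
    show "(\<lambda>c. cnj (\<beta> (\<lambda>j\<in>J. star (C j) (c j)))) \<in> multilinear_forms J C"
      unfolding multilinear_forms_def
    proof (intro CollectI ballI)
      fix c j assume c: "c \<in> restr_prod J C" and j: "j \<in> J"
      show "linear_functional (C j) (\<lambda>v. cnj (\<beta> (\<lambda>i\<in>J. star (C i) ((c(j := v)) i))))"
        unfolding upd[OF j] by (rule star_alg.linear_functional_star[OF salg[OF j] \<beta>'[OF str[OF c] j]])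
    qed
    fix c assume c: "c \<in> restr_prod J C"
    show "(\<lambda>d. \<beta> (\<lambda>j\<in>J. c j \<otimes>\<^bsub>C j\<^esub> d j)) \<in> multilinear_forms J C"
      unfolding multilinear_forms_def
    proof (intro CollectI ballI)
      fix d j assume d: "d \<in> restr_prod J C" and j: "j \<in> J"
      show "linear_functional (C j) (\<lambda>v. \<beta> (\<lambda>i\<in>J. c i \<otimes>\<^bsub>C i\<^esub> (d(j := v)) i))"
        unfolding upd[OF j]
        by (rule star_alg.linear_functional_l_mult[OF salg[OF j] \<beta>'[OF mult[OF c d] j] closed[OF c j]])
    qed
    show "(\<lambda>d. \<beta> (\<lambda>j\<in>J. d j \<otimes>\<^bsub>C j\<^esub> c j)) \<in> multilinear_forms J C"
      unfolding multilinear_forms_def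
    proof (intro CollectI ballI)
      fix d j assume d: "d \<in> restr_prod J C" and j: "j \<in> J"
      show "linear_functional (C j) (\<lambda>v. \<beta> (\<lambda>i\<in>J. (d(j := v)) i \<otimes>\<^bsub>C i\<^esub> c i))"
        unfolding upd[OF j]
        by (rule star_alg.linear_functional_r_mult[OF salg[OF j] \<beta>'[OF mult[OF d c] j] closed[OF c j]])
    qed
  next
    fix \<beta> \<gamma> assume "\<beta> \<in> multilinear_forms J C" "\<gamma> \<in> multilinear_forms J C"
    then show "(\<lambda>c. \<beta> c + \<gamma> c) \<in> multilinear_forms J C"
      by (auto simp: multilinear_forms_def intro: lfs)
  qed (auto simp: alg_inf_tensor_def pure_inf_tensor_def multilinear_forms_def linear_functional_const_zero)
qed

no_notation fps_nth (infixl "$" 75)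

section \<open>Tensor products of two C*-algebras\<close>

lemma with_norm_simps [simp]:
  "carrier (with_norm T p) = carrier T" "monoid.mult (with_norm T p) = monoid.mult T"
  "one (with_norm T p) = one T" "zero (with_norm T p) = zero T" "add (with_norm T p) = add T"
  "module.smult (with_norm T p) = module.smult T" "star (with_norm T p) = star T" "nrm (with_norm T p) = p"
  by (simp_all add: with_norm_def star_algebra.extend_def)

lemma with_norm_pre_cstar:
  assumes "star_alg T" "cstar_seminorm T p" shows "pre_cstar (with_norm T p)"
proof (rule pre_cstarI)
  interpret star_alg T by fact
  show "star_alg (with_norm T p)"
    by (rule star_algI; (simp only: with_norm_simps)?)
      (simp_all add: a_assoc m_assoc l_distr r_distr smult_l_distr smult_r_distr
        smult_smult smult_mult_left smult_mult_right star_add star_smult star_mult, simp add: a_comm)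
  show "cstar_seminorm (with_norm T p) (nrm (with_norm T p))"
    using assms(2) by (simp add: cstar_seminorm_def)
qed

text \<open>What is visible of a unital *-homomorphism on elementary tensors, as a curried map. The
  embezzlement isomorphisms enter the towers in this form alone; \<open>max_pure\<close> and
  \<open>min_pure\<close> are further instances.\<close>

definition tensor_hom ::
    "'a normed_star_algebra \<Rightarrow> 'c normed_star_algebra \<Rightarrow> 'r normed_star_algebra \<Rightarrow> ('a \<Rightarrow> 'c \<Rightarrow> 'r) \<Rightarrow> bool" where
  "tensor_hom A C R \<mu> \<longleftrightarrow> \<mu> \<one>\<^bsub>A\<^esub> \<one>\<^bsub>C\<^esub> = \<one>\<^bsub>R\<^esub> \<and> (\<forall>a\<in>carrier A. \<forall>c\<in>carrier C. \<mu> a c \<in> carrier R \<and>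
     \<mu> (star A a) (star C c) = star R (\<mu> a c) \<and>
     (\<forall>k. \<mu> (k \<odot>\<^bsub>A\<^esub> a) c = k \<odot>\<^bsub>R\<^esub> \<mu> a c \<and> \<mu> a (k \<odot>\<^bsub>C\<^esub> c) = k \<odot>\<^bsub>R\<^esub> \<mu> a c) \<and>
     (\<forall>a'\<in>carrier A. \<mu> (a \<oplus>\<^bsub>A\<^esub> a') c = \<mu> a c \<oplus>\<^bsub>R\<^esub> \<mu> a' c) \<and>
     (\<forall>c'\<in>carrier C. \<mu> a (c \<oplus>\<^bsub>C\<^esub> c') = \<mu> a c \<oplus>\<^bsub>R\<^esub> \<mu> a c') \<and>
     (\<forall>a'\<in>carrier A. \<forall>c'\<in>carrier C. \<mu> (a \<otimes>\<^bsub>A\<^esub> a') (c \<otimes>\<^bsub>C\<^esub> c') = \<mu> a c \<otimes>\<^bsub>R\<^esub> \<mu> a' c'))"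

lemma tensor_homD:
  assumes "tensor_hom A C R \<mu>"
  shows "\<mu> \<one>\<^bsub>A\<^esub> \<one>\<^bsub>C\<^esub> = \<one>\<^bsub>R\<^esub>"
    "\<lbrakk>a \<in> carrier A; c \<in> carrier C\<rbrakk> \<Longrightarrow> \<mu> a c \<in> carrier R"
    "\<lbrakk>a \<in> carrier A; c \<in> carrier C\<rbrakk> \<Longrightarrow> \<mu> (star A a) (star C c) = star R (\<mu> a c)"
    "\<lbrakk>a \<in> carrier A; c \<in> carrier C\<rbrakk> \<Longrightarrow> \<mu> (k \<odot>\<^bsub>A\<^esub> a) c = k \<odot>\<^bsub>R\<^esub> \<mu> a c"
    "\<lbrakk>a \<in> carrier A; c \<in> carrier C\<rbrakk> \<Longrightarrow> \<mu> a (k \<odot>\<^bsub>C\<^esub> c) = k \<odot>\<^bsub>R\<^esub> \<mu> a c"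
    "\<lbrakk>a \<in> carrier A; a' \<in> carrier A; c \<in> carrier C\<rbrakk> \<Longrightarrow> \<mu> (a \<oplus>\<^bsub>A\<^esub> a') c = \<mu> a c \<oplus>\<^bsub>R\<^esub> \<mu> a' c"
    "\<lbrakk>a \<in> carrier A; c \<in> carrier C; c' \<in> carrier C\<rbrakk> \<Longrightarrow> \<mu> a (c \<oplus>\<^bsub>C\<^esub> c') = \<mu> a c \<oplus>\<^bsub>R\<^esub> \<mu> a c'"
    "\<lbrakk>a \<in> carrier A; a' \<in> carrier A; c \<in> carrier C; c' \<in> carrier C\<rbrakk> \<Longrightarrow>
      \<mu> (a \<otimes>\<^bsub>A\<^esub> a') (c \<otimes>\<^bsub>C\<^esub> c') = \<mu> a c \<otimes>\<^bsub>R\<^esub> \<mu> a' c'"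
  using assms unfolding tensor_hom_def by blast+

lemma tensor_hom_comp:
  assumes "tensor_hom A C R \<mu>" "star_hom R R' h" shows "tensor_hom A C R' (\<lambda>a c. h (\<mu> a c))"
  using tensor_homD[OF assms(1)] star_homD[OF assms(2)] by (simp add: tensor_hom_def)

locale cstar_pair =
  fixes A :: "'a normed_star_algebra" and B :: "'b normed_star_algebra"
  assumes A: "cstar_algebra A" and B: "cstar_algebra B"
begin

sublocale A: pre_cstar A by (rule cstar_algebra_imp_pre_cstar[OF A])
sublocale B: pre_cstar B by (rule cstar_algebra_imp_pre_cstar[OF B])

sublocale T: span_alg "carrier A \<times> carrier B" "bilinear_forms A B" "\<lambda>\<beta> (a, b). \<beta> a b" "\<lambda>f a b. f (a, b)"
    "\<lambda>(a, b) (a', b'). (a \<otimes>\<^bsub>A\<^esub> a', b \<otimes>\<^bsub>B\<^esub> b')" "(\<one>\<^bsub>A\<^esub>, \<one>\<^bsub>B\<^esub>)" "\<lambda>(a, b). (star A a, star B b)" "alg_tensor A B"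
  by (rule alg_tensor_span_alg[OF A.star_alg_axioms B.star_alg_axioms])

abbreviation T where "T \<equiv> alg_tensor A B"
abbreviation pure where "pure \<equiv> pure_tensor A B"

lemma T_ev: "T.ev (a, b) = pure a b"
  by (auto simp: T.ev_def pure_tensor_def fun_eq_iff)

lemma pure_in [simp]: "\<lbrakk>a \<in> carrier A; b \<in> carrier B\<rbrakk> \<Longrightarrow> pure a b \<in> carrier T"
  using T.ev_in[of "(a, b)"] by (simp add: T_ev)

lemma T_induct [consumes 1, case_names zero add pure]:
  assumes "x \<in> carrier T" "P \<zero>\<^bsub>T\<^esub>"
    "\<And>x y. \<lbrakk>x \<in> carrier T; y \<in> carrier T; P x; P y\<rbrakk> \<Longrightarrow> P (x \<oplus>\<^bsub>T\<^esub> y)"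
    "\<And>k a b. \<lbrakk>a \<in> carrier A; b \<in> carrier B\<rbrakk> \<Longrightarrow> P (k \<odot>\<^bsub>T\<^esub> pure a b)"
  shows "P x"
  using assms(1)
proof (induction rule: T.span_induct)
  case (ev c v) then show ?case using assms(4)[of "fst v" "snd v" c] by (auto simp: T_ev)
qed (use assms in auto)

lemma pure_mult: "\<lbrakk>a \<in> carrier A; a' \<in> carrier A; b \<in> carrier B; b' \<in> carrier B\<rbrakk> \<Longrightarrow>
    pure (a \<otimes>\<^bsub>A\<^esub> a') (b \<otimes>\<^bsub>B\<^esub> b') = pure a b \<otimes>\<^bsub>T\<^esub> pure a' b'"
  by (simp add: alg_tensor_mult_pure[OF A B])

lemma pure_star: "\<lbrakk>a \<in> carrier A; b \<in> carrier B\<rbrakk> \<Longrightarrow> pure (star A a) (star B b) = star T (pure a b)"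
  by (simp add: alg_tensor_star_pure[OF A B])

lemma pure_one: "pure \<one>\<^bsub>A\<^esub> \<one>\<^bsub>B\<^esub> = \<one>\<^bsub>T\<^esub>"
  by (simp add: alg_tensor_def)

lemma
  assumes "a \<in> carrier A" "b \<in> carrier B"
  shows pure_smult_l: "pure (k \<odot>\<^bsub>A\<^esub> a) b = k \<odot>\<^bsub>T\<^esub> pure a b"
    and pure_smult_r: "pure a (k \<odot>\<^bsub>B\<^esub> b) = k \<odot>\<^bsub>T\<^esub> pure a b"
    and pure_add_l: "a' \<in> carrier A \<Longrightarrow> pure (a \<oplus>\<^bsub>A\<^esub> a') b = pure a b \<oplus>\<^bsub>T\<^esub> pure a' b"
    and pure_add_r: "b' \<in> carrier B \<Longrightarrow> pure a (b \<oplus>\<^bsub>B\<^esub> b') = pure a b \<oplus>\<^bsub>T\<^esub> pure a b'"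
  using assms by (auto simp: pure_tensor_def alg_tensor_def bilinear_forms_def linear_functional_def)

text \<open>With one factor fixed at the unit, \<open>p\<close> becomes a C*-seminorm on the other
  C*-algebra and is dominated by its norm; an elementary tensor is the product of two such elements.
  This estimate is what makes the maximal norm finite.\<close>

lemma seminorm_pure_le:
  assumes p: "cstar_seminorm T p" and a: "a \<in> carrier A" and b: "b \<in> carrier B"
  shows "p (pure a b) \<le> nrm A a * nrm B b"
proof -
  interpret p: cstar_seminormed T p by unfold_locales (rule p)
  have "cstar_seminorm A (\<lambda>a. p (pure a \<one>\<^bsub>B\<^esub>))"
    by (rule cstar_seminorm_pullback[OF p])
      (use pure_mult[of _ _ "\<one>\<^bsub>B\<^esub>" "\<one>\<^bsub>B\<^esub>"] pure_star[of _ "\<one>\<^bsub>B\<^esub>"] in \<open>simp_all add: pure_add_l pure_smult_l\<close>)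
  then have 1: "p (pure a \<one>\<^bsub>B\<^esub>) \<le> nrm A a" by (rule cstar_seminorm_le_nrm[OF A _ a])
  have "cstar_seminorm B (\<lambda>b. p (pure \<one>\<^bsub>A\<^esub> b))"
    by (rule cstar_seminorm_pullback[OF p])
      (use pure_mult[of "\<one>\<^bsub>A\<^esub>" "\<one>\<^bsub>A\<^esub>"] pure_star[of "\<one>\<^bsub>A\<^esub>"] in \<open>simp_all add: pure_add_r pure_smult_r\<close>)
  then have 2: "p (pure \<one>\<^bsub>A\<^esub> b) \<le> nrm B b" by (rule cstar_seminorm_le_nrm[OF B _ b])
  have "p (pure a b) \<le> p (pure a \<one>\<^bsub>B\<^esub>) * p (pure \<one>\<^bsub>A\<^esub> b)"
    using pure_mult[of a "\<one>\<^bsub>A\<^esub>" "\<one>\<^bsub>B\<^esub>" b] p.p_mult_le[of "pure a \<one>\<^bsub>B\<^esub>" "pure \<one>\<^bsub>A\<^esub> b"] a b by simp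
  also have "\<dots> \<le> nrm A a * nrm B b"
    using a b by (intro mult_mono 1 2) auto
  finally show ?thesis .
qed

section \<open>The maximal norm\<close>

lemma zero_seminorm: "cstar_seminorm T (\<lambda>_. 0)"
  by (simp add: cstar_seminorm_def)

lemma bdd_above_seminorms:
  assumes "x \<in> carrier T"
  shows "bdd_above ((\<lambda>p. p x) ` {p. cstar_seminorm T p})"
proof -
  have "\<exists>K. \<forall>p. cstar_seminorm T p \<longrightarrow> p x \<le> K" (is "\<exists>K. ?bound x K")
    using assms
  proof (induction rule: T_induct)
    case zero
    have "p \<zero>\<^bsub>T\<^esub> \<le> 0" if "cstar_seminorm T p" for p
    proof -
      interpret p: cstar_seminormed T p by unfold_locales (rule that)
      show ?thesis by simp
    qed
    then show ?case by blast
  next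
    case (add x y)
    then obtain K L where K: "\<And>p. cstar_seminorm T p \<Longrightarrow> p x \<le> K" and L: "\<And>p. cstar_seminorm T p \<Longrightarrow> p y \<le> L"
      by blast
    have "p (x \<oplus>\<^bsub>T\<^esub> y) \<le> K + L" if "cstar_seminorm T p" for p
      using K[OF that] L[OF that] that add.hyps by (force simp: cstar_seminorm_def)
    then show ?case by blast
  next
    case (pure k a b)
    have "p (k \<odot>\<^bsub>T\<^esub> pure a b) \<le> cmod k * (nrm A a * nrm B b)" if "cstar_seminorm T p" for p
      using seminorm_pure_le[OF that pure] that pure by (simp add: cstar_seminorm_def mult_left_mono)
    then show ?case by blast
  qed
  then obtain K where "?bound x K" ..
  then show ?thesis by (intro bdd_aboveI[of _ K]) auto
qed

lemma seminorm_le_max_norm: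
  "\<lbrakk>cstar_seminorm T p; x \<in> carrier T\<rbrakk> \<Longrightarrow> p x \<le> max_norm A B x"
  unfolding max_norm_def by (rule cSUP_upper[OF _ bdd_above_seminorms]) auto

text \<open>The zero seminorm makes the set of C*-seminorms nonempty, so that the supremum is a
  least upper bound.\<close>

lemma max_norm_least:
  "(\<And>p. cstar_seminorm T p \<Longrightarrow> p x \<le> M) \<Longrightarrow> max_norm A B x \<le> M"
  unfolding max_norm_def using zero_seminorm by (intro cSUP_least) auto

text \<open>Each law passes from the individual seminorms to their pointwise supremum; for the
  C*-identity, squares and suprema are interchanged by taking square roots.\<close>

lemma max_norm_seminorm: "cstar_seminorm T (max_norm A B)"
proof -
  let ?M = "max_norm A B"
  note le = seminorm_le_max_norm
  have nonneg: "0 \<le> ?M x" if "x \<in> carrier T" for x using le[OF zero_seminorm that] .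
  have smult_le: "?M (c \<odot>\<^bsub>T\<^esub> x) \<le> cmod c * ?M x" if x: "x \<in> carrier T" for c x
    using le[OF _ x] x by (intro max_norm_least) (simp add: cstar_seminorm_def mult_left_mono)
  have smult: "?M (c \<odot>\<^bsub>T\<^esub> x) = cmod c * ?M x" if x: "x \<in> carrier T" for c x
  proof (rule antisym[OF smult_le[OF x]], cases "c = 0")
    case False
    have "?M x \<le> cmod (1 / c) * ?M (c \<odot>\<^bsub>T\<^esub> x)"
      using smult_le[of "c \<odot>\<^bsub>T\<^esub> x" "1 / c"] x False by (simp add: T.smult_smult)
    then show "cmod c * ?M x \<le> ?M (c \<odot>\<^bsub>T\<^esub> x)" using False by (simp add: norm_divide field_simps)
  qed (use nonneg x in auto)
  have add: "?M (x \<oplus>\<^bsub>T\<^esub> y) \<le> ?M x + ?M y" if "x \<in> carrier T" "y \<in> carrier T" for x y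
  proof (rule max_norm_least)
    fix p assume p: "cstar_seminorm T p"
    then show "p (x \<oplus>\<^bsub>T\<^esub> y) \<le> ?M x + ?M y"
      using le[OF p that(1)] le[OF p that(2)] that by (force simp: cstar_seminorm_def)
  qed
  have mult: "?M (x \<otimes>\<^bsub>T\<^esub> y) \<le> ?M x * ?M y" if "x \<in> carrier T" "y \<in> carrier T" for x y
  proof (rule max_norm_least)
    fix p assume p: "cstar_seminorm T p"
    have "p (x \<otimes>\<^bsub>T\<^esub> y) \<le> p x * p y" using p that by (simp add: cstar_seminorm_def)
    also have "\<dots> \<le> ?M x * ?M y"
      using p that by (intro mult_mono le[OF p] nonneg) (auto simp: cstar_seminorm_def)
    finally show "p (x \<otimes>\<^bsub>T\<^esub> y) \<le> ?M x * ?M y" .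
  qed
  have cstar: "?M (star T x \<otimes>\<^bsub>T\<^esub> x) = (?M x)\<^sup>2" if x: "x \<in> carrier T" for x
  proof (rule antisym)
    have h: "star T x \<otimes>\<^bsub>T\<^esub> x \<in> carrier T" using x by simp
    show "?M (star T x \<otimes>\<^bsub>T\<^esub> x) \<le> (?M x)\<^sup>2"
    proof (rule max_norm_least)
      fix p assume p: "cstar_seminorm T p"
      have "(p x)\<^sup>2 \<le> (?M x)\<^sup>2" using p x by (intro power_mono le[OF p]) (auto simp: cstar_seminorm_def)
      then show "p (star T x \<otimes>\<^bsub>T\<^esub> x) \<le> (?M x)\<^sup>2" using p x by (simp add: cstar_seminorm_def)
    qed
    have "?M x \<le> sqrt (?M (star T x \<otimes>\<^bsub>T\<^esub> x))"
    proof (rule max_norm_least)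
      fix p assume p: "cstar_seminorm T p"
      then have "(p x)\<^sup>2 \<le> ?M (star T x \<otimes>\<^bsub>T\<^esub> x)" using le[OF p h] x by (simp add: cstar_seminorm_def)
      then show "p x \<le> sqrt (?M (star T x \<otimes>\<^bsub>T\<^esub> x))" by (rule real_le_rsqrt)
    qed
    then have "(?M x)\<^sup>2 \<le> (sqrt (?M (star T x \<otimes>\<^bsub>T\<^esub> x)))\<^sup>2" by (rule power_mono) (rule nonneg[OF x])
    then show "(?M x)\<^sup>2 \<le> ?M (star T x \<otimes>\<^bsub>T\<^esub> x)" using nonneg[OF h] by simp
  qed
  show ?thesis using nonneg add smult mult cstar by (simp add: cstar_seminorm_def)
qed

section \<open>The minimal norm\<close>

lemma states_positive: "\<phi> \<in> states R \<Longrightarrow> positive_functional R \<phi>"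
  by (auto simp: states_def positive_functional_def less_eq_complex_def)

text \<open>On elementary tensors the kernel of the product functional is the entrywise product of
  the kernels of \<open>\<phi>\<close> and \<open>\<psi>\<close>, hence positive by the Schur
  product theorem.\<close>

lemma product_functional_positive:
  assumes \<phi>: "\<phi> \<in> states A" and \<psi>: "\<psi> \<in> states B"
  shows "positive_functional T (product_functional \<phi> \<psi>)"
proof -
  have lin: "linear_functional A \<phi>" "linear_functional B \<psi>" using \<phi> \<psi> by (auto simp: states_def)
  have "positive_functional T (\<lambda>x. x (\<lambda>a b. \<phi> a * \<psi> b))"
  proof (rule T.positive_functional_form)
    show "(\<lambda>a b. \<phi> a * \<psi> b) \<in> bilinear_forms A B"
      using lin by (auto simp: bilinear_forms_def linear_functional_def algebra_simps)
    fix n :: nat and v :: "nat \<Rightarrow> 'a \<times> 'b" assume v: "\<And>k. k < n \<Longrightarrow> v k \<in> carrier A \<times> carrier B"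
    have "psd_on {..<n} (\<lambda>k l. \<phi> (star A (fst (v k)) \<otimes>\<^bsub>A\<^esub> fst (v l)) * \<psi> (star B (snd (v k)) \<otimes>\<^bsub>B\<^esub> snd (v l)))"
      by (intro psd_on_schur_product A.positive_functional_psd B.positive_functional_psd states_positive \<phi> \<psi>)
        (use v in \<open>auto simp: mem_Times_iff\<close>)
    then show "psd_on {..<n} (\<lambda>k l. case (case (case v k of (a, b) \<Rightarrow> (star A a, star B b)) of
        (a, b) \<Rightarrow> \<lambda>(a', b'). (a \<otimes>\<^bsub>A\<^esub> a', b \<otimes>\<^bsub>B\<^esub> b')) (v l) of (a, b) \<Rightarrow> \<phi> a * \<psi> b)"
      by (simp add: split_beta)
  qed
  then show ?thesis by (simp add: product_functional_def[abs_def])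
qed

text \<open>Elementary tensors with a unit in one place are images of a C*-algebra under a unital
  *-homomorphism, hence bounded. They generate \<open>T\<close>, so every element is bounded, as the
  theory of \<open>gns_norm\<close> demands.\<close>

lemma min_norm_seminorm: "cstar_seminorm T (min_norm A B)"
proof -
  let ?\<Omega> = "{product_functional \<phi> \<psi> | \<phi> \<psi>. \<phi> \<in> states A \<and> \<psi> \<in> states B}"
  have pos: "positive_functional T \<omega>" if "\<omega> \<in> ?\<Omega>" for \<omega>
    using that product_functional_positive by blast
  have bdd_pure: "pure a b \<in> T.bounded_elements ?\<Omega>" if "a \<in> carrier A" "b \<in> carrier B" for a b
  proof -
    have "pure a \<one>\<^bsub>B\<^esub> \<in> T.bounded_elements ?\<Omega>"
      by (rule T.bounded_elements_image[OF pos A _ _ _ _ _ _ that(1)])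
        (use pure_mult[of _ _ "\<one>\<^bsub>B\<^esub>" "\<one>\<^bsub>B\<^esub>"] pure_star[of _ "\<one>\<^bsub>B\<^esub>"] in \<open>simp_all add: pure_add_l pure_smult_l pure_one\<close>)
    moreover have "pure \<one>\<^bsub>A\<^esub> b \<in> T.bounded_elements ?\<Omega>"
      by (rule T.bounded_elements_image[OF pos B _ _ _ _ _ _ that(2)])
        (use pure_mult[of "\<one>\<^bsub>A\<^esub>" "\<one>\<^bsub>A\<^esub>"] pure_star[of "\<one>\<^bsub>A\<^esub>"] in \<open>simp_all add: pure_add_r pure_smult_r pure_one\<close>)
    ultimately have "pure a \<one>\<^bsub>B\<^esub> \<otimes>\<^bsub>T\<^esub> pure \<one>\<^bsub>A\<^esub> b \<in> T.bounded_elements ?\<Omega>"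
      by (rule T.bounded_elements_mult[OF pos, rotated])
    then show ?thesis using pure_mult[of a "\<one>\<^bsub>A\<^esub>" "\<one>\<^bsub>B\<^esub>" b] that by simp
  qed
  have "x \<in> T.bounded_elements ?\<Omega>" if "x \<in> carrier T" for x
    using that
  proof (induction rule: T_induct)
    case zero
    show ?case using T.bounded_elements_smult[OF pos bdd_pure[OF A.one_closed B.one_closed], of 0] by simp
  next
    case (add x y) then show ?case by (intro T.bounded_elements_add[OF pos])
  next
    case (pure k a b) then show ?case by (intro T.bounded_elements_smult[OF pos] bdd_pure)
  qed
  then have bdd: "\<exists>K. \<forall>\<omega>\<in>?\<Omega>. \<forall>y\<in>carrier T. gns_seminorm T \<omega> (x \<otimes>\<^bsub>T\<^esub> y) \<le> K * gns_seminorm T \<omega> y"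
    if "x \<in> carrier T" for x
    using that unfolding T.bounded_elements_def by blast
  have "star_subalgebra T (carrier T)" by (simp add: star_subalgebra_def)
  from T.gns_norm_cstar_seminorm[OF this pos bdd]
  show ?thesis unfolding min_norm_def by simp
qed

section \<open>Elementary tensors in the completions\<close>

lemma tensor_hom_completion:
  assumes "cstar_seminorm T p"
  shows "tensor_hom A B (completion (with_norm T p)) (\<lambda>a b. to_completion (with_norm T p) (pure a b))"
proof -
  interpret N: pre_cstar "with_norm T p" by (rule with_norm_pre_cstar[OF T.star_alg_axioms assms])
  note h = star_homD[OF N.to_completion_star_hom, simplified]
  show ?thesis
    by (simp add: tensor_hom_def h pure_add_l pure_add_r pure_smult_l pure_smult_r pure_star pure_mult pure_one
        flip: h)
qed

lemma max_pure_tensor_hom: "tensor_hom A B (max_tensor A B) (max_pure A B)"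
  using tensor_hom_completion[OF max_norm_seminorm]
  by (simp add: max_tensor_def max_pure_def[abs_def])

lemma min_pure_tensor_hom: "tensor_hom A B (min_tensor A B) (min_pure A B)"
  using tensor_hom_completion[OF min_norm_seminorm]
  by (simp add: min_tensor_def min_pure_def[abs_def])

lemma max_pre_cstar: "pre_cstar (with_norm T (max_norm A B))"
  by (rule with_norm_pre_cstar[OF T.star_alg_axioms max_norm_seminorm])

lemma max_tensor_cstar_algebra: "cstar_algebra (max_tensor A B)"
  unfolding max_tensor_def by (rule pre_cstar.completion_cstar_algebra[OF max_pre_cstar])

lemma nrm_max_pure_le:
  assumes "a \<in> carrier A" "b \<in> carrier B"
  shows "nrm (max_tensor A B) (max_pure A B a b) \<le> nrm A a * nrm B b"
  using pre_cstar.nrm_to_completion[OF max_pre_cstar, of "pure a b"] assms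
  by (simp add: max_tensor_def max_pure_def seminorm_pure_le[OF max_norm_seminorm])

end

section \<open>Matrix algebras\<close>

lemma mat_adjoint_dim [simp]:
  "dim_row (mat_adjoint M) = dim_col M" "dim_col (mat_adjoint M) = dim_row M"
  by (simp_all add: mat_adjoint_def)

lemma mat_adjoint_index:
  "\<lbrakk>i < dim_col M; j < dim_row M\<rbrakk> \<Longrightarrow> mat_adjoint (M :: complex mat) $$ (i, j) = cnj (M $$ (j, i))"
  by (simp add: mat_adjoint_def mat_of_rows_index)

section \<open>The operator norm\<close>

definition vnorm :: "nat \<Rightarrow> complex vec \<Rightarrow> real" where
  "vnorm n v = L2_set (\<lambda>i. cmod (v $ i)) {..<n}"

lemma vnorm_nonneg [simp]: "0 \<le> vnorm n v"
  by (simp add: vnorm_def L2_set_nonneg)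

lemma vnorm_smult: "v \<in> carrier_vec n \<Longrightarrow> vnorm n (c \<cdot>\<^sub>v v) = cmod c * vnorm n v"
  unfolding vnorm_def by (subst L2_set_right_distrib) (auto intro!: L2_set_cong simp: norm_mult)

lemma vnorm_add: "\<lbrakk>v \<in> carrier_vec n; w \<in> carrier_vec n\<rbrakk> \<Longrightarrow> vnorm n (v + w) \<le> vnorm n v + vnorm n w"
  unfolding vnorm_def
  by (rule order_trans[OF L2_set_mono L2_set_triangle_ineq]) (auto intro: norm_triangle_ineq)

lemma mult_mat_vec_index:
  "\<lbrakk>M \<in> carrier_mat n n; v \<in> carrier_vec n; i < n\<rbrakk> \<Longrightarrow> (M *\<^sub>v v) $ i = (\<Sum>j<n. M $$ (i, j) * v $ j)"
  by (auto simp: scalar_prod_def lessThan_atLeast0 intro!: sum.cong)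

text \<open>A crude bound with two purposes: it makes the supremum in \<open>op_norm\<close> finite,
  and it shows that entrywise convergence implies convergence in norm.\<close>

lemma vnorm_mult_le:
  assumes M: "M \<in> carrier_mat n n" and v: "v \<in> carrier_vec n"
  shows "vnorm n (M *\<^sub>v v) \<le> (\<Sum>i<n. \<Sum>j<n. cmod (M $$ (i, j))) * vnorm n v"
proof -
  have "vnorm n (M *\<^sub>v v) \<le> (\<Sum>i<n. cmod ((M *\<^sub>v v) $ i))"
    unfolding vnorm_def by (rule L2_set_le_sum) simp
  also have "\<dots> \<le> (\<Sum>i<n. \<Sum>j<n. cmod (M $$ (i, j)) * vnorm n v)"
  proof (rule sum_mono)
    fix i assume "i \<in> {..<n}"
    then have "cmod ((M *\<^sub>v v) $ i) \<le> (\<Sum>j<n. cmod (M $$ (i, j)) * cmod (v $ j))"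
      using mult_mat_vec_index[OF M v, of i] norm_sum[of "\<lambda>j. M $$ (i, j) * v $ j" "{..<n}"] by (simp add: norm_mult)
    also have "\<dots> \<le> (\<Sum>j<n. cmod (M $$ (i, j)) * vnorm n v)"
      unfolding vnorm_def by (intro sum_mono mult_left_mono member_le_L2_set) auto
    finally show "cmod ((M *\<^sub>v v) $ i) \<le> (\<Sum>j<n. cmod (M $$ (i, j)) * vnorm n v)" .
  qed
  finally show ?thesis by (simp add: sum_distrib_right)
qed

lemma op_norm_eq:
  "M \<in> carrier_mat n n \<Longrightarrow> op_norm M = (SUP v\<in>{v \<in> carrier_vec n. vnorm n v \<le> 1}. vnorm n (M *\<^sub>v v))"
  by (auto simp: op_norm_def vnorm_def)

lemma bdd_above_op_norm:
  assumes M: "M \<in> carrier_mat n n"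
  shows "bdd_above ((\<lambda>v. vnorm n (M *\<^sub>v v)) ` {v \<in> carrier_vec n. vnorm n v \<le> 1})"
proof (rule bdd_aboveI2)
  fix v assume "v \<in> {v \<in> carrier_vec n. vnorm n v \<le> 1}"
  then show "vnorm n (M *\<^sub>v v) \<le> (\<Sum>i<n. \<Sum>j<n. cmod (M $$ (i, j)))"
    using vnorm_mult_le[OF M, of v] mult_left_mono[of "vnorm n v" 1 "\<Sum>i<n. \<Sum>j<n. cmod (M $$ (i, j))"]
    by (force intro: sum_nonneg)
qed

lemma op_norm_upper:
  assumes M: "M \<in> carrier_mat n n" and v: "v \<in> carrier_vec n"
  shows "vnorm n (M *\<^sub>v v) \<le> op_norm M * vnorm n v"
proof (cases "vnorm n v = 0")
  case True then show ?thesis using vnorm_mult_le[OF M v] by simp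
next
  case False
  then have r: "0 < vnorm n v" using vnorm_nonneg[of n v] by linarith
  have "complex_of_real (1 / vnorm n v) \<cdot>\<^sub>v v \<in> {v \<in> carrier_vec n. vnorm n v \<le> 1}"
    using v r by (simp add: vnorm_smult norm_divide)
  then have "vnorm n (M *\<^sub>v (complex_of_real (1 / vnorm n v) \<cdot>\<^sub>v v)) \<le> op_norm M"
    unfolding op_norm_eq[OF M] by (rule cSUP_upper[OF _ bdd_above_op_norm[OF M]])
  also have "M *\<^sub>v (complex_of_real (1 / vnorm n v) \<cdot>\<^sub>v v) = complex_of_real (1 / vnorm n v) \<cdot>\<^sub>v (M *\<^sub>v v)"
    by (rule mult_mat_vec[OF M v])
  finally show ?thesis using r M v
    by (simp add: vnorm_smult norm_divide pos_divide_le_eq)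
qed

lemma op_norm_least:
  assumes M: "M \<in> carrier_mat n n" and K: "0 \<le> K" "\<And>v. v \<in> carrier_vec n \<Longrightarrow> vnorm n (M *\<^sub>v v) \<le> K * vnorm n v"
  shows "op_norm M \<le> K"
  unfolding op_norm_eq[OF M]
proof (rule cSUP_least)
  have "vnorm n (0\<^sub>v n) \<le> 1" by (simp add: vnorm_def L2_set_def)
  then show "{v \<in> carrier_vec n. vnorm n v \<le> 1} \<noteq> {}" by (auto intro!: exI[of _ "0\<^sub>v n"])
  fix v assume v: "v \<in> {v \<in> carrier_vec n. vnorm n v \<le> 1}"
  have "vnorm n (M *\<^sub>v v) \<le> K * vnorm n v" using K(2) v by simp
  also have "\<dots> \<le> K * 1" using v K(1) by (intro mult_left_mono) auto
  finally show "vnorm n (M *\<^sub>v v) \<le> K" by simp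
qed

lemma op_norm_nonneg: "M \<in> carrier_mat n n \<Longrightarrow> 0 \<le> op_norm M"
proof -
  assume M: "M \<in> carrier_mat n n"
  have "vnorm n (M *\<^sub>v 0\<^sub>v n) \<le> op_norm M"
    unfolding op_norm_eq[OF M]
    by (rule cSUP_upper[OF _ bdd_above_op_norm[OF M]]) (simp add: vnorm_def L2_set_def)
  then show ?thesis using order_trans[OF vnorm_nonneg] by blast
qed

lemma op_norm_le_sum: "M \<in> carrier_mat n n \<Longrightarrow> op_norm M \<le> (\<Sum>i<n. \<Sum>j<n. cmod (M $$ (i, j)))"
  by (rule op_norm_least) (auto intro!: sum_nonneg vnorm_mult_le)

lemma entry_le_op_norm:
  assumes M: "M \<in> carrier_mat n n" and ij: "i < n" "j < n"
  shows "cmod (M $$ (i, j)) \<le> op_norm M"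
proof -
  have "(M *\<^sub>v unit_vec n j) $ i = M $$ (i, j)" using M ij by simp
  then have "cmod (M $$ (i, j)) \<le> vnorm n (M *\<^sub>v unit_vec n j)"
    unfolding vnorm_def using ij member_le_L2_set[of "{..<n}" i "\<lambda>i. cmod ((M *\<^sub>v unit_vec n j) $ i)"] by simp
  also have "\<dots> \<le> op_norm M * vnorm n (unit_vec n j)" using M by (intro op_norm_upper) auto
  also have "vnorm n (unit_vec n j) = 1"
  proof -
    have "(\<Sum>i<n. (cmod (unit_vec n j $ i))\<^sup>2) = (\<Sum>i<n. if i = j then 1 else 0)"
      by (intro sum.cong) (use ij in \<open>auto simp: index_unit_vec\<close>)
    then show ?thesis using ij by (simp add: vnorm_def L2_set_def)
  qed
  finally show ?thesis by simp
qed

lemma adjoint_inner: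
  assumes M: "M \<in> carrier_mat n n" and v: "v \<in> carrier_vec n" and w: "w \<in> carrier_vec n"
  shows "(\<Sum>i<n. cnj ((M *\<^sub>v v) $ i) * w $ i) = (\<Sum>j<n. cnj (v $ j) * (mat_adjoint M *\<^sub>v w) $ j)"
proof -
  have M': "mat_adjoint M \<in> carrier_mat n n" using M by auto
  have "(\<Sum>i<n. cnj ((M *\<^sub>v v) $ i) * w $ i) = (\<Sum>i<n. \<Sum>j<n. cnj (M $$ (i, j)) * cnj (v $ j) * w $ i)"
    by (intro sum.cong refl) (simp add: mult_mat_vec_index[OF M v] sum_distrib_right)
  also have "\<dots> = (\<Sum>j<n. \<Sum>i<n. cnj (M $$ (i, j)) * cnj (v $ j) * w $ i)" by (rule sum.swap)
  also have "\<dots> = (\<Sum>j<n. cnj (v $ j) * (mat_adjoint M *\<^sub>v w) $ j)"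
    by (intro sum.cong refl)
      (use M in \<open>simp add: mult_mat_vec_index[OF M' w] sum_distrib_left mat_adjoint_index mult_ac
        del: index_mult_mat_vec\<close>)
  finally show ?thesis .
qed

text \<open>The squared length of the image of \<open>v\<close> under \<open>M\<close> is the inner
  product of \<open>v\<close> with its image under \<open>mat_adjoint M * M\<close>; Cauchy-Schwarz
  bounds it.\<close>

lemma op_norm_adjoint_mult_ge:
  assumes M: "M \<in> carrier_mat n n" shows "(op_norm M)\<^sup>2 \<le> op_norm (mat_adjoint M * M)"
proof -
  let ?H = "mat_adjoint M * M"
  have M': "mat_adjoint M \<in> carrier_mat n n" and H: "?H \<in> carrier_mat n n" using M by auto
  have "op_norm M \<le> sqrt (op_norm ?H)"
  proof (rule op_norm_least[OF M])
    fix v :: "complex vec" assume v: "v \<in> carrier_vec n"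
    have Mv: "M *\<^sub>v v \<in> carrier_vec n" using M v by auto
    have "complex_of_real ((vnorm n (M *\<^sub>v v))\<^sup>2) = (\<Sum>i<n. cnj ((M *\<^sub>v v) $ i) * (M *\<^sub>v v) $ i)"
      by (simp add: vnorm_def L2_set_def sum_nonneg complex_norm_square mult.commute del: of_real_power)
    also have "\<dots> = (\<Sum>j<n. cnj (v $ j) * (?H *\<^sub>v v) $ j)"
      using adjoint_inner[OF M v Mv] assoc_mult_mat_vec[OF M' M v] by simp
    finally have "(vnorm n (M *\<^sub>v v))\<^sup>2 = cmod (\<Sum>j<n. cnj (v $ j) * (?H *\<^sub>v v) $ j)"
      by (metis norm_of_real abs_of_nonneg zero_le_power2)
    also have "\<dots> \<le> (\<Sum>j<n. \<bar>cmod (v $ j)\<bar> * \<bar>cmod ((?H *\<^sub>v v) $ j)\<bar>)"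
      by (rule order_trans[OF norm_sum]) (simp add: norm_mult)
    also have "\<dots> \<le> vnorm n v * vnorm n (?H *\<^sub>v v)" unfolding vnorm_def by (rule L2_set_mult_ineq)
    also have "\<dots> \<le> vnorm n v * (op_norm ?H * vnorm n v)"
      by (intro mult_left_mono op_norm_upper[OF H v]) simp
    also have "\<dots> = (sqrt (op_norm ?H) * vnorm n v)\<^sup>2"
      using op_norm_nonneg[OF H] by (simp add: power2_eq_square algebra_simps)
    finally show "vnorm n (M *\<^sub>v v) \<le> sqrt (op_norm ?H) * vnorm n v"
      by (rule power2_le_imp_le) (simp add: op_norm_nonneg[OF H])
  qed (simp add: op_norm_nonneg[OF H])
  then have "(op_norm M)\<^sup>2 \<le> (sqrt (op_norm ?H))\<^sup>2" by (rule power_mono) (rule op_norm_nonneg[OF M])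
  then show ?thesis by (simp add: op_norm_nonneg[OF H])
qed

section \<open>Matrices as a C*-algebra\<close>

lemma mat_adjoint_adjoint: "mat_adjoint (mat_adjoint M) = (M :: complex mat)"
  by (rule eq_matI) (simp_all add: mat_adjoint_index)

lemma mat_adjoint_mult:
  "\<lbrakk>M \<in> carrier_mat n n; N \<in> carrier_mat n n\<rbrakk> \<Longrightarrow>
    mat_adjoint (M * N) = mat_adjoint N * mat_adjoint (M :: complex mat)"
  by (rule eq_matI) (auto simp: mat_adjoint_index scalar_prod_def mult.commute intro!: sum.cong)

lemma matrix_star_alg: "star_alg (matrix_algebra n)"
  by (rule star_algI)
    (auto simp: matrix_algebra_def mat_adjoint_adjoint mat_adjoint_mult add_mult_distrib_mat[of _ n n]
      mult_add_distrib_mat[of _ n n] assoc_mult_mat[of _ n n _ n _ n] comm_add_mat[of _ n n]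
      mat_adjoint_index distrib_left distrib_right intro!: eq_matI)

lemma op_norm_mult_le:
  assumes M: "M \<in> carrier_mat n n" and N: "N \<in> carrier_mat n n"
  shows "op_norm (M * N) \<le> op_norm M * op_norm N"
proof (rule op_norm_least)
  fix v :: "complex vec" assume v: "v \<in> carrier_vec n"
  have "vnorm n ((M * N) *\<^sub>v v) \<le> op_norm M * vnorm n (N *\<^sub>v v)"
    using op_norm_upper[OF M, of "N *\<^sub>v v"] M N v by (simp add: assoc_mult_mat_vec[OF M N v])
  also have "\<dots> \<le> op_norm M * (op_norm N * vnorm n v)"
    by (intro mult_left_mono op_norm_upper N v op_norm_nonneg[OF M])
  finally show "vnorm n ((M * N) *\<^sub>v v) \<le> op_norm M * op_norm N * vnorm n v" by (simp add: mult.assoc)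
qed (use M N op_norm_nonneg[OF M] op_norm_nonneg[OF N] in auto)

lemma matrix_cstar_seminorm: "cstar_seminorm (matrix_algebra n) op_norm"
proof -
  have adj_ge: "op_norm M \<le> op_norm (mat_adjoint M)" if M: "M \<in> carrier_mat n n" for M
  proof (cases "op_norm M = 0")
    case False
    have M': "mat_adjoint M \<in> carrier_mat n n" using M by auto
    have "op_norm M * op_norm M \<le> op_norm (mat_adjoint M) * op_norm M"
      using op_norm_adjoint_mult_ge[OF M] op_norm_mult_le[OF M' M] by (simp add: power2_eq_square)
    then show ?thesis using False op_norm_nonneg[OF M] by (simp add: mult_le_cancel_right)
  qed (use op_norm_nonneg[OF carrier_matI[of "mat_adjoint M" n n]] M in auto)
  have cstar: "op_norm (mat_adjoint M * M) = (op_norm M)\<^sup>2" if M: "M \<in> carrier_mat n n" for M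
  proof (rule antisym[OF _ op_norm_adjoint_mult_ge[OF M]])
    have M': "mat_adjoint M \<in> carrier_mat n n" using M by auto
    have "op_norm (mat_adjoint M) * op_norm M \<le> op_norm M * op_norm M"
      using adj_ge[OF M'] op_norm_nonneg[OF M] by (intro mult_right_mono) (simp_all add: mat_adjoint_adjoint)
    then show "op_norm (mat_adjoint M * M) \<le> (op_norm M)\<^sup>2"
      using op_norm_mult_le[OF M' M] by (simp add: power2_eq_square)
  qed
  have smult: "op_norm (c \<cdot>\<^sub>m M) \<le> cmod c * op_norm M" if M: "M \<in> carrier_mat n n" for c M
  proof (rule op_norm_least)
    fix v :: "complex vec" assume v: "v \<in> carrier_vec n"
    have "(c \<cdot>\<^sub>m M) *\<^sub>v v = c \<cdot>\<^sub>v (M *\<^sub>v v)" using M v by (intro eq_vecI) auto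
    then show "vnorm n ((c \<cdot>\<^sub>m M) *\<^sub>v v) \<le> cmod c * op_norm M * vnorm n v"
      using op_norm_upper[OF M v] M v by (simp add: vnorm_smult mult.assoc mult_left_mono)
  qed (use M op_norm_nonneg[OF M] in auto)
  \<comment> \<open>For nonzero \<open>c\<close> the inequality for the scalar \<open>1 / c\<close>,
    applied to the scaled matrix, is the reverse of the one for \<open>c\<close>.\<close>
  have smult_eq: "op_norm (c \<cdot>\<^sub>m M) = cmod c * op_norm M" if M: "M \<in> carrier_mat n n" for c M
  proof (rule antisym[OF smult[OF M]], cases "c = 0")
    case True then show "cmod c * op_norm M \<le> op_norm (c \<cdot>\<^sub>m M)"
      using op_norm_nonneg[of "c \<cdot>\<^sub>m M" n] M by simp
  next
    case False
    have "(1 / c) \<cdot>\<^sub>m (c \<cdot>\<^sub>m M) = M" using False by (intro eq_matI) auto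
    then have "op_norm M \<le> cmod (1 / c) * op_norm (c \<cdot>\<^sub>m M)" using smult[of "c \<cdot>\<^sub>m M" "1 / c"] M by simp
    then show "cmod c * op_norm M \<le> op_norm (c \<cdot>\<^sub>m M)" using False by (simp add: norm_divide field_simps)
  qed
  have add: "op_norm (M + N) \<le> op_norm M + op_norm N"
    if M: "M \<in> carrier_mat n n" and N: "N \<in> carrier_mat n n" for M N
  proof (rule op_norm_least)
    fix v :: "complex vec" assume v: "v \<in> carrier_vec n"
    have "vnorm n ((M + N) *\<^sub>v v) \<le> vnorm n (M *\<^sub>v v) + vnorm n (N *\<^sub>v v)"
      using vnorm_add[of "M *\<^sub>v v" n "N *\<^sub>v v"] M N v by (simp add: add_mult_distrib_mat_vec[OF M N v])
    then show "vnorm n ((M + N) *\<^sub>v v) \<le> (op_norm M + op_norm N) * vnorm n v"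
      using op_norm_upper[OF M v] op_norm_upper[OF N v] by (simp add: distrib_right)
  qed (use M N op_norm_nonneg[OF M] op_norm_nonneg[OF N] in auto)
  show ?thesis
    using op_norm_nonneg add smult_eq op_norm_mult_le cstar
    by (simp add: cstar_seminorm_def matrix_algebra_def)
qed

text \<open>Entries are bounded by the operator norm, and the operator norm by the sum of the moduli
  of the entries. So a Cauchy sequence converges entrywise, and the matrix of limits is its limit in
  norm.\<close>

theorem matrix_cstar_algebra: "cstar_algebra (matrix_algebra n)"
proof (rule cstar_algebraI[OF matrix_star_alg])
  have nrm: "nrm (matrix_algebra n) = op_norm" and car: "carrier (matrix_algebra n) = carrier_mat n n"
    by (simp_all add: matrix_algebra_def)
  show sem: "cstar_seminorm (matrix_algebra n) (nrm (matrix_algebra n))"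
    unfolding nrm by (rule matrix_cstar_seminorm)
  interpret M: pre_cstar "matrix_algebra n" by (rule pre_cstarI[OF matrix_star_alg sem])
  show "M = \<zero>\<^bsub>matrix_algebra n\<^esub>" if "M \<in> carrier (matrix_algebra n)" "nrm (matrix_algebra n) M = 0" for M
  proof -
    have M: "M \<in> carrier_mat n n" "op_norm M = 0" using that by (simp_all add: car nrm)
    have "M = 0\<^sub>m n n"
      using entry_le_op_norm[OF M(1)] M by (intro eq_matI) auto
    then show ?thesis by (simp add: matrix_algebra_def)
  qed
  fix s assume "s \<in> cauchy_seqs (matrix_algebra n)"
  then have s: "M.cauchy s" by (simp add: M.cauchy_seqs_iff)
  have sc: "s k \<in> carrier_mat n n" for k using M.cauchy_closed[OF s] by (simp add: car)
  have minus: "x \<ominus>\<^bsub>matrix_algebra n\<^esub> y \<in> carrier_mat n n"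
      "i < n \<Longrightarrow> j < n \<Longrightarrow> (x \<ominus>\<^bsub>matrix_algebra n\<^esub> y) $$ (i, j) = x $$ (i, j) - y $$ (i, j)"
    if "x \<in> carrier_mat n n" "y \<in> carrier_mat n n" for x y i j
    using that M.minus_eq_smult[of x y] by (auto simp: car matrix_algebra_def)
  have "convergent (\<lambda>k. s k $$ (i, j))" if ij: "i < n" "j < n" for i j
  proof (rule Cauchy_convergent, rule metric_CauchyI)
    fix e :: real assume "0 < e"
    then obtain N where N: "\<And>m k. m \<ge> N \<Longrightarrow> k \<ge> N \<Longrightarrow> nrm (matrix_algebra n) (s m \<ominus>\<^bsub>matrix_algebra n\<^esub> s k) < e"
      using M.cauchyD[OF s] by blast
    have "dist (s m $$ (i, j)) (s k $$ (i, j)) < e" if "m \<ge> N" "k \<ge> N" for m k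
      using entry_le_op_norm[OF minus(1)[OF sc[of m] sc[of k]] ij] N[OF that] minus(2)[OF sc[of m] sc[of k] ij]
      by (simp add: dist_norm nrm)
    then show "\<exists>N. \<forall>m\<ge>N. \<forall>k\<ge>N. dist (s m $$ (i, j)) (s k $$ (i, j)) < e" by blast
  qed
  then have lim: "(\<lambda>k. s k $$ (i, j)) \<longlonglongrightarrow> lim (\<lambda>k. s k $$ (i, j))" if "i < n" "j < n" for i j
    using that by (simp add: convergent_LIMSEQ_iff)
  define L where "L = mat n n (\<lambda>(i, j). lim (\<lambda>k. s k $$ (i, j)))"
  have L: "L \<in> carrier_mat n n" by (simp add: L_def)
  have "(\<lambda>k. nrm (matrix_algebra n) (s k \<ominus>\<^bsub>matrix_algebra n\<^esub> L)) \<longlonglongrightarrow> 0"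
  proof (rule tendsto_sandwich[OF _ _ tendsto_const])
    show "\<forall>\<^sub>F k in sequentially. 0 \<le> nrm (matrix_algebra n) (s k \<ominus>\<^bsub>matrix_algebra n\<^esub> L)"
      unfolding nrm by (intro always_eventually allI op_norm_nonneg[OF minus(1)[OF sc L]])
    show "\<forall>\<^sub>F k in sequentially. nrm (matrix_algebra n) (s k \<ominus>\<^bsub>matrix_algebra n\<^esub> L) \<le>
        (\<Sum>i<n. \<Sum>j<n. cmod (s k $$ (i, j) - L $$ (i, j)))"
      using op_norm_le_sum[OF minus(1)[OF sc L]] minus(2)[OF sc L] by (simp add: nrm)
    have "(\<lambda>k. \<Sum>i<n. \<Sum>j<n. cmod (s k $$ (i, j) - L $$ (i, j))) \<longlonglongrightarrow> (\<Sum>i<n. \<Sum>j<n. 0)"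
    proof (intro tendsto_sum)
      fix i j assume "i \<in> {..<n}" "j \<in> {..<n}"
      then have "(\<lambda>k. s k $$ (i, j)) \<longlonglongrightarrow> L $$ (i, j)" using lim by (simp add: L_def)
      then show "(\<lambda>k. cmod (s k $$ (i, j) - L $$ (i, j))) \<longlonglongrightarrow> 0"
        by (simp add: tendsto_norm_zero LIM_zero)
    qed
    then show "(\<lambda>k. \<Sum>i<n. \<Sum>j<n. cmod (s k $$ (i, j) - L $$ (i, j))) \<longlonglongrightarrow> 0" by simp
  qed
  then show "\<exists>x\<in>carrier (matrix_algebra n). (\<lambda>k. nrm (matrix_algebra n) (s k \<ominus>\<^bsub>matrix_algebra n\<^esub> x)) \<longlonglongrightarrow> 0"
    using L by (auto simp: car)
qed

text \<open>The vector state of the first basis vector. It shows that states exist, so that the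
  spatial norm of the unit does not vanish.\<close>

lemma corner_state:
  assumes "0 < n"
  shows "(\<lambda>c\<in>carrier (matrix_algebra n). c $$ (0, 0)) \<in> states (matrix_algebra n)"
proof -
  have "Im ((mat_adjoint c * c) $$ (0, 0)) = 0 \<and> 0 \<le> Re ((mat_adjoint c * c) $$ (0, 0))"
    if c: "c \<in> carrier_mat n n" for c :: "complex mat"
  proof -
    have "(mat_adjoint c * c) $$ (0, 0) = (\<Sum>i = 0..<n. cnj (c $$ (i, 0)) * c $$ (i, 0))"
      using c assms by (auto simp: scalar_prod_def mat_adjoint_index intro!: sum.cong)
    then show ?thesis by (auto intro!: sum_nonneg add_nonneg_nonneg)
  qed
  then show ?thesis
    using assms entry_le_op_norm[of _ n 0 0]
    by (auto simp: states_def linear_functional_def matrix_algebra_def)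
qed

section \<open>Infinite tensor products of matrix algebras\<close>

definition matrix_unit :: "nat \<Rightarrow> nat \<Rightarrow> nat \<Rightarrow> complex mat" where
  "matrix_unit n i k = mat n n (\<lambda>p. if p = (i, k) then 1 else 0)"

lemma matrix_unit_in [simp]: "matrix_unit n i k \<in> carrier (matrix_algebra n)"
  by (simp add: matrix_unit_def matrix_algebra_def)

text \<open>Multiplication by matrix units on both sides isolates one entry. Summed over
  \<open>l\<close>, the right side is that entry times the identity; this is the source of
  \<open>coord\<close>.\<close>

lemma matrix_unit_sandwich:
  assumes "M \<in> carrier_mat n n" "i < n" "k < n" "l < n"
  shows "matrix_unit n l i * M * matrix_unit n k l = M $$ (i, k) \<cdot>\<^sub>m matrix_unit n l l"
proof (rule eq_matI)
  fix a b assume "a < dim_row (M $$ (i, k) \<cdot>\<^sub>m matrix_unit n l l)" "b < dim_col (M $$ (i, k) \<cdot>\<^sub>m matrix_unit n l l)"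
  then have ab: "a < n" "b < n" by (simp_all add: matrix_unit_def)
  have left: "(matrix_unit n l i * M) $$ (a, r) = (if a = l then M $$ (i, r) else 0)" if "r < n" for r
  proof -
    have "(matrix_unit n l i * M) $$ (a, r) = (\<Sum>s=0..<n. (if a = l \<and> s = i then 1 else 0) * M $$ (s, r))"
      using assms ab that by (auto simp: matrix_unit_def scalar_prod_def intro!: sum.cong)
    also have "\<dots> = (\<Sum>s=0..<n. if s = i then (if a = l then M $$ (i, r) else 0) else 0)"
      by (intro sum.cong) auto
    finally show ?thesis using assms by simp
  qed
  have "(matrix_unit n l i * M * matrix_unit n k l) $$ (a, b) =
      (\<Sum>r=0..<n. (matrix_unit n l i * M) $$ (a, r) * (if r = k \<and> b = l then 1 else 0))"
    using assms ab by (auto simp: matrix_unit_def scalar_prod_def intro!: sum.cong)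
  also have "\<dots> = (\<Sum>r=0..<n. if r = k then (if a = l \<and> b = l then M $$ (i, k) else 0) else 0)"
    by (intro sum.cong) (auto simp: left)
  also have "\<dots> = (M $$ (i, k) \<cdot>\<^sub>m matrix_unit n l l) $$ (a, b)"
    using assms ab by (auto simp: matrix_unit_def)
  finally show "(matrix_unit n l i * M * matrix_unit n k l) $$ (a, b) = (M $$ (i, k) \<cdot>\<^sub>m matrix_unit n l l) $$ (a, b)" .
qed (use assms in \<open>simp_all add: matrix_unit_def\<close>)

lemma linear_functional_matrix_expand:
  assumes \<phi>: "linear_functional (matrix_algebra n) \<phi>" and M: "M \<in> carrier_mat n n"
  shows "\<phi> M = (\<Sum>p\<in>{..<n} \<times> {..<n}. M $$ p * \<phi> (matrix_unit n (fst p) (snd p)))"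
proof -
  have add: "\<phi> (x + y) = \<phi> x + \<phi> y" and smult: "\<phi> (c \<cdot>\<^sub>m x) = c * \<phi> x"
    if "x \<in> carrier_mat n n" "y \<in> carrier_mat n n" for x y c
    using \<phi> that by (auto simp: linear_functional_def matrix_algebra_def)
  have partial: "\<phi> (mat n n (\<lambda>p. if p \<in> P then M $$ p else 0)) =
      (\<Sum>p\<in>P. M $$ p * \<phi> (matrix_unit n (fst p) (snd p)))"
    if "finite P" for P
    using that
  proof (induction P rule: finite_induct)
    case empty
    have "\<phi> (0 \<cdot>\<^sub>m 0\<^sub>m n n) = 0" using smult[of "0\<^sub>m n n" "0\<^sub>m n n" 0] by simp
    moreover have "(0 :: complex) \<cdot>\<^sub>m 0\<^sub>m n n = mat n n (\<lambda>p. 0)" by (rule eq_matI) auto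
    ultimately show ?case by simp
  next
    case (insert q P)
    have "mat n n (\<lambda>p. if p \<in> insert q P then M $$ p else 0) =
        M $$ q \<cdot>\<^sub>m matrix_unit n (fst q) (snd q) + mat n n (\<lambda>p. if p \<in> P then M $$ p else 0)"
      using insert.hyps by (intro eq_matI) (auto simp: matrix_unit_def)
    then show ?case
      using insert add[of "M $$ q \<cdot>\<^sub>m matrix_unit n (fst q) (snd q)" "mat n n (\<lambda>p. if p \<in> P then M $$ p else 0)"]
        smult[of "matrix_unit n (fst q) (snd q)" "matrix_unit n (fst q) (snd q)"]
      by (simp add: matrix_unit_def)
  qed
  have "mat n n (\<lambda>p. if p \<in> {..<n} \<times> {..<n} then M $$ p else 0) = M"
    using M by (intro eq_matI) auto
  then show ?thesis using partial[of "{..<n} \<times> {..<n}"] by simp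
qed

text \<open>Positive dimensions exclude the zero algebra, whose unit has norm 0. The index set is
  the whole type, so that families are plain functions.\<close>

locale matrix_product =
  fixes d :: "'j \<Rightarrow> nat" assumes d_pos: "0 < d j"
begin

abbreviation C where "C \<equiv> (\<lambda>j. matrix_algebra (d j))"
abbreviation S where "S \<equiv> restr_prod UNIV C"
abbreviation T where "T \<equiv> alg_inf_tensor UNIV C"

sublocale T: span_alg S "multilinear_forms UNIV C" "\<lambda>\<beta>. \<beta>" "\<lambda>\<beta>. \<beta>"
    "\<lambda>c d. \<lambda>j\<in>UNIV. c j \<otimes>\<^bsub>C j\<^esub> d j" "\<lambda>j\<in>UNIV. \<one>\<^bsub>C j\<^esub>" "\<lambda>c. \<lambda>j\<in>UNIV. star (C j) (c j)" T
  by (rule alg_inf_tensor_span_alg) (rule matrix_cstar_algebra)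

sublocale C: pre_cstar "C j" for j
  by (rule cstar_algebra_imp_pre_cstar[OF matrix_cstar_algebra])

abbreviation unit_seq where "unit_seq \<equiv> (\<lambda>j. \<one>\<^bsub>C j\<^esub>)"
abbreviation supp where "supp c \<equiv> {j. c j \<noteq> \<one>\<^bsub>C j\<^esub>}"

lemma S_iff: "c \<in> S \<longleftrightarrow> (\<forall>j. c j \<in> carrier (C j)) \<and> finite (supp c)"
  by (auto simp: restr_prod_def)

lemma S_closed [simp]: "c \<in> S \<Longrightarrow> c j \<in> carrier (C j)"
  by (simp add: S_iff)

lemma S_upd [simp]: "\<lbrakk>c \<in> S; v \<in> carrier (C j)\<rbrakk> \<Longrightarrow> c(j := v) \<in> S"
  by (rule restr_prod_upd) auto

lemma unit_seq_in [simp]: "unit_seq \<in> S"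
  by (simp add: S_iff)

lemma ev_eq_pure: "T.ev c = pure_inf_tensor UNIV C c"
  by (simp add: T.ev_def pure_inf_tensor_def)

lemma ev_unit: "T.ev unit_seq = \<one>\<^bsub>T\<^esub>"
  by (simp add: T.ev_one restrict_UNIV)

lemma ev_mult_upd:
  "\<lbrakk>c \<in> S; v \<in> carrier (C j)\<rbrakk> \<Longrightarrow> T.ev c \<otimes>\<^bsub>T\<^esub> T.ev (unit_seq(j := v)) = T.ev (c(j := c j \<otimes>\<^bsub>C j\<^esub> v))"
  "\<lbrakk>c \<in> S; v \<in> carrier (C j)\<rbrakk> \<Longrightarrow> T.ev (unit_seq(j := v)) \<otimes>\<^bsub>T\<^esub> T.ev c = T.ev (c(j := v \<otimes>\<^bsub>C j\<^esub> c j))"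
  by (auto simp: T.ev_mult restrict_UNIV intro!: arg_cong[of _ _ T.ev])

lemma ev_split: "c \<in> S \<Longrightarrow> T.ev c = T.ev (c(j := \<one>\<^bsub>C j\<^esub>)) \<otimes>\<^bsub>T\<^esub> T.ev (unit_seq(j := c j))"
  using ev_mult_upd(1)[of "c(j := \<one>\<^bsub>C j\<^esub>)" "c j" j] by simp

lemma linear_upd:
  "\<lbrakk>\<beta> \<in> multilinear_forms UNIV C; c \<in> S\<rbrakk> \<Longrightarrow> linear_functional (C j) (\<lambda>v. \<beta> (c(j := v)))"
  by (rule multilinear_formsD) auto

lemma ev_upd_add: "\<lbrakk>c \<in> S; v \<in> carrier (C j); w \<in> carrier (C j)\<rbrakk> \<Longrightarrow>
    T.ev (c(j := v \<oplus>\<^bsub>C j\<^esub> w)) = T.ev (c(j := v)) \<oplus>\<^bsub>T\<^esub> T.ev (c(j := w))"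
  using linear_upd[of _ c j] by (auto simp: T.ev_def T.add_T linear_functional_def)

lemma ev_upd_smult: "\<lbrakk>c \<in> S; v \<in> carrier (C j)\<rbrakk> \<Longrightarrow>
    T.ev (c(j := a \<odot>\<^bsub>C j\<^esub> v)) = a \<odot>\<^bsub>T\<^esub> T.ev (c(j := v))"
  using linear_upd[of _ c j] by (auto simp: T.ev_def T.smult_T linear_functional_def)

subsection \<open>Finite stages\<close>

abbreviation stage where "stage \<equiv> tensor_stage UNIV C"

lemma stage_eq: "stage F = fun_span (T.ev ` {c \<in> S. supp c \<subseteq> F})"
  by (auto simp: tensor_stage_def ev_eq_pure intro!: arg_cong[of _ _ fun_span] image_eqI)

lemma stage_induct [consumes 1, case_names zero add ev]:
  assumes "x \<in> stage F" "P \<zero>\<^bsub>T\<^esub>"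
    "\<And>x y. \<lbrakk>x \<in> stage F; y \<in> stage F; P x; P y\<rbrakk> \<Longrightarrow> P (x \<oplus>\<^bsub>T\<^esub> y)"
    "\<And>a c. \<lbrakk>c \<in> S; supp c \<subseteq> F\<rbrakk> \<Longrightarrow> P (a \<odot>\<^bsub>T\<^esub> T.ev c)"
  shows "P x"
proof (rule fun_span_induct[of x "T.ev ` {c \<in> S. supp c \<subseteq> F}" P])
  show "x \<in> fun_span (T.ev ` {c \<in> S. supp c \<subseteq> F})" using assms(1) by (simp only: stage_eq)
  show "P (\<lambda>_. 0)" using assms(2) by (simp only: T.zero_T)
  show "P (\<lambda>\<beta>. x \<beta> + y \<beta>)" if "x \<in> fun_span (T.ev ` {c \<in> S. supp c \<subseteq> F})"
    "y \<in> fun_span (T.ev ` {c \<in> S. supp c \<subseteq> F})" "P x" "P y" for x y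
    using assms(3)[of x y] that by (simp only: stage_eq T.add_T)
  show "P (\<lambda>\<beta>. a * v \<beta>)" if "v \<in> T.ev ` {c \<in> S. supp c \<subseteq> F}" for a v
    using assms(4)[of _ a] that by (auto simp only: T.smult_T)
qed

lemma stage_zero: "\<zero>\<^bsub>T\<^esub> \<in> stage F"
  unfolding stage_eq T.zero_T by (rule fun_span_zero)

lemma stage_add: "\<lbrakk>x \<in> stage F; y \<in> stage F\<rbrakk> \<Longrightarrow> x \<oplus>\<^bsub>T\<^esub> y \<in> stage F"
  unfolding stage_eq T.add_T by (rule fun_span_add)

lemma stage_smult: "x \<in> stage F \<Longrightarrow> a \<odot>\<^bsub>T\<^esub> x \<in> stage F"
  unfolding stage_eq T.smult_T by (rule fun_span_smult)

lemma stage_ev: "\<lbrakk>c \<in> S; supp c \<subseteq> F\<rbrakk> \<Longrightarrow> T.ev c \<in> stage F"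
  unfolding stage_eq by (rule fun_span_base) blast

lemma stage_subset: "x \<in> stage F \<Longrightarrow> x \<in> carrier T"
  by (induction rule: stage_induct) auto

lemma stage_mono: "x \<in> stage F \<Longrightarrow> F \<subseteq> G \<Longrightarrow> x \<in> stage G"
  by (induction rule: stage_induct) (auto intro: stage_zero stage_add stage_smult stage_ev)

lemma supp_mult: "supp (\<lambda>j\<in>UNIV. c j \<otimes>\<^bsub>C j\<^esub> e j) \<subseteq> supp c \<union> supp e"
proof (rule subsetI, rule ccontr)
  fix j assume j: "j \<in> supp (\<lambda>j\<in>UNIV. c j \<otimes>\<^bsub>C j\<^esub> e j)" "j \<notin> supp c \<union> supp e"
  then have "c j = \<one>\<^bsub>C j\<^esub>" "e j = \<one>\<^bsub>C j\<^esub>" by auto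
  then show False using j(1) by simp
qed

lemma supp_star: "supp (\<lambda>j\<in>UNIV. star (C j) (c j)) \<subseteq> supp c"
proof (rule subsetI, rule ccontr)
  fix j assume j: "j \<in> supp (\<lambda>j\<in>UNIV. star (C j) (c j))" "j \<notin> supp c"
  then have "c j = \<one>\<^bsub>C j\<^esub>" by auto
  then show False using j(1) by simp
qed

lemma stage_mult: "x \<in> stage F \<Longrightarrow> y \<in> stage F \<Longrightarrow> x \<otimes>\<^bsub>T\<^esub> y \<in> stage F"
proof (induction x rule: stage_induct)
  case (ev a c)
  from ev(3) show ?case
  proof (induction y rule: stage_induct)
    case ev': (ev b e)
    have "supp (\<lambda>j\<in>UNIV. c j \<otimes>\<^bsub>C j\<^esub> e j) \<subseteq> F" using supp_mult[of c e] ev(2) ev'(2) by blast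
    then show ?case
      using ev ev' by (auto simp: T.smult_mult_left T.smult_mult_right T.ev_mult intro!: stage_smult stage_ev)
  qed (use ev stage_subset in \<open>auto simp: T.r_distr intro: stage_zero stage_add\<close>)
qed (use stage_subset in \<open>auto simp: T.l_distr intro: stage_zero stage_add\<close>)

lemma stage_star: "x \<in> stage F \<Longrightarrow> star T x \<in> stage F"
proof (induction rule: stage_induct)
  case (ev a c)
  have "supp (\<lambda>j\<in>UNIV. star (C j) (c j)) \<subseteq> F" using supp_star[of c] ev(2) by blast
  then show ?case using ev by (auto simp: T.star_smult T.ev_star intro!: stage_smult stage_ev)
qed (use stage_subset in \<open>auto simp: T.star_add intro: stage_zero stage_add\<close>)

lemma stage_one: "\<one>\<^bsub>T\<^esub> \<in> stage F"
  unfolding ev_unit[symmetric] by (rule stage_ev) auto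

lemma stage_subalgebra: "star_subalgebra T (stage F)"
  unfolding star_subalgebra_def
  by (intro conjI ballI allI subsetI stage_zero stage_one stage_add stage_mult stage_star stage_smult) (rule stage_subset)

text \<open>Generators have finite support. Consequently the infimum in
  \<open>inf_tensor_norm\<close> is over a nonempty set.\<close>

lemma ex_stage: "x \<in> carrier T \<Longrightarrow> \<exists>F. finite F \<and> x \<in> stage F"
proof (induction rule: T.span_induct)
  case zero then show ?case by (intro exI[of _ "{}"]) (simp add: stage_zero)
next
  case (add x y)
  then obtain F G where F: "finite F" "x \<in> stage F" and G: "finite G" "y \<in> stage G" by blast
  have "x \<in> stage (F \<union> G)" "y \<in> stage (F \<union> G)"
    using stage_mono[OF F(2)] stage_mono[OF G(2)] by auto
  then show ?case using F G stage_add by (intro exI[of _ "F \<union> G"]) auto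
next
  case (ev a c)
  then show ?case by (intro exI[of _ "supp c"]) (auto simp: S_iff intro!: stage_smult stage_ev)
qed

subsection \<open>Uniqueness of the C*-norm\<close>

text \<open>Addition in \<open>T\<close> is pointwise, so finite sums can be taken pointwise as well
  and inherit the laws of complex sums.\<close>

definition tsum :: "'i set \<Rightarrow> ('i \<Rightarrow> (('j \<Rightarrow> complex mat) \<Rightarrow> complex) \<Rightarrow> complex) \<Rightarrow> (('j \<Rightarrow> complex mat) \<Rightarrow> complex) \<Rightarrow> complex" where
  "tsum I f = (\<lambda>\<beta>. \<Sum>i\<in>I. f i \<beta>)"

lemma tsum_empty: "tsum {} f = \<zero>\<^bsub>T\<^esub>" by (simp add: tsum_def T.zero_T)

lemma tsum_insert: "finite I \<Longrightarrow> i \<notin> I \<Longrightarrow> tsum (insert i I) f = f i \<oplus>\<^bsub>T\<^esub> tsum I f"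
  by (auto simp: tsum_def T.add_T)

lemma tsum_add: "tsum I (\<lambda>i. f i \<oplus>\<^bsub>T\<^esub> g i) = tsum I f \<oplus>\<^bsub>T\<^esub> tsum I g"
  by (simp add: tsum_def T.add_T sum.distrib)

lemma tsum_stage:
  "finite I \<Longrightarrow> (\<And>i. i \<in> I \<Longrightarrow> f i \<in> stage F) \<Longrightarrow> tsum I f \<in> stage F"
  by (induction I rule: finite_induct) (auto simp: tsum_empty tsum_insert intro: stage_zero stage_add)

lemma tsum_seminorm:
  assumes p: "cstar_seminorm (T\<lparr>carrier := stage F\<rparr>) p" and "finite I" "\<And>i. i \<in> I \<Longrightarrow> f i \<in> stage F"
  shows "p (tsum I f) \<le> (\<Sum>i\<in>I. p (f i))"
  using assms(2,3)
proof (induction I rule: finite_induct)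
  case empty
  have "\<forall>a. \<forall>x\<in>stage F. p (a \<odot>\<^bsub>T\<^esub> x) = cmod a * p x" using p by (simp add: cstar_seminorm_def)
  from bspec[OF spec[OF this, of 0] stage_zero] show ?case by (simp add: tsum_empty)
next
  case (insert i I)
  have "p (f i \<oplus>\<^bsub>T\<^esub> tsum I f) \<le> p (f i) + p (tsum I f)"
    using p insert.prems tsum_stage[OF insert.hyps(1)] by (simp add: cstar_seminorm_def)
  then show ?case using insert by (simp add: tsum_insert)
qed

definition unit_at where "unit_at j i k = T.ev (unit_seq(j := matrix_unit (d j) i k))"

text \<open>The entry of \<open>x\<close> at position \<open>p\<close> of the \<open>j\<close>-th
  factor, as an element over the other factors. Since it is built from products with matrix units
  and a sum, every C*-seminorm on a stage controls it.\<close>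

definition coord where
  "coord j x p = tsum {..<d j} (\<lambda>l. unit_at j l (fst p) \<otimes>\<^bsub>T\<^esub> x \<otimes>\<^bsub>T\<^esub> unit_at j (snd p) l)"

lemma unit_at_in [simp]: "unit_at j i k \<in> carrier T"
  by (simp add: unit_at_def)

lemma unit_at_stage: "j \<in> F \<Longrightarrow> unit_at j i k \<in> stage F"
  unfolding unit_at_def by (rule stage_ev) auto

lemma coord_ev:
  assumes c: "c \<in> S" and p: "p \<in> {..<d j} \<times> {..<d j}"
  shows "coord j (a \<odot>\<^bsub>T\<^esub> T.ev c) p = (a * c j $$ p) \<odot>\<^bsub>T\<^esub> T.ev (c(j := \<one>\<^bsub>C j\<^esub>))"
proof -
  have cj: "c j \<in> carrier_mat (d j) (d j)" using S_closed[OF c, of j] by (simp add: matrix_algebra_def)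
  have tm: "unit_at j l (fst p) \<otimes>\<^bsub>T\<^esub> (a \<odot>\<^bsub>T\<^esub> T.ev c) \<otimes>\<^bsub>T\<^esub> unit_at j (snd p) l =
      (a * c j $$ p) \<odot>\<^bsub>T\<^esub> T.ev (c(j := matrix_unit (d j) l l))" if "l < d j" for l
  proof -
    have "unit_at j l (fst p) \<otimes>\<^bsub>T\<^esub> T.ev c \<otimes>\<^bsub>T\<^esub> unit_at j (snd p) l =
        T.ev (c(j := matrix_unit (d j) l (fst p) \<otimes>\<^bsub>C j\<^esub> c j \<otimes>\<^bsub>C j\<^esub> matrix_unit (d j) (snd p) l))"
      using c by (simp add: unit_at_def ev_mult_upd)
    also have "matrix_unit (d j) l (fst p) \<otimes>\<^bsub>C j\<^esub> c j \<otimes>\<^bsub>C j\<^esub> matrix_unit (d j) (snd p) l =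
        c j $$ p \<odot>\<^bsub>C j\<^esub> matrix_unit (d j) l l"
      using matrix_unit_sandwich[OF cj, of "fst p" "snd p" l] p that by (auto simp: matrix_algebra_def)
    also have "T.ev (c(j := c j $$ p \<odot>\<^bsub>C j\<^esub> matrix_unit (d j) l l)) =
        c j $$ p \<odot>\<^bsub>T\<^esub> T.ev (c(j := matrix_unit (d j) l l))"
      by (rule ev_upd_smult[OF c matrix_unit_in])
    finally show ?thesis
      using c by (simp add: T.smult_mult_left T.smult_mult_right T.smult_smult)
  qed
  \<comment> \<open>The identity matrix is the sum of the diagonal matrix units, so the terms add up
    to a unit in place \<open>j\<close>.\<close>
  have "(\<Sum>l<d j. \<beta> (c(j := matrix_unit (d j) l l))) = \<beta> (c(j := \<one>\<^bsub>C j\<^esub>))"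
    if "\<beta> \<in> multilinear_forms UNIV C" for \<beta>
  proof -
    have "\<beta> (c(j := 1\<^sub>m (d j))) =
        (\<Sum>p\<in>{..<d j} \<times> {..<d j}. 1\<^sub>m (d j) $$ p * \<beta> (c(j := matrix_unit (d j) (fst p) (snd p))))"
      by (rule linear_functional_matrix_expand[OF linear_upd[OF that c, of j] one_carrier_mat])
    also have "\<dots> = (\<Sum>i<d j. \<Sum>k<d j. 1\<^sub>m (d j) $$ (i, k) * \<beta> (c(j := matrix_unit (d j) i k)))"
      unfolding sum.cartesian_product by (rule sum.cong) auto
    also have "\<dots> = (\<Sum>i<d j. \<Sum>k<d j. if k = i then \<beta> (c(j := matrix_unit (d j) i i)) else 0)"
      by (intro sum.cong refl) auto
    finally show ?thesis by (simp add: matrix_algebra_def)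
  qed
  then have "(\<Sum>l<d j. ((a * c j $$ p) \<odot>\<^bsub>T\<^esub> T.ev (c(j := matrix_unit (d j) l l))) \<beta>) =
      ((a * c j $$ p) \<odot>\<^bsub>T\<^esub> T.ev (c(j := \<one>\<^bsub>C j\<^esub>))) \<beta>" for \<beta>
    by (simp add: T.smult_T T.ev_def flip: sum_distrib_left)
  then show ?thesis unfolding coord_def tsum_def by (intro ext) (simp add: tm)
qed

lemma coord_add:
  "\<lbrakk>x \<in> carrier T; y \<in> carrier T\<rbrakk> \<Longrightarrow> coord j (x \<oplus>\<^bsub>T\<^esub> y) p = coord j x p \<oplus>\<^bsub>T\<^esub> coord j y p"
  by (simp add: coord_def T.l_distr T.r_distr tsum_add)

lemma coord_zero: "coord j \<zero>\<^bsub>T\<^esub> p = \<zero>\<^bsub>T\<^esub>"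
  by (simp add: coord_def) (simp add: tsum_def T.zero_T)

lemma coord_stage:
  "x \<in> stage (insert j F) \<Longrightarrow> p \<in> {..<d j} \<times> {..<d j} \<Longrightarrow> coord j x p \<in> stage F"
proof (induction rule: stage_induct)
  case (add x y) then show ?case using stage_subset by (simp add: coord_add stage_add)
next
  case (ev a c)
  then show ?case by (subst coord_ev) (auto intro!: stage_smult stage_ev split: if_splits)
qed (simp add: coord_zero stage_zero)

text \<open>An element of the larger stage is regarded as a matrix of size \<open>d j\<close> with
  entries in the stage over \<open>F\<close>, and expanded in matrix units.\<close>

lemma coord_expand:
  "x \<in> stage (insert j F) \<Longrightarrow>
    x = tsum ({..<d j} \<times> {..<d j}) (\<lambda>p. coord j x p \<otimes>\<^bsub>T\<^esub> unit_at j (fst p) (snd p))"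
proof (induction rule: stage_induct)
  case zero
  then show ?case by (simp add: coord_zero) (simp add: tsum_def T.zero_T)
next
  case (add x y)
  let ?P = "{..<d j} \<times> {..<d j}"
  have cl: "coord j x p \<in> carrier T" "coord j y p \<in> carrier T" if "p \<in> ?P" for p
    using coord_stage[OF add.hyps(1) that] coord_stage[OF add.hyps(2) that] stage_subset by auto
  have xy: "x \<in> carrier T" "y \<in> carrier T" using add.hyps stage_subset by auto
  have "tsum ?P (\<lambda>p. coord j (x \<oplus>\<^bsub>T\<^esub> y) p \<otimes>\<^bsub>T\<^esub> unit_at j (fst p) (snd p)) =
      tsum ?P (\<lambda>p. coord j x p \<otimes>\<^bsub>T\<^esub> unit_at j (fst p) (snd p)) \<oplus>\<^bsub>T\<^esub>
      tsum ?P (\<lambda>p. coord j y p \<otimes>\<^bsub>T\<^esub> unit_at j (fst p) (snd p))"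
    unfolding coord_add[OF xy] T.span_l_add tsum_add ..
  then show ?case using add.IH by simp
next
  case (ev a c)
  let ?P = "{..<d j} \<times> {..<d j}"
  have cj: "c j \<in> carrier_mat (d j) (d j)" using S_closed[OF ev(1), of j] by (simp add: matrix_algebra_def)
  have tm: "coord j (a \<odot>\<^bsub>T\<^esub> T.ev c) p \<otimes>\<^bsub>T\<^esub> unit_at j (fst p) (snd p) =
      (a * c j $$ p) \<odot>\<^bsub>T\<^esub> T.ev (c(j := matrix_unit (d j) (fst p) (snd p)))" if "p \<in> ?P" for p
    using ev(1) that by (simp add: coord_ev T.smult_mult_left unit_at_def ev_mult_upd)
  have "(a \<odot>\<^bsub>T\<^esub> T.ev c) \<beta> =
      (\<Sum>p\<in>?P. ((a * c j $$ p) \<odot>\<^bsub>T\<^esub> T.ev (c(j := matrix_unit (d j) (fst p) (snd p)))) \<beta>)" for \<beta>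
    using linear_functional_matrix_expand[OF linear_upd[OF _ ev(1), of \<beta> j] cj]
    by (auto simp: T.smult_T T.ev_def sum_distrib_left mult.assoc)
  then show ?case unfolding tsum_def by (intro ext) (simp add: tm)
qed

text \<open>One factor is split off at a time. The coordinates of \<open>x\<close> lie in the
  smaller stage, where \<open>p\<close> is dominated by \<open>q\<close>, and their
  \<open>q\<close>-values are at most a multiple of \<open>q x\<close> because they arise by
  multiplication with matrix units; \<open>p x\<close> is then estimated through the expansion in
  coordinates. The empty stage consists of scalars, where \<open>q \<one> \<noteq> 0\<close> is
  decisive.\<close>

lemma stage_seminorm_dominated:
  assumes "finite F" "cstar_seminorm (T\<lparr>carrier := stage F\<rparr>) p"
    "cstar_seminorm (T\<lparr>carrier := stage F\<rparr>) q" "q \<one>\<^bsub>T\<^esub> \<noteq> 0"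
  shows "\<exists>K\<ge>0. \<forall>x\<in>stage F. p x \<le> K * q x"
  using assms
proof (induction F rule: finite_induct)
  case empty
  have sc: "\<exists>a. x = a \<odot>\<^bsub>T\<^esub> \<one>\<^bsub>T\<^esub>" if "x \<in> stage {}" for x
    using that
  proof (induction rule: stage_induct)
    case zero then show ?case by (intro exI[of _ 0]) simp
  next
    case (add x y) then show ?case by (auto simp flip: T.smult_l_distr)
  next
    case (ev a c)
    then have "c = unit_seq" by auto
    then show ?case using ev_unit by auto
  qed
  have q1: "0 < q \<one>\<^bsub>T\<^esub>" and p1: "0 \<le> p \<one>\<^bsub>T\<^esub>"
    using empty stage_one[of "{}"] by (auto simp: cstar_seminorm_def order_less_le)
  have "p x \<le> p \<one>\<^bsub>T\<^esub> / q \<one>\<^bsub>T\<^esub> * q x" if "x \<in> stage {}" for x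
    using sc[OF that] empty.prems stage_one[of "{}"] q1 by (auto simp: cstar_seminorm_def)
  then show ?case using q1 p1 by (intro exI[of _ "p \<one>\<^bsub>T\<^esub> / q \<one>\<^bsub>T\<^esub>"]) auto
next
  case (insert j F)
  let ?P = "{..<d j} \<times> {..<d j}"
  let ?G = "insert j F"
  note p = insert.prems(1) and q = insert.prems(2)
  have sub: "stage F \<subseteq> carrier (T\<lparr>carrier := stage ?G\<rparr>)" using stage_mono[of _ F ?G] by auto
  have "cstar_seminorm (T\<lparr>carrier := stage F\<rparr>) p" "cstar_seminorm (T\<lparr>carrier := stage F\<rparr>) q"
    using cstar_seminorm_subset[OF p sub] cstar_seminorm_subset[OF q sub] by simp_all
  from insert.IH[OF this insert.prems(3)]
  obtain K where K: "0 \<le> K" "\<And>x. x \<in> stage F \<Longrightarrow> p x \<le> K * q x" by blast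
  have pm: "p (x \<otimes>\<^bsub>T\<^esub> y) \<le> p x * p y" "0 \<le> p x" and qm: "q (x \<otimes>\<^bsub>T\<^esub> y) \<le> q x * q y" "0 \<le> q x"
    if "x \<in> stage ?G" "y \<in> stage ?G" for x y
    using p q that by (auto simp: cstar_seminorm_def)
  \<comment> \<open>\<open>?L r\<close> bounds the coordinate map \<open>r\<close> with respect to
    \<open>q\<close>; \<open>?M\<close> combines these bounds with the constant \<open>K\<close> of
    the smaller stage and the \<open>p\<close>-values of the matrix units.\<close>
  let ?L = "\<lambda>r. \<Sum>l<d j. q (unit_at j l (fst r)) * q (unit_at j (snd r) l)"
  let ?M = "\<Sum>r\<in>?P. K * ?L r * p (unit_at j (fst r) (snd r))"
  have U: "unit_at j i k \<in> stage ?G" for i k by (rule unit_at_stage) simp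
  have pos: "0 \<le> ?L r" for r by (intro sum_nonneg mult_nonneg_nonneg qm(2)[OF U U])
  have "p x \<le> ?M * q x" if x: "x \<in> stage ?G" for x
  proof -
    have co: "coord j x r \<in> stage F" "coord j x r \<in> stage ?G" if "r \<in> ?P" for r
      using coord_stage[OF x that] stage_mono[of _ F ?G] by auto
    have co_q: "q (coord j x r) \<le> ?L r * q x" for r
    proof -
      have "q (coord j x r) \<le> (\<Sum>l<d j. q (unit_at j l (fst r) \<otimes>\<^bsub>T\<^esub> x \<otimes>\<^bsub>T\<^esub> unit_at j (snd r) l))"
        unfolding coord_def by (rule tsum_seminorm[OF q]) (auto intro!: stage_mult U x)
      also have "\<dots> \<le> (\<Sum>l<d j. q (unit_at j l (fst r)) * q (unit_at j (snd r) l) * q x)"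
      proof (rule sum_mono)
        fix l
        have "q (unit_at j l (fst r) \<otimes>\<^bsub>T\<^esub> x \<otimes>\<^bsub>T\<^esub> unit_at j (snd r) l) \<le>
            q (unit_at j l (fst r) \<otimes>\<^bsub>T\<^esub> x) * q (unit_at j (snd r) l)"
          by (rule qm(1)[OF stage_mult[OF U x] U])
        also have "\<dots> \<le> (q (unit_at j l (fst r)) * q x) * q (unit_at j (snd r) l)"
          by (rule mult_right_mono[OF qm(1)[OF U x] qm(2)[OF U U]])
        finally show "q (unit_at j l (fst r) \<otimes>\<^bsub>T\<^esub> x \<otimes>\<^bsub>T\<^esub> unit_at j (snd r) l) \<le>
            q (unit_at j l (fst r)) * q (unit_at j (snd r) l) * q x" by (simp add: mult_ac)
      qed
      finally show ?thesis by (simp add: sum_distrib_right)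
    qed
    have "p x \<le> (\<Sum>r\<in>?P. p (coord j x r \<otimes>\<^bsub>T\<^esub> unit_at j (fst r) (snd r)))"
      by (subst coord_expand[OF x], rule tsum_seminorm[OF p]) (auto intro!: stage_mult U co)
    also have "\<dots> \<le> (\<Sum>r\<in>?P. K * ?L r * p (unit_at j (fst r) (snd r)) * q x)"
    proof (rule sum_mono)
      fix r assume r: "r \<in> ?P"
      have "p (coord j x r \<otimes>\<^bsub>T\<^esub> unit_at j (fst r) (snd r)) \<le> p (coord j x r) * p (unit_at j (fst r) (snd r))"
        by (rule pm(1)[OF co(2)[OF r] U])
      also have "\<dots> \<le> (K * (?L r * q x)) * p (unit_at j (fst r) (snd r))"
        by (intro mult_right_mono order_trans[OF K(2)[OF co(1)[OF r]]] mult_left_mono co_q K(1) pm(2)[OF U U])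
      finally show "p (coord j x r \<otimes>\<^bsub>T\<^esub> unit_at j (fst r) (snd r)) \<le>
          K * ?L r * p (unit_at j (fst r) (snd r)) * q x" by (simp add: mult_ac)
    qed
    finally show ?thesis by (simp add: sum_distrib_right)
  qed
  moreover have "0 \<le> ?M" by (intro sum_nonneg mult_nonneg_nonneg K pos pm(2)[OF U U])
  ultimately show ?case by blast
qed

text \<open>Each seminorm dominates the other up to a constant, and between C*-seminorms such a
  constant can be replaced by 1.\<close>

lemma stage_seminorm_unique:
  assumes "finite F" "cstar_seminorm (T\<lparr>carrier := stage F\<rparr>) p"
    "cstar_seminorm (T\<lparr>carrier := stage F\<rparr>) q" "p \<one>\<^bsub>T\<^esub> \<noteq> 0" "q \<one>\<^bsub>T\<^esub> \<noteq> 0" "x \<in> stage F"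
  shows "p x = q x"
proof -
  have sa: "star_alg (T\<lparr>carrier := stage F\<rparr>)" by (rule T.star_subalgebra_star_alg[OF stage_subalgebra])
  have le: "p x \<le> q x" if pq: "cstar_seminorm (T\<lparr>carrier := stage F\<rparr>) p"
    "cstar_seminorm (T\<lparr>carrier := stage F\<rparr>) q" "q \<one>\<^bsub>T\<^esub> \<noteq> 0" for p q
  proof -
    obtain K where "\<And>x. x \<in> stage F \<Longrightarrow> p x \<le> K * q x"
      using stage_seminorm_dominated[OF assms(1) pq] by blast
    then show ?thesis
      using star_alg.cstar_seminorm_le_if_dominated[OF sa pq(1,2), of K x] assms(6) by simp
  qed
  show ?thesis by (intro antisym le assms)
qed

subsection \<open>Product states\<close>

abbreviation pstates where
  "pstates \<equiv> {product_inf_functional UNIV C \<phi> | \<phi>. \<phi> \<in> (\<Pi>\<^sub>E j\<in>UNIV. states (C j))}"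

lemma prod_supp_eq:
  assumes "\<And>j. \<phi> j \<one>\<^bsub>C j\<^esub> = (1 :: complex)" "finite F" "supp c \<subseteq> F"
  shows "(\<Prod>j\<in>{j\<in>UNIV. c j \<noteq> \<one>\<^bsub>C j\<^esub>}. \<phi> j (c j)) = (\<Prod>j\<in>F. \<phi> j (c j))"
  by (rule prod.mono_neutral_left) (use assms in auto)

text \<open>The index set of the product depends on the varied coordinate. Over the fixed set
  \<open>insert j (supp c - {j})\<close> only the factor \<open>\<phi> j v\<close> depends on
  \<open>v\<close>; the indices added to the support contribute
  \<open>\<phi> i \<one> = 1\<close>.\<close>

lemma product_form:
  assumes lin: "\<And>j. linear_functional (C j) (\<phi> j)" and one: "\<And>j. \<phi> j \<one>\<^bsub>C j\<^esub> = 1"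
  shows "(\<lambda>c. \<Prod>j\<in>{j\<in>UNIV. c j \<noteq> \<one>\<^bsub>C j\<^esub>}. \<phi> j (c j)) \<in> multilinear_forms UNIV C"
  unfolding multilinear_forms_def
proof (intro CollectI ballI)
  fix c j assume c: "c \<in> S"
  let ?F = "supp c - {j}"
  have fin: "finite ?F" using c by (simp add: S_iff)
  have "(\<Prod>i\<in>{i\<in>UNIV. (c(j := v)) i \<noteq> \<one>\<^bsub>C i\<^esub>}. \<phi> i ((c(j := v)) i)) = (\<Prod>i\<in>?F. \<phi> i (c i)) * \<phi> j v" for v
  proof -
    have "(\<Prod>i\<in>{i\<in>UNIV. (c(j := v)) i \<noteq> \<one>\<^bsub>C i\<^esub>}. \<phi> i ((c(j := v)) i)) = (\<Prod>i\<in>insert j ?F. \<phi> i ((c(j := v)) i))"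
      by (rule prod_supp_eq[of \<phi>, OF one]) (use c in \<open>auto simp: S_iff\<close>)
    also have "\<dots> = \<phi> j v * (\<Prod>i\<in>?F. \<phi> i ((c(j := v)) i))"
      by (subst prod.insert[OF fin]) simp_all
    also have "(\<Prod>i\<in>?F. \<phi> i ((c(j := v)) i)) = (\<Prod>i\<in>?F. \<phi> i (c i))" by (intro prod.cong) auto
    finally show ?thesis by (simp add: mult.commute)
  qed
  then show "linear_functional (C j) (\<lambda>v. \<Prod>i\<in>{i\<in>UNIV. (c(j := v)) i \<noteq> \<one>\<^bsub>C i\<^esub>}. \<phi> i ((c(j := v)) i))"
    using linear_functional_scale[OF lin[of j]] by simp
qed

text \<open>Schur products of finitely many kernels: outside the union of the supports of the
  generators involved, all factors are 1.\<close>

lemma product_inf_functional_positive: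
  assumes "\<omega> \<in> pstates" shows "positive_functional T \<omega>"
proof -
  from assms obtain \<phi> where \<phi>: "\<And>j. \<phi> j \<in> states (C j)" and \<omega>: "\<omega> = product_inf_functional UNIV C \<phi>" by auto
  have lin: "linear_functional (C j) (\<phi> j)" and one: "\<phi> j \<one>\<^bsub>C j\<^esub> = 1"
    and pos: "positive_functional (C j) (\<phi> j)" for j
    using \<phi>[of j] by (auto simp: states_def positive_functional_def less_eq_complex_def)
  show ?thesis unfolding \<omega> product_inf_functional_def[abs_def]
  proof (rule T.positive_functional_form[OF product_form[OF lin one]])
    fix n :: nat and v :: "nat \<Rightarrow> 'j \<Rightarrow> complex mat" assume v: "\<And>k. k < n \<Longrightarrow> v k \<in> S"
    let ?F = "\<Union>k<n. supp (v k)"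
    have fin: "finite ?F" using v by (auto simp: S_iff)
    let ?m = "\<lambda>k l. \<lambda>j\<in>UNIV. (\<lambda>j\<in>UNIV. star (C j) (v k j)) j \<otimes>\<^bsub>C j\<^esub> v l j"
    let ?K = "\<lambda>k l. \<Prod>j\<in>?F. \<phi> j (star (C j) (v k j) \<otimes>\<^bsub>C j\<^esub> v l j)"
    have eq: "(\<Prod>j\<in>{j\<in>UNIV. ?m k l j \<noteq> \<one>\<^bsub>C j\<^esub>}. \<phi> j (?m k l j)) = ?K k l" if "k < n" "l < n" for k l
    proof -
      have "supp (?m k l) \<subseteq> ?F"
      proof
        fix j assume j: "j \<in> supp (?m k l)"
        have "v k j \<noteq> \<one>\<^bsub>C j\<^esub> \<or> v l j \<noteq> \<one>\<^bsub>C j\<^esub>"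
        proof (rule ccontr)
          assume "\<not> ?thesis"
          then have "?m k l j = \<one>\<^bsub>C j\<^esub>" by simp
          then show False using j by blast
        qed
        then show "j \<in> ?F" using that by blast
      qed
      from prod_supp_eq[of \<phi>, OF one fin this] show ?thesis by simp
    qed
    have "psd_on {..<n} ?K"
      by (rule psd_on_prod[OF fin]) (intro C.positive_functional_psd[OF pos] S_closed v, simp)
    then show "psd_on {..<n} (\<lambda>k l. \<Prod>j\<in>{j\<in>UNIV. ?m k l j \<noteq> \<one>\<^bsub>C j\<^esub>}. \<phi> j (?m k l j))"
      unfolding psd_on_def
    proof (intro allI impI)
      fix I c assume psd: "\<forall>I c. finite I \<longrightarrow> I \<subseteq> {..<n} \<longrightarrow> 0 \<le> (\<Sum>i\<in>I. \<Sum>j\<in>I. cnj (c i) * c j * ?K i j)"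
        and I: "finite I" "I \<subseteq> {..<n}"
      have "(\<Sum>k\<in>I. \<Sum>l\<in>I. cnj (c k) * c l * (\<Prod>j\<in>{j\<in>UNIV. ?m k l j \<noteq> \<one>\<^bsub>C j\<^esub>}. \<phi> j (?m k l j))) =
          (\<Sum>k\<in>I. \<Sum>l\<in>I. cnj (c k) * c l * ?K k l)"
        by (intro sum.cong refl arg_cong2[of _ _ _ _ times] eq) (use I in auto)
      then show "0 \<le> (\<Sum>k\<in>I. \<Sum>l\<in>I. cnj (c k) * c l * (\<Prod>j\<in>{j\<in>UNIV. ?m k l j \<noteq> \<one>\<^bsub>C j\<^esub>}. \<phi> j (?m k l j)))"
        using psd I by presburger
    qed
  qed
qed

lemma one_bounded: "\<one>\<^bsub>T\<^esub> \<in> T.bounded_elements pstates"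
  by (auto simp: T.bounded_elements_def intro!: exI[of _ 1])

text \<open>Induction on the support, splitting off one coordinate at a time as an image of the
  matrix algebra \<open>C j\<close> under a unital *-homomorphism.\<close>

lemma ev_bounded:
  assumes "finite F" "c \<in> S" "supp c \<subseteq> F" shows "T.ev c \<in> T.bounded_elements pstates"
  using assms
proof (induction F arbitrary: c rule: finite_induct)
  case empty
  then have "c = unit_seq" by auto
  then show ?case using one_bounded by (simp add: ev_unit)
next
  case (insert j F)
  have 1: "T.ev (c(j := \<one>\<^bsub>C j\<^esub>)) \<in> T.bounded_elements pstates"
  proof (rule insert.IH)
    show "c(j := \<one>\<^bsub>C j\<^esub>) \<in> S" by (rule S_upd[OF insert.prems(1) C.one_closed])
    show "supp (c(j := \<one>\<^bsub>C j\<^esub>)) \<subseteq> F" using insert.prems(2) by (auto split: if_splits)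
  qed
  have 2: "T.ev (unit_seq(j := c j)) \<in> T.bounded_elements pstates"
  proof (rule T.bounded_elements_image[where A = "C j"])
    show "T.ev (unit_seq(j := a \<otimes>\<^bsub>C j\<^esub> b)) = T.ev (unit_seq(j := a)) \<otimes>\<^bsub>T\<^esub> T.ev (unit_seq(j := b))"
      if "a \<in> carrier (C j)" "b \<in> carrier (C j)" for a b
      using that ev_mult_upd(1)[of "unit_seq(j := a)" b j] by simp
    show "T.ev (unit_seq(j := star (C j) a)) = star T (T.ev (unit_seq(j := a)))" if "a \<in> carrier (C j)" for a
      using that by (auto simp: T.ev_star restrict_UNIV intro!: arg_cong[of _ _ T.ev])
    have "unit_seq(j := \<one>\<^bsub>C j\<^esub>) = unit_seq" by (rule ext) simp
    then show "T.ev (unit_seq(j := \<one>\<^bsub>C j\<^esub>)) = \<one>\<^bsub>T\<^esub>" by (simp only: ev_unit)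
    show "T.ev (unit_seq(j := a)) \<in> carrier T" if "a \<in> carrier (C j)" for a
      by (rule T.ev_in[OF S_upd[OF unit_seq_in that]])
    show "T.ev (unit_seq(j := a \<oplus>\<^bsub>C j\<^esub> b)) = T.ev (unit_seq(j := a)) \<oplus>\<^bsub>T\<^esub> T.ev (unit_seq(j := b))"
      if "a \<in> carrier (C j)" "b \<in> carrier (C j)" for a b
      by (rule ev_upd_add[OF unit_seq_in that])
    show "T.ev (unit_seq(j := k \<odot>\<^bsub>C j\<^esub> a)) = k \<odot>\<^bsub>T\<^esub> T.ev (unit_seq(j := a))"
      if "a \<in> carrier (C j)" for k a
      by (rule ev_upd_smult[OF unit_seq_in that])
    show "c j \<in> carrier (C j)" by (rule S_closed[OF insert.prems(1)])
  qed (rule product_inf_functional_positive matrix_cstar_algebra, assumption?)+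
  show ?case
    using T.bounded_elements_mult[OF product_inf_functional_positive 1 2] insert.prems
    by (simp flip: ev_split[of c j])
qed

lemma all_bounded: "x \<in> carrier T \<Longrightarrow> x \<in> T.bounded_elements pstates"
proof (induction rule: T.span_induct)
  case zero
  show ?case using T.bounded_elements_smult[OF product_inf_functional_positive one_bounded, of 0] by simp
next
  case (add x y) then show ?case by (intro T.bounded_elements_add[OF product_inf_functional_positive])
next
  case (ev a c)
  then show ?case
    by (intro T.bounded_elements_smult[OF product_inf_functional_positive] ev_bounded[of "supp c"])
      (auto simp: S_iff)
qed

text \<open>The product of the corner states is 1 at the unit, which keeps the norm of the unit away
  from 0.\<close>

lemma stage_min_norm_seminorm:
  "cstar_seminorm (T\<lparr>carrier := stage F\<rparr>) (stage_min_norm UNIV C F)"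
  and stage_min_norm_one: "stage_min_norm UNIV C F \<one>\<^bsub>T\<^esub> \<noteq> 0"
proof -
  have bdd: "\<exists>K. \<forall>\<omega>\<in>pstates. \<forall>y\<in>stage F. gns_seminorm T \<omega> (x \<otimes>\<^bsub>T\<^esub> y) \<le> K * gns_seminorm T \<omega> y"
    if x: "x \<in> stage F" for x
  proof (rule T.bounded_elementsE[OF all_bounded[OF stage_subset[OF x]]])
    fix K assume K: "\<And>\<omega> y. \<lbrakk>\<omega> \<in> pstates; y \<in> carrier T\<rbrakk> \<Longrightarrow>
        gns_seminorm T \<omega> (x \<otimes>\<^bsub>T\<^esub> y) \<le> K * gns_seminorm T \<omega> y"
    show ?thesis by (intro exI[of _ K] ballI K stage_subset)
  qed
  note facts = stage_subalgebra product_inf_functional_positive bdd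
  show "cstar_seminorm (T\<lparr>carrier := stage F\<rparr>) (stage_min_norm UNIV C F)"
    unfolding stage_min_norm_def by (rule T.gns_norm_cstar_seminorm[OF facts])
  define \<phi> where "\<phi> = (\<lambda>j. \<lambda>c\<in>carrier (C j). c $$ (0, 0))"
  have \<phi>: "\<phi> j \<in> states (C j)" for j unfolding \<phi>_def by (rule corner_state[OF d_pos])
  then have \<omega>: "product_inf_functional UNIV C \<phi> \<in> pstates" by auto
  have "product_inf_functional UNIV C \<phi> \<one>\<^bsub>T\<^esub> = 1"
  proof -
    have "(\<lambda>c. \<Prod>j\<in>{j\<in>UNIV. c j \<noteq> \<one>\<^bsub>C j\<^esub>}. \<phi> j (c j)) \<in> multilinear_forms UNIV C"
      by (rule product_form) (use \<phi> in \<open>auto simp: states_def\<close>)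
    then show ?thesis by (simp add: product_inf_functional_def flip: ev_unit)
  qed
  then have "gns_seminorm T (product_inf_functional UNIV C \<phi>) \<one>\<^bsub>T\<^esub> = 1"
    by (simp add: gns_seminorm_def)
  then show "stage_min_norm UNIV C F \<one>\<^bsub>T\<^esub> \<noteq> 0"
    using T.gns_seminorm_le_gns_norm[OF facts stage_one \<omega> stage_one] by (auto simp: stage_min_norm_def)
qed

text \<open>On every finite stage that contains \<open>x\<close> the spatial norm agrees with
  \<open>p\<close>, so the infimum is taken over the singleton of \<open>p x\<close>.\<close>

theorem inf_tensor_norm_eq:
  assumes p: "cstar_seminorm T p" "p \<one>\<^bsub>T\<^esub> \<noteq> 0" and x: "x \<in> carrier T"
  shows "inf_tensor_norm UNIV C x = p x"
proof -
  have "stage_min_norm UNIV C F x = p x" if "finite F" "x \<in> stage F" for F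
  proof -
    have "stage F \<subseteq> carrier T" using stage_subset by (rule subsetI)
    from cstar_seminorm_subset[OF p(1) this] show ?thesis
      by (intro stage_seminorm_unique[of F "stage_min_norm UNIV C F" p x] that stage_min_norm_seminorm
          stage_min_norm_one p(2))
  qed
  then have "(\<lambda>F. stage_min_norm UNIV C F x) ` {F. finite F \<and> F \<subseteq> UNIV \<and> x \<in> stage F} = {p x}"
    using ex_stage[OF x] by auto
  then show ?thesis by (simp add: inf_tensor_norm_def)
qed

end

section \<open>Linear functionals separate points\<close>

definition subspace_of :: "('a, 'm) star_algebra_scheme \<Rightarrow> 'a set \<Rightarrow> bool" where
  "subspace_of T W \<longleftrightarrow> W \<subseteq> carrier T \<and> \<zero>\<^bsub>T\<^esub> \<in> W \<and>
     (\<forall>x\<in>W. \<forall>y\<in>W. x \<oplus>\<^bsub>T\<^esub> y \<in> W) \<and> (\<forall>c. \<forall>x\<in>W. c \<odot>\<^bsub>T\<^esub> x \<in> W)"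

text \<open>Modulo a maximal subspace \<open>M\<close> that avoids \<open>a\<close>, every
  \<open>b\<close> is a multiple \<open>t \<odot> a\<close>; this \<open>t\<close> is the value at
  \<open>b\<close>. Functionals without continuity are the appropriate ones, because the forms
  behind the algebraic tensor products are purely algebraic.\<close>

lemma (in star_alg) linear_functional_separates:
  assumes a: "a \<in> carrier T" "a \<noteq> \<zero>"
  obtains \<phi> where "linear_functional T \<phi>" "\<phi> a \<noteq> 0"
proof -
  let ?WW = "{W. subspace_of T W \<and> a \<notin> W}"
  have "\<exists>M\<in>?WW. \<forall>V\<in>?WW. M \<subseteq> V \<longrightarrow> V = M"
  proof (rule subset_Zorn_nonempty)
    have "{\<zero>} \<in> ?WW" using a by (simp add: subspace_of_def)
    then show "?WW \<noteq> {}" by blast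
    fix CC assume ne: "CC \<noteq> {}" and "subset.chain ?WW CC"
    then have sub: "\<And>W. W \<in> CC \<Longrightarrow> subspace_of T W \<and> a \<notin> W"
      and chain: "\<And>W V. \<lbrakk>W \<in> CC; V \<in> CC\<rbrakk> \<Longrightarrow> W \<subseteq> V \<or> V \<subseteq> W"
      by (auto simp: subset_chain_def)
    have "subspace_of T (\<Union>CC)"
      unfolding subspace_of_def
    proof (intro conjI ballI allI)
      show "\<Union>CC \<subseteq> carrier T"
      proof (rule Union_least)
        show "W \<subseteq> carrier T" if "W \<in> CC" for W using sub[OF that] by (simp add: subspace_of_def)
      qed
      show "\<zero> \<in> \<Union>CC" using ne sub by (auto simp: subspace_of_def)
      fix x assume x: "x \<in> \<Union>CC"
      then obtain W where W: "W \<in> CC" "x \<in> W" by blast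
      have "c \<odot> x \<in> W" for c using W sub[OF W(1)] by (simp add: subspace_of_def)
      then show "c \<odot> x \<in> \<Union>CC" for c using W(1) by (rule UnionI[rotated])
      fix y assume y: "y \<in> \<Union>CC"
      then obtain V where V: "V \<in> CC" "y \<in> V" by blast
      have "(x \<in> V \<and> y \<in> V) \<or> (x \<in> W \<and> y \<in> W)" using chain[OF W(1) V(1)] W V by blast
      then have "x \<oplus> y \<in> V \<or> x \<oplus> y \<in> W" using sub[OF W(1)] sub[OF V(1)] by (auto simp: subspace_of_def)
      then show "x \<oplus> y \<in> \<Union>CC" using W(1) V(1) by blast
    qed
    then show "\<Union>CC \<in> ?WW" using sub by blast
  qed
  then obtain M where M: "subspace_of T M" "a \<notin> M"
    and maximal: "\<And>V. \<lbrakk>subspace_of T V; a \<notin> V; M \<subseteq> V\<rbrakk> \<Longrightarrow> V = M" by blast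
  have Mc: "x \<in> M \<Longrightarrow> x \<in> carrier T" and M0: "\<zero> \<in> M" and Madd: "x \<in> M \<Longrightarrow> y \<in> M \<Longrightarrow> x \<oplus> y \<in> M"
    and Msm: "x \<in> M \<Longrightarrow> c \<odot> x \<in> M" for x y c
    using M(1) by (auto simp: subspace_of_def)
  have ex: "\<exists>t. b \<oplus> (-t) \<odot> a \<in> M" if b: "b \<in> carrier T" for b
  proof (cases "b \<in> M")
    case True then show ?thesis using a b by (intro exI[of _ 0]) simp
  next
    case False
    let ?V = "{m \<oplus> c \<odot> b | m c. m \<in> M}"
    have "subspace_of T ?V"
      unfolding subspace_of_def
    proof (intro conjI ballI allI)
      show "?V \<subseteq> carrier T" using Mc b by auto
      show "\<zero> \<in> ?V" using M0 b by (intro CollectI exI[of _ \<zero>] exI[of _ 0]) simp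
      fix x assume "x \<in> ?V"
      then obtain m c where x: "x = m \<oplus> c \<odot> b" "m \<in> M" by blast
      show "k \<odot> x \<in> ?V" for k
        unfolding x by (intro CollectI exI[of _ "k \<odot> m"] exI[of _ "k * c"])
          (use x Mc b Msm in \<open>simp add: smult_r_distr smult_smult\<close>)
      fix y assume "y \<in> ?V"
      then obtain m' c' where y: "y = m' \<oplus> c' \<odot> b" "m' \<in> M" by blast
      show "x \<oplus> y \<in> ?V"
        unfolding x y by (intro CollectI exI[of _ "m \<oplus> m'"] exI[of _ "c + c'"])
          (use x y Mc b Madd in \<open>simp add: smult_l_distr a_ac\<close>)
    qed
    moreover have "M \<subseteq> ?V"
    proof
      fix m assume "m \<in> M"
      then show "m \<in> ?V" using b Mc by (intro CollectI exI[of _ m] exI[of _ 0]) simp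
    qed
    moreover have "b \<in> ?V" using b M0 by (intro CollectI exI[of _ \<zero>] exI[of _ 1]) simp
    \<comment> \<open>By maximality the span of \<open>M\<close> and \<open>b\<close> contains
      \<open>a\<close>. The coefficient \<open>c\<close> of \<open>b\<close> there is nonzero as
      \<open>a\<close> is not in \<open>M\<close>, and solving for \<open>b\<close> gives
      \<open>t = 1 / c\<close>.\<close>
    ultimately have "a \<in> ?V" using maximal[of ?V] False by blast
    then obtain m c where am: "a = m \<oplus> c \<odot> b" "m \<in> M" by blast
    have c: "c \<noteq> 0" using am M(2) b Mc by auto
    have "b \<oplus> (- (1 / c)) \<odot> a = (b \<oplus> (-1) \<odot> b) \<oplus> (- (1 / c)) \<odot> m"
      unfolding am(1) using am(2) Mc b c by (simp add: smult_r_distr smult_smult a_ac)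
    also have "b \<oplus> (-1) \<odot> b = \<zero>" using b smult_l_distr[of b 1 "-1"] by simp
    finally show ?thesis using Msm[OF am(2)] Mc[OF am(2)] by (intro exI[of _ "1 / c"]) simp
  qed
  have un: "t = t'" if b: "b \<in> carrier T" and t: "b \<oplus> (-t) \<odot> a \<in> M" "b \<oplus> (-t') \<odot> a \<in> M" for b t t'
  proof (rule ccontr)
    assume ne: "t \<noteq> t'"
    have "(b \<oplus> (-t') \<odot> a) \<oplus> (-1) \<odot> (b \<oplus> (-t) \<odot> a) = (b \<oplus> (-1) \<odot> b) \<oplus> ((-t') \<odot> a \<oplus> t \<odot> a)"
      using a b by (simp add: smult_r_distr smult_smult a_ac)
    also have "b \<oplus> (-1) \<odot> b = \<zero>" using b smult_l_distr[of b 1 "-1"] by simp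
    also have "(-t') \<odot> a \<oplus> t \<odot> a = (t - t') \<odot> a" using a by (simp flip: smult_l_distr)
    finally have "(t - t') \<odot> a \<in> M" using Madd[OF t(2) Msm[OF t(1), of "-1"]] a by simp
    from Msm[OF this, of "1 / (t - t')"] show False using ne a M(2) by (simp add: smult_smult)
  qed
  define \<phi> where "\<phi> b = (THE t. b \<oplus> (-t) \<odot> a \<in> M)" for b
  have \<phi>: "b \<oplus> (- \<phi> b) \<odot> a \<in> M" if "b \<in> carrier T" for b
    unfolding \<phi>_def by (rule theI') (use ex[OF that] un[OF that] in blast)
  have \<phi>_eq: "\<phi> b = t" if "b \<in> carrier T" "b \<oplus> (-t) \<odot> a \<in> M" for b t
    using un[OF that(1) \<phi>[OF that(1)] that(2)] .
  have "linear_functional T \<phi>"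
    unfolding linear_functional_def
  proof (intro conjI ballI allI)
    fix x y assume xy: "x \<in> carrier T" "y \<in> carrier T"
    have "(x \<oplus> y) \<oplus> (- (\<phi> x + \<phi> y)) \<odot> a = (x \<oplus> (- \<phi> x) \<odot> a) \<oplus> (y \<oplus> (- \<phi> y) \<odot> a)"
      using smult_l_distr[OF a(1), of "- \<phi> x" "- \<phi> y"] xy a(1) by (simp add: a_ac)
    then show "\<phi> (x \<oplus> y) = \<phi> x + \<phi> y" using Madd[OF \<phi> \<phi>] xy by (intro \<phi>_eq) auto
  next
    fix c x assume x: "x \<in> carrier T"
    have "c \<odot> x \<oplus> (- (c * \<phi> x)) \<odot> a = c \<odot> (x \<oplus> (- \<phi> x) \<odot> a)"
      using x a by (simp add: smult_r_distr smult_smult)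
    then show "\<phi> (c \<odot> x) = c * \<phi> x" using Msm[OF \<phi>[OF x]] x by (intro \<phi>_eq) auto
  qed
  moreover have "\<phi> a = 1"
  proof (rule \<phi>_eq[OF a(1)])
    have "a \<oplus> (-1) \<odot> a = \<zero>" using a(1) smult_l_distr[of a 1 "-1"] by simp
    then show "a \<oplus> (-1) \<odot> a \<in> M" using M0 by simp
  qed
  ultimately show thesis using that by simp
qed

lemma (in star_alg) linear_functionals_eqI:
  assumes "a \<in> carrier T" "b \<in> carrier T" "\<And>\<phi>. linear_functional T \<phi> \<Longrightarrow> \<phi> a = \<phi> b"
  shows "a = b"
proof (rule ccontr)
  assume "a \<noteq> b"
  then have "a \<ominus> b \<noteq> \<zero>" using minus_eq_zeroD assms by blast
  then obtain \<phi> where \<phi>: "linear_functional T \<phi>" "\<phi> (a \<ominus> b) \<noteq> 0"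
    using linear_functional_separates[of "a \<ominus> b"] assms by auto
  then show False
    using assms by (simp add: minus_eq_smult linear_functional_add linear_functional_smult)
qed

section \<open>Towers of embezzlement isomorphisms\<close>

text \<open>\<open>\<mu> m\<close> stands for the isomorphism of level \<open>m\<close>, seen on
  elementary tensors, which absorbs the coordinate \<open>e m\<close>. Alice and Bob share
  \<open>d\<close> and \<open>e\<close> and differ in the maps.\<close>

locale tensor_tower = matrix_product d for d :: "'j \<Rightarrow> nat" +
  fixes A :: "'a normed_star_algebra" and e :: "nat \<Rightarrow> 'j" and \<mu> :: "nat \<Rightarrow> 'a \<Rightarrow> complex mat \<Rightarrow> 'a"
  assumes A: "cstar_algebra A" and e: "bij e" and \<mu>: "tensor_hom A (C (e m)) A (\<mu> m)"
begin

sublocale A: pre_cstar A by (rule cstar_algebra_imp_pre_cstar[OF A])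

text \<open>The accumulator \<open>a\<close> is the innermost entry: \<open>\<mu> m\<close> acts on
  it first and \<open>\<mu> 0\<close> last. A further level therefore only changes the accumulator,
  and it turns \<open>\<one>\<close> into \<open>\<one>\<close> when its coordinate is a
  unit.\<close>

primrec lam :: "nat \<Rightarrow> 'a \<Rightarrow> ('j \<Rightarrow> complex mat) \<Rightarrow> 'a" where
  "lam 0 a c = a"
| "lam (Suc m) a c = lam m (\<mu> m a (c (e m))) c"

lemmas \<mu>D = tensor_homD[OF \<mu>]

lemma lam_closed: "a \<in> carrier A \<Longrightarrow> (\<And>j. c j \<in> carrier (C j)) \<Longrightarrow> lam m a c \<in> carrier A"
  by (induction m arbitrary: a) (simp_all add: \<mu>D)

lemma lam_add: "\<lbrakk>a \<in> carrier A; a' \<in> carrier A; \<And>j. c j \<in> carrier (C j)\<rbrakk> \<Longrightarrow>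
    lam m (a \<oplus>\<^bsub>A\<^esub> a') c = lam m a c \<oplus>\<^bsub>A\<^esub> lam m a' c"
  by (induction m arbitrary: a a') (simp_all add: \<mu>D)

lemma lam_smult: "\<lbrakk>a \<in> carrier A; \<And>j. c j \<in> carrier (C j)\<rbrakk> \<Longrightarrow>
    lam m (k \<odot>\<^bsub>A\<^esub> a) c = k \<odot>\<^bsub>A\<^esub> lam m a c"
  by (induction m arbitrary: a) (simp_all add: \<mu>D)

lemma lam_mult: "\<lbrakk>a \<in> carrier A; a' \<in> carrier A; \<And>j. c j \<in> carrier (C j); \<And>j. c' j \<in> carrier (C j)\<rbrakk> \<Longrightarrow>
    lam m (a \<otimes>\<^bsub>A\<^esub> a') (\<lambda>j. c j \<otimes>\<^bsub>C j\<^esub> c' j) = lam m a c \<otimes>\<^bsub>A\<^esub> lam m a' c'"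
  by (induction m arbitrary: a a') (simp_all add: \<mu>D)

lemma lam_star: "\<lbrakk>a \<in> carrier A; \<And>j. c j \<in> carrier (C j)\<rbrakk> \<Longrightarrow>
    lam m (star A a) (\<lambda>j. star (C j) (c j)) = star A (lam m a c)"
  by (induction m arbitrary: a) (simp_all add: \<mu>D)

lemma lam_cong: "(\<And>k. k < m \<Longrightarrow> c (e k) = c' (e k)) \<Longrightarrow> lam m a c = lam m a c'"
  by (induction m arbitrary: a) simp_all

lemma lam_upd_ge: "m \<le> k \<Longrightarrow> lam m a (c(e k := v)) = lam m a c"
  by (rule lam_cong) (use inj_eq[OF bij_is_inj[OF e]] in auto)

text \<open>As \<open>e\<close> is injective, the coordinate \<open>e k\<close> is read at level
  \<open>k\<close> only. There linearity is that of \<open>\<mu> k\<close> in its matrix argument,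
  and the levels applied afterwards are linear in the accumulator; levels beyond \<open>k\<close>
  merely provide another accumulator.\<close>

lemma lam_upd_linear:
  assumes "a \<in> carrier A" "\<And>j. c j \<in> carrier (C j)" "k < m" "linear_functional A \<phi>"
  shows "linear_functional (C (e k)) (\<lambda>v. \<phi> (lam m a (c(e k := v))))"
  using assms(1,3)
proof (induction m arbitrary: a)
  case (Suc m)
  show ?case
  proof (cases "k = m")
    case True
    have "(\<lambda>v. \<phi> (lam (Suc m) a (c(e k := v)))) = (\<lambda>v. \<phi> (lam m (\<mu> m a v) c))"
      by (rule ext) (simp only: True lam.simps fun_upd_same lam_upd_ge[OF order_refl])
    moreover have "linear_functional (C (e k)) (\<lambda>v. \<phi> (lam m (\<mu> m a v) c))"
      unfolding True using Suc.prems assms(2) A.linear_functional_add[OF assms(4)] A.linear_functional_smult[OF assms(4)]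
      by (simp add: linear_functional_def \<mu>D lam_add lam_smult lam_closed)
    ultimately show ?thesis by (simp only:)
  next
    case False
    then have "k < m" using Suc.prems by simp
    moreover have "e m \<noteq> e k" using False bij_is_inj[OF e] by (auto simp: inj_def)
    ultimately show ?thesis using Suc.IH[of "\<mu> m a (c (e m))"] Suc.prems assms(2) by (simp add: \<mu>D)
  qed
qed simp

lemma lam_extend:
  assumes "\<And>k. m \<le> k \<Longrightarrow> c (e k) = \<one>\<^bsub>C (e k)\<^esub>" "m \<le> n" shows "lam n \<one>\<^bsub>A\<^esub> c = lam m \<one>\<^bsub>A\<^esub> c"
  using assms(2)
proof (induction n rule: dec_induct)
  case (step n) then show ?case using assms(1)[of n] by (simp add: \<mu>D(1))
qed simp

text \<open>\<open>LEAST\<close> just selects a level beyond the support. Every later level gives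
  the same value, so two arguments can be treated at a common level.\<close>

definition prod_map :: "('j \<Rightarrow> complex mat) \<Rightarrow> 'a" where
  "prod_map c = lam (LEAST m. \<forall>k\<ge>m. c (e k) = \<one>\<^bsub>C (e k)\<^esub>) \<one>\<^bsub>A\<^esub> c"

lemma ex_bound: "c \<in> S \<Longrightarrow> \<exists>m. \<forall>k\<ge>m. c (e k) = \<one>\<^bsub>C (e k)\<^esub>"
proof -
  assume c: "c \<in> S"
  have "finite (e -` supp c)"
    by (rule finite_vimageI[OF _ bij_is_inj[OF e]]) (use c in \<open>simp add: S_iff\<close>)
  then obtain m where "\<forall>k\<in>e -` supp c. k < m" by (auto simp: finite_nat_set_iff_bounded)
  then show ?thesis by (intro exI[of _ m]) force
qed

lemma prod_map_eq:
  assumes "\<forall>k\<ge>m. c (e k) = \<one>\<^bsub>C (e k)\<^esub>" shows "prod_map c = lam m \<one>\<^bsub>A\<^esub> c"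
proof -
  let ?L = "LEAST m. \<forall>k\<ge>m. c (e k) = \<one>\<^bsub>C (e k)\<^esub>"
  let ?P = "\<lambda>m. \<forall>k\<ge>m. c (e k) = \<one>\<^bsub>C (e k)\<^esub>"
  have "?P ?L" by (rule LeastI[of ?P, OF assms])
  then have "c (e k) = \<one>\<^bsub>C (e k)\<^esub>" if "?L \<le> k" for k using that by blast
  moreover have "?L \<le> m" by (rule Least_le[of ?P, OF assms])
  ultimately show ?thesis unfolding prod_map_def by (rule lam_extend[symmetric])
qed

lemma common_bound:
  assumes "c \<in> S" "c' \<in> S"
  obtains m where "\<forall>k\<ge>m. c (e k) = \<one>\<^bsub>C (e k)\<^esub>" "\<forall>k\<ge>m. c' (e k) = \<one>\<^bsub>C (e k)\<^esub>"
proof -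
  obtain m m' where "\<forall>k\<ge>m. c (e k) = \<one>\<^bsub>C (e k)\<^esub>" "\<forall>k\<ge>m'. c' (e k) = \<one>\<^bsub>C (e k)\<^esub>"
    using ex_bound[OF assms(1)] ex_bound[OF assms(2)] by blast
  then show thesis by (intro that[of "max m m'"]) auto
qed

lemma prod_map_closed: "c \<in> S \<Longrightarrow> prod_map c \<in> carrier A"
  unfolding prod_map_def by (rule lam_closed) auto

lemma prod_map_mult:
  assumes c: "c \<in> S" and c': "c' \<in> S"
  shows "prod_map (\<lambda>j\<in>UNIV. c j \<otimes>\<^bsub>C j\<^esub> c' j) = prod_map c \<otimes>\<^bsub>A\<^esub> prod_map c'"
proof -
  obtain m where m: "\<forall>k\<ge>m. c (e k) = \<one>\<^bsub>C (e k)\<^esub>" "\<forall>k\<ge>m. c' (e k) = \<one>\<^bsub>C (e k)\<^esub>"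
    by (rule common_bound[OF c c'])
  then have "\<forall>k\<ge>m. (\<lambda>j\<in>UNIV. c j \<otimes>\<^bsub>C j\<^esub> c' j) (e k) = \<one>\<^bsub>C (e k)\<^esub>" by simp
  from prod_map_eq[OF this] show ?thesis
    unfolding prod_map_eq[OF m(1)] prod_map_eq[OF m(2)] restrict_UNIV
    using lam_mult[of "\<one>\<^bsub>A\<^esub>" "\<one>\<^bsub>A\<^esub>" c c' m] c c' by simp
qed

lemma prod_map_star:
  assumes c: "c \<in> S"
  shows "prod_map (\<lambda>j\<in>UNIV. star (C j) (c j)) = star A (prod_map c)"
proof -
  obtain m where m: "\<forall>k\<ge>m. c (e k) = \<one>\<^bsub>C (e k)\<^esub>" using ex_bound[OF c] by blast
  then have "\<forall>k\<ge>m. (\<lambda>j\<in>UNIV. star (C j) (c j)) (e k) = \<one>\<^bsub>C (e k)\<^esub>" by simp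
  from prod_map_eq[OF this] show ?thesis
    unfolding prod_map_eq[OF m] restrict_UNIV using lam_star[of "\<one>\<^bsub>A\<^esub>" c m] c by simp
qed

lemma prod_map_unit: "prod_map unit_seq = \<one>\<^bsub>A\<^esub>"
  using prod_map_eq[of 0 unit_seq] by simp

lemma prod_map_form:
  assumes \<phi>: "linear_functional A \<phi>"
  shows "(\<lambda>c. \<phi> (prod_map c)) \<in> multilinear_forms UNIV C"
  unfolding multilinear_forms_def
proof (intro CollectI ballI)
  fix c j assume c: "c \<in> S"
  obtain k where j: "j = e k" using e by (metis bij_pointE)
  obtain m where m: "\<forall>i\<ge>m. c (e i) = \<one>\<^bsub>C (e i)\<^esub>" using ex_bound[OF c] by blast
  \<comment> \<open>A single level bounds the support of \<open>c(j := v)\<close> for all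
    \<open>v\<close> at once, so linearity in \<open>v\<close> can be read off from
    \<open>lam\<close>.\<close>
  have "prod_map (c(j := v)) = lam (max m (Suc k)) \<one>\<^bsub>A\<^esub> (c(j := v))" for v
    by (rule prod_map_eq) (use m j inj_eq[OF bij_is_inj[OF e]] in auto)
  then show "linear_functional (C j) (\<lambda>v. \<phi> (prod_map (c(j := v))))"
    using lam_upd_linear[OF _ _ _ \<phi>, of "\<one>\<^bsub>A\<^esub>" c k "max m (Suc k)"] c j by simp
qed

text \<open>Well defined because linear functionals separate the points of \<open>A\<close>.\<close>

definition rep :: "((('j \<Rightarrow> complex mat) \<Rightarrow> complex) \<Rightarrow> complex) \<Rightarrow> 'a" where
  "rep x = (THE a. a \<in> carrier A \<and> (\<forall>\<phi>. linear_functional A \<phi> \<longrightarrow> \<phi> a = x (\<lambda>c. \<phi> (prod_map c))))"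

lemma rep_eqI:
  assumes "a \<in> carrier A" "\<And>\<phi>. linear_functional A \<phi> \<Longrightarrow> \<phi> a = x (\<lambda>c. \<phi> (prod_map c))"
  shows "rep x = a"
  unfolding rep_def
proof (rule the_equality)
  show "a \<in> carrier A \<and> (\<forall>\<phi>. linear_functional A \<phi> \<longrightarrow> \<phi> a = x (\<lambda>c. \<phi> (prod_map c)))"
    using assms by blast
  show "b = a" if "b \<in> carrier A \<and> (\<forall>\<phi>. linear_functional A \<phi> \<longrightarrow> \<phi> b = x (\<lambda>c. \<phi> (prod_map c)))" for b
    using that assms by (intro A.linear_functionals_eqI) auto
qed

text \<open>Existence by induction over the span: an evaluation at \<open>v\<close> is represented
  by \<open>prod_map v\<close>, and representability passes to sums and multiples.\<close>

lemma rep_props: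
  assumes "x \<in> carrier T"
  shows "rep x \<in> carrier A \<and> (\<forall>\<phi>. linear_functional A \<phi> \<longrightarrow> \<phi> (rep x) = x (\<lambda>c. \<phi> (prod_map c)))"
proof -
  have "\<exists>a\<in>carrier A. \<forall>\<phi>. linear_functional A \<phi> \<longrightarrow> \<phi> a = x (\<lambda>c. \<phi> (prod_map c))"
    using assms
  proof (induction rule: T.span_induct)
    case zero
    show ?case by (intro bexI[of _ "\<zero>\<^bsub>A\<^esub>"]) (auto simp: T.zero_T A.linear_functional_zero)
  next
    case (add x y)
    then obtain a b where "a \<in> carrier A" "\<forall>\<phi>. linear_functional A \<phi> \<longrightarrow> \<phi> a = x (\<lambda>c. \<phi> (prod_map c))"
      "b \<in> carrier A" "\<forall>\<phi>. linear_functional A \<phi> \<longrightarrow> \<phi> b = y (\<lambda>c. \<phi> (prod_map c))" by blast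
    then show ?case by (intro bexI[of _ "a \<oplus>\<^bsub>A\<^esub> b"]) (auto simp: T.add_T A.linear_functional_add)
  next
    case (ev k v)
    then show ?case
      by (intro bexI[of _ "k \<odot>\<^bsub>A\<^esub> prod_map v"])
        (auto simp: T.smult_T prod_map_form prod_map_closed A.linear_functional_smult)
  qed
  then obtain a where "a \<in> carrier A" "\<forall>\<phi>. linear_functional A \<phi> \<longrightarrow> \<phi> a = x (\<lambda>c. \<phi> (prod_map c))" by blast
  then show ?thesis using rep_eqI[of a x] by simp
qed

lemma rep_add: "\<lbrakk>x \<in> carrier T; y \<in> carrier T\<rbrakk> \<Longrightarrow> rep (x \<oplus>\<^bsub>T\<^esub> y) = rep x \<oplus>\<^bsub>A\<^esub> rep y"
  using rep_props[of x] rep_props[of y] by (intro rep_eqI) (auto simp: T.add_T A.linear_functional_add)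

lemma rep_smult: "x \<in> carrier T \<Longrightarrow> rep (k \<odot>\<^bsub>T\<^esub> x) = k \<odot>\<^bsub>A\<^esub> rep x"
  using rep_props[of x] by (intro rep_eqI) (auto simp: T.smult_T A.linear_functional_smult)

lemma rep_ev: "c \<in> S \<Longrightarrow> rep (T.ev c) = prod_map c"
  by (rule rep_eqI) (auto simp: prod_map_closed prod_map_form)

lemma rep_zero: "rep \<zero>\<^bsub>T\<^esub> = \<zero>\<^bsub>A\<^esub>"
  by (rule rep_eqI) (auto simp: T.zero_T A.linear_functional_zero)

lemma rep_one: "rep \<one>\<^bsub>T\<^esub> = \<one>\<^bsub>A\<^esub>"
  using rep_ev[of unit_seq] by (simp add: ev_unit prod_map_unit)

lemma rep_hom:
  "x \<in> carrier T \<Longrightarrow> rep x \<in> carrier A"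
  "\<lbrakk>x \<in> carrier T; y \<in> carrier T\<rbrakk> \<Longrightarrow> rep (x \<otimes>\<^bsub>T\<^esub> y) = rep x \<otimes>\<^bsub>A\<^esub> rep y"
  "x \<in> carrier T \<Longrightarrow> rep (star T x) = star A (rep x)"
proof -
  have ev: "rep (T.ev c) \<in> carrier A"
    "rep (T.ev (\<lambda>j\<in>UNIV. c j \<otimes>\<^bsub>C j\<^esub> c' j)) = rep (T.ev c) \<otimes>\<^bsub>A\<^esub> rep (T.ev c')"
    "rep (T.ev (\<lambda>j\<in>UNIV. star (C j) (c j))) = star A (rep (T.ev c))"
    if "c \<in> S" "c' \<in> S" for c c'
    using that T.m_in[OF that] T.st_in[OF that(1)]
    by (simp_all add: rep_ev prod_map_closed prod_map_mult prod_map_star del: T.m_in T.st_in)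
  note hom = T.hom_from_generators[where f = rep, OF A.star_alg_axioms rep_zero]
  show "rep x \<in> carrier A" if "x \<in> carrier T"
    by (rule hom(1); (fact that | (rule rep_add rep_smult ev; assumption)))
  show "rep (x \<otimes>\<^bsub>T\<^esub> y) = rep x \<otimes>\<^bsub>A\<^esub> rep y" if "x \<in> carrier T" "y \<in> carrier T"
    by (rule hom(2); (fact that | (rule rep_add rep_smult ev; assumption)))
  show "rep (star T x) = star A (rep x)" if "x \<in> carrier T"
    by (rule hom(3); (fact that | (rule rep_add rep_smult ev; assumption)))
qed

section \<open>Isometric embedding of the infinite tensor product\<close>

abbreviation N where "N \<equiv> with_norm T (inf_tensor_norm UNIV C)"

context
  assumes nontrivial: "\<one>\<^bsub>A\<^esub> \<noteq> \<zero>\<^bsub>A\<^esub>"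
begin

text \<open>\<open>\<lambda>x. nrm A (rep x)\<close> is a C*-seminorm on \<open>T\<close>, nonzero
  at the unit because \<open>\<one> \<noteq> \<zero>\<close> in \<open>A\<close>. Uniqueness
  identifies it with the inductive limit norm.\<close>

lemma inf_norm_eq: "x \<in> carrier T \<Longrightarrow> inf_tensor_norm UNIV C x = nrm A (rep x)"
proof (rule inf_tensor_norm_eq)
  show "cstar_seminorm T (\<lambda>x. nrm A (rep x))"
    by (rule cstar_seminorm_pullback[OF A.seminorm]) (simp_all add: rep_hom rep_add rep_smult)
  show "nrm A (rep \<one>\<^bsub>T\<^esub>) \<noteq> 0"
    using nontrivial cstar_algebra.norm_definite[OF A A.one_closed] by (auto simp: rep_one)
qed

text \<open>The C*-seminorm laws for \<open>inf_tensor_norm\<close> are inherited from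
  \<open>A\<close> through \<open>inf_norm_eq\<close>.\<close>

lemma N_pre_cstar: "pre_cstar N"
proof (rule with_norm_pre_cstar[OF T.star_alg_axioms])
  have "cstar_seminorm T (\<lambda>x. nrm A (rep x))"
    by (rule cstar_seminorm_pullback[OF A.seminorm]) (simp_all add: rep_hom rep_add rep_smult)
  then show "cstar_seminorm T (inf_tensor_norm UNIV C)"
    by (rule cstar_seminorm_cong[OF _ inf_norm_eq T.star_alg_axioms])
qed

lemma inf_tensor_cstar_algebra: "cstar_algebra (inf_tensor UNIV C)"
  unfolding inf_tensor_def by (rule pre_cstar.completion_cstar_algebra[OF N_pre_cstar])

lemma inf_tensor_embeds:
  obtains \<pi> where "star_mono (inf_tensor UNIV C) A \<pi>"
    "\<And>c. c \<in> S \<Longrightarrow> \<pi> (inf_pure UNIV C c) = prod_map c"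
proof -
  have hom: "star_hom N A rep"
    by (rule star_homI) (simp_all add: rep_hom rep_add rep_smult rep_one)
  have iso: "nrm A (rep x) = nrm N x" if "x \<in> carrier N" for x
    using that by (simp add: inf_norm_eq)
  show thesis
  proof (rule star_hom_extends_to_completion[OF N_pre_cstar A hom])
    show "nrm A (rep x) \<le> nrm N x" if "x \<in> carrier N" for x using iso[OF that] by simp
    fix F assume F: "star_hom (completion N) A F" "\<And>x. x \<in> carrier N \<Longrightarrow> F (to_completion N x) = rep x"
      "(\<And>x. x \<in> carrier N \<Longrightarrow> nrm A (rep x) = nrm N x) \<Longrightarrow> inj_on F (carrier (completion N))"
    show thesis
    proof (rule that[of F])
      show "star_mono (inf_tensor UNIV C) A F"
        using F(1) F(3)[OF iso] by (simp add: star_mono_def inf_tensor_def)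
      show "F (inf_pure UNIV C c) = prod_map c" if "c \<in> S" for c
        using F(2)[of "T.ev c"] that by (simp add: inf_pure_def rep_ev flip: ev_eq_pure)
    qed
  qed
qed

end
end

section \<open>Maximal tensor products of homomorphisms\<close>

text \<open>Pulling forms back along \<open>f\<close> and \<open>g\<close> gives a *-homomorphism
  \<open>F\<close> of algebraic tensor products. The maximal norm of the target composed with
  \<open>F\<close> is a C*-seminorm on the source, hence at most the maximal norm there, so
  \<open>F\<close> is contractive and extends.\<close>

lemma max_tensor_map:
  assumes G: "cstar_algebra G" and H: "cstar_algebra H" and A: "cstar_algebra A" and B: "cstar_algebra B"
    and f: "star_hom G A f" and g: "star_hom H B g"
  obtains \<theta> where "star_hom (max_tensor G H) (max_tensor A B) \<theta>"
    "\<And>a b. \<lbrakk>a \<in> carrier G; b \<in> carrier H\<rbrakk> \<Longrightarrow> \<theta> (max_pure G H a b) = max_pure A B (f a) (g b)"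
    "\<And>x. x \<in> carrier (max_tensor G H) \<Longrightarrow> nrm (max_tensor A B) (\<theta> x) \<le> nrm (max_tensor G H) x"
proof -
  interpret D: cstar_pair G H by (rule cstar_pair.intro[OF G H])
  interpret R: cstar_pair A B by (rule cstar_pair.intro[OF A B])
  note fD = star_homD[OF f] and gD = star_homD[OF g]
  \<comment> \<open>The guard makes \<open>F x\<close> vanish off \<open>bilinear_forms A B\<close>,
    as elements of the target algebra do.\<close>
  define F where "F x = (\<lambda>\<beta>. if \<beta> \<in> bilinear_forms A B then x (\<lambda>a b. \<beta> (f a) (g b)) else 0)"
    for x :: "('a \<Rightarrow> 'b \<Rightarrow> complex) \<Rightarrow> complex"
  have form: "(\<lambda>a b. \<beta> (f a) (g b)) \<in> bilinear_forms G H" if "\<beta> \<in> bilinear_forms A B" for \<beta>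
    using that by (auto simp: bilinear_forms_def linear_functional_def fD gD)
  have F_pure: "F (D.pure a b) = R.pure (f a) (g b)" for a b
    using form by (auto simp: F_def pure_tensor_def)
  have F_add: "F (x \<oplus>\<^bsub>D.T\<^esub> y) = F x \<oplus>\<^bsub>R.T\<^esub> F y" for x y
    by (auto simp: F_def alg_tensor_def)
  have F_smult: "F (k \<odot>\<^bsub>D.T\<^esub> x) = k \<odot>\<^bsub>R.T\<^esub> F x" for k x
    by (auto simp: F_def alg_tensor_def)
  have F_zero: "F \<zero>\<^bsub>D.T\<^esub> = \<zero>\<^bsub>R.T\<^esub>"
    by (auto simp: F_def alg_tensor_def)
  have F_one: "F \<one>\<^bsub>D.T\<^esub> = \<one>\<^bsub>R.T\<^esub>"
    using F_pure[of "\<one>\<^bsub>G\<^esub>" "\<one>\<^bsub>H\<^esub>"] by (simp add: D.pure_one R.pure_one fD gD)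
  have F_ev: "F (D.T.ev c) \<in> carrier R.T"
    "F (D.T.ev ((case c of (a, b) \<Rightarrow> \<lambda>(a', b'). (a \<otimes>\<^bsub>G\<^esub> a', b \<otimes>\<^bsub>H\<^esub> b')) c')) = F (D.T.ev c) \<otimes>\<^bsub>R.T\<^esub> F (D.T.ev c')"
    "F (D.T.ev (case c of (a, b) \<Rightarrow> (star G a, star H b))) = star R.T (F (D.T.ev c))"
    if "c \<in> carrier G \<times> carrier H" "c' \<in> carrier G \<times> carrier H" for c c'
    using that by (auto simp: D.T_ev F_pure fD gD R.pure_mult R.pure_star)
  note F_hom = D.T.hom_from_generators[where f = F, OF R.T.star_alg_axioms F_zero]
  have F_in: "F x \<in> carrier R.T" if "x \<in> carrier D.T" for x
    by (rule F_hom(1); (fact that | rule F_add F_smult | (rule F_ev; assumption)))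
  have F_mult: "F (x \<otimes>\<^bsub>D.T\<^esub> y) = F x \<otimes>\<^bsub>R.T\<^esub> F y" if "x \<in> carrier D.T" "y \<in> carrier D.T" for x y
    by (rule F_hom(2); (fact that | rule F_add F_smult | (rule F_ev; assumption)))
  have F_star: "F (star D.T x) = star R.T (F x)" if "x \<in> carrier D.T" for x
    by (rule F_hom(3); (fact that | rule F_add F_smult | (rule F_ev; assumption)))
  let ?N = "with_norm D.T (max_norm G H)" and ?N' = "with_norm R.T (max_norm A B)"
  interpret N': pre_cstar ?N' by (rule R.max_pre_cstar)
  have contr: "max_norm A B (F x) \<le> max_norm G H x" if "x \<in> carrier D.T" for x
    by (rule D.seminorm_le_max_norm[OF cstar_seminorm_pullback[OF R.max_norm_seminorm] that])
      (simp_all add: F_in F_add F_mult F_smult F_star)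
  note tc = star_homD[OF N'.to_completion_star_hom, simplified]
  have hom: "star_hom ?N (max_tensor A B) (\<lambda>x. to_completion ?N' (F x))"
    unfolding max_tensor_def
    by (rule star_homI) (simp_all add: tc F_in F_add F_mult F_smult F_star F_one)
  show thesis
  proof (rule star_hom_extends_to_completion[OF D.max_pre_cstar R.max_tensor_cstar_algebra hom])
    show "nrm (max_tensor A B) (to_completion ?N' (F x)) \<le> nrm ?N x" if "x \<in> carrier ?N" for x
      using that contr[of x] N'.nrm_to_completion[of "F x"] by (simp add: max_tensor_def F_in)
    fix \<theta> assume \<theta>: "star_hom (completion ?N) (max_tensor A B) \<theta>"
      "\<And>x. x \<in> carrier ?N \<Longrightarrow> \<theta> (to_completion ?N x) = to_completion ?N' (F x)"
      "\<And>U. U \<in> carrier (completion ?N) \<Longrightarrow> nrm (max_tensor A B) (\<theta> U) \<le> nrm (completion ?N) U"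
    show thesis
    proof (rule that[of \<theta>])
      show "star_hom (max_tensor G H) (max_tensor A B) \<theta>" using \<theta>(1) by (simp add: max_tensor_def)
      show "\<theta> (max_pure G H a b) = max_pure A B (f a) (g b)" if "a \<in> carrier G" "b \<in> carrier H" for a b
        using \<theta>(2)[of "D.pure a b"] that by (simp add: max_pure_def F_pure)
      show "nrm (max_tensor A B) (\<theta> x) \<le> nrm (max_tensor G H) x" if "x \<in> carrier (max_tensor G H)" for x
        using \<theta>(3)[of x] that by (simp add: max_tensor_def[of G H])
    qed
  qed
qed

section \<open>The product state\<close>

text \<open>Meant for slices of a state, whose bound is the norm of the fixed factor. Scaling by
  \<open>1 / (1 + M)\<close> rather than \<open>1 / M\<close> covers \<open>M = 0\<close>.\<close>

lemma (in pre_cstar) scaled_functionals_eqI: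
  assumes h: "linear_functional K h" "\<And>U. U \<in> carrier K \<Longrightarrow> cmod (h U) \<le> M * nrm K U"
    and h': "linear_functional K h'" "\<And>U. U \<in> carrier K \<Longrightarrow> cmod (h' U) \<le> M * nrm K U"
    and M: "0 \<le> M" and eq: "\<And>x. x \<in> carrier N \<Longrightarrow> h (to_completion N x) = h' (to_completion N x)"
    and U: "U \<in> carrier K"
  shows "h U = h' U"
proof -
  interpret K: pre_cstar K by (rule completion_pre_cstar)
  let ?c = "complex_of_real (1 / (1 + M))"
  have M1: "0 < 1 + M" using M by simp
  have bound: "cmod (?c * f U) \<le> nrm K U" if "cmod (f U) \<le> M * nrm K U" "U \<in> carrier K" for f U
  proof -
    have "M * nrm K U \<le> (1 + M) * nrm K U" using that(2) by (intro mult_right_mono) auto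
    then have "cmod (f U) / (1 + M) \<le> nrm K U" using that(1) M1 by (simp add: pos_divide_le_eq mult.commute)
    moreover have "cmod ?c = 1 / (1 + M)" unfolding norm_of_real using M1 by simp
    ultimately show ?thesis unfolding norm_mult by simp
  qed
  have "?c * h U = ?c * h' U"
    by (rule bounded_functionals_eqI[OF linear_functional_scale[OF h(1)] _ linear_functional_scale[OF h'(1)]])
      (use bound h(2) h'(2) eq U in auto)
  then show ?thesis using M1 by (simp add: complex_eq_iff)
qed

lemma (in cstar_pair) states_max_tensor_eqI:
  assumes h: "h \<in> states (max_tensor A B)" and h': "h' \<in> states (max_tensor A B)"
    and eq: "\<And>a b. \<lbrakk>a \<in> carrier A; b \<in> carrier B\<rbrakk> \<Longrightarrow> h (max_pure A B a b) = h' (max_pure A B a b)"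
  shows "h = h'"
proof (rule extensionalityI[of _ "carrier (max_tensor A B)"])
  let ?N = "with_norm T (max_norm A B)"
  interpret N: pre_cstar ?N by (rule max_pre_cstar)
  note tc = star_homD[OF N.to_completion_star_hom, simplified]
  have K: "completion ?N = max_tensor A B" by (simp add: max_tensor_def)
  have lin: "linear_functional N.K h" "linear_functional N.K h'"
    and bd: "\<And>U. U \<in> carrier N.K \<Longrightarrow> cmod (h U) \<le> nrm N.K U" "\<And>U. U \<in> carrier N.K \<Longrightarrow> cmod (h' U) \<le> nrm N.K U"
    using h h' by (auto simp: states_def K)
  interpret K: pre_cstar N.K by (rule N.completion_pre_cstar)
  have alg: "h (to_completion ?N x) = h' (to_completion ?N x)" if "x \<in> carrier T" for x
    using that
  proof (induction rule: T_induct)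
    case zero
    have "to_completion ?N \<zero>\<^bsub>T\<^esub> = \<zero>\<^bsub>N.K\<^esub>" by (simp add: to_completion_def N.zero_K)
    then show ?case by (simp add: K.linear_functional_zero[OF lin(1)] K.linear_functional_zero[OF lin(2)])
  next
    case (add x y)
    then show ?case
      by (simp add: tc K.linear_functional_add[OF lin(1)] K.linear_functional_add[OF lin(2)])
  next
    case (pure k a b)
    then show ?case
      using eq[OF pure] by (simp add: tc K.linear_functional_smult[OF lin(1)] K.linear_functional_smult[OF lin(2)] max_pure_def)
  qed
  show "h U = h' U" if "U \<in> carrier (max_tensor A B)" for U
    by (rule N.bounded_functionals_eqI[OF lin(1) bd(1) lin(2) bd(2)]) (use alg that in \<open>simp_all add: K\<close>)
qed (use h h' in \<open>auto simp: states_def\<close>)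

context tensor_tower
begin

context
  assumes nontrivial: "\<one>\<^bsub>A\<^esub> \<noteq> \<zero>\<^bsub>A\<^esub>"
begin

abbreviation G where "G \<equiv> inf_tensor UNIV C"

lemma inf_pure_in: "c \<in> S \<Longrightarrow> inf_pure UNIV C c \<in> carrier G"
  using pre_cstar.to_completion_closed[OF N_pre_cstar[OF nontrivial], of "T.ev c"]
  by (simp add: inf_pure_def inf_tensor_def flip: ev_eq_pure)

lemma functional_on_inf_tensor_eqI:
  assumes h: "linear_functional G h" "\<And>U. U \<in> carrier G \<Longrightarrow> cmod (h U) \<le> M * nrm G U"
    and h': "linear_functional G h'" "\<And>U. U \<in> carrier G \<Longrightarrow> cmod (h' U) \<le> M * nrm G U"
    and M: "0 \<le> M" and eq: "\<And>c. c \<in> S \<Longrightarrow> h (inf_pure UNIV C c) = h' (inf_pure UNIV C c)"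
    and U: "U \<in> carrier G"
  shows "h U = h' U"
proof -
  interpret N: pre_cstar N by (rule N_pre_cstar[OF nontrivial])
  interpret K: pre_cstar N.K by (rule N.completion_pre_cstar)
  note tc = star_homD[OF N.to_completion_star_hom, simplified]
  have G: "G = N.K" by (simp add: inf_tensor_def)
  note lin = h(1)[unfolded G] h'(1)[unfolded G]
  have alg: "h (to_completion N x) = h' (to_completion N x)" if "x \<in> carrier T" for x
    using that
  proof (induction rule: T.span_induct)
    case zero
    have "to_completion N \<zero>\<^bsub>T\<^esub> = \<zero>\<^bsub>N.K\<^esub>" by (simp add: to_completion_def N.zero_K)
    then show ?case by (simp add: K.linear_functional_zero[OF lin(1)] K.linear_functional_zero[OF lin(2)])
  next
    case (add x y)
    then show ?case
      by (simp add: tc K.linear_functional_add[OF lin(1)] K.linear_functional_add[OF lin(2)])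
  next
    case (ev k c)
    then show ?case
      using eq[OF ev] by (simp add: tc K.linear_functional_smult[OF lin(1)] K.linear_functional_smult[OF lin(2)]
          inf_pure_def flip: ev_eq_pure)
  qed
  show ?thesis
    by (rule N.scaled_functionals_eqI[OF lin(1) _ lin(2) _ M]) (use h(2) h'(2) alg U in \<open>simp_all add: G\<close>)
qed

text \<open>The uniqueness half of the definite description \<open>product_state\<close>. Equality
  spreads one slot at a time: with an elementary tensor in the second slot, by density in the first;
  then, with an arbitrary first slot, by density in the second.\<close>

lemma states_inf_tensor_eqI:
  assumes h: "h \<in> states (max_tensor G G)" and h': "h' \<in> states (max_tensor G G)"
    and eq: "\<And>c c'. \<lbrakk>c \<in> S; c' \<in> S\<rbrakk> \<Longrightarrow>
      h (max_pure G G (inf_pure UNIV C c) (inf_pure UNIV C c')) = h' (max_pure G G (inf_pure UNIV C c) (inf_pure UNIV C c'))"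
  shows "h = h'"
proof -
  note G = inf_tensor_cstar_algebra[OF nontrivial]
  interpret P: cstar_pair G G by (rule cstar_pair.intro[OF G G])
  note mp = tensor_homD[OF P.max_pure_tensor_hom]
  have lin: "linear_functional G (\<lambda>a. f (max_pure G G a b))" "linear_functional G (\<lambda>a. f (max_pure G G b a))"
    if "f \<in> states (max_tensor G G)" "b \<in> carrier G" for f b
    using that by (auto simp: states_def linear_functional_def mp)
  have bd: "cmod (f (max_pure G G a b)) \<le> nrm G b * nrm G a" "cmod (f (max_pure G G b a)) \<le> nrm G b * nrm G a"
    if "f \<in> states (max_tensor G G)" "a \<in> carrier G" "b \<in> carrier G" for f a b
  proof -
    have le: "cmod (f (max_pure G G u v)) \<le> nrm G u * nrm G v" if "u \<in> carrier G" "v \<in> carrier G" for u v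
      using P.nrm_max_pure_le[OF that] \<open>f \<in> states (max_tensor G G)\<close> mp(2)[OF that]
      by (auto simp: states_def intro: order_trans)
    show "cmod (f (max_pure G G a b)) \<le> nrm G b * nrm G a" "cmod (f (max_pure G G b a)) \<le> nrm G b * nrm G a"
      using le[of a b] le[of b a] that by (simp_all add: mult.commute)
  qed
  have half: "h (max_pure G G a (inf_pure UNIV C c)) = h' (max_pure G G a (inf_pure UNIV C c))"
    if "a \<in> carrier G" "c \<in> S" for a c
  proof -
    have pc: "inf_pure UNIV C c \<in> carrier G" by (rule inf_pure_in[OF that(2)])
    show ?thesis
      by (rule functional_on_inf_tensor_eqI[OF lin(1)[OF h pc] bd(1)[OF h _ pc] lin(1)[OF h' pc] bd(1)[OF h' _ pc]
            P.A.p_nonneg[OF pc] eq[OF _ that(2)] that(1)])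
  qed
  show ?thesis
  proof (rule P.states_max_tensor_eqI[OF h h'])
    fix a b assume a: "a \<in> carrier G" and b: "b \<in> carrier G"
    show "h (max_pure G G a b) = h' (max_pure G G a b)"
      by (rule functional_on_inf_tensor_eqI[OF lin(2)[OF h a] bd(2)[OF h _ a] lin(2)[OF h' a] bd(2)[OF h' _ a]
            P.A.p_nonneg[OF a] half[OF a] b])
  qed
qed

end
end

section \<open>Restriction of the catalyst state to the towers\<close>

lemma states_pullback:
  fixes \<theta> :: "'a \<Rightarrow> 'b"
  assumes R: "star_alg R" and \<theta>: "star_hom R R' \<theta>" and contr: "\<And>x. x \<in> carrier R \<Longrightarrow> nrm R' (\<theta> x) \<le> nrm R x"
    and s: "s \<in> states R'"
  shows "(\<lambda>x\<in>carrier R. s (\<theta> x)) \<in> states R"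
proof -
  interpret star_alg R by (rule R)
  note h = star_homD[OF \<theta>]
  have s': "linear_functional R' s" "\<And>x. x \<in> carrier R' \<Longrightarrow> Im (s (star R' x \<otimes>\<^bsub>R'\<^esub> x)) = 0"
    "\<And>x. x \<in> carrier R' \<Longrightarrow> 0 \<le> Re (s (star R' x \<otimes>\<^bsub>R'\<^esub> x))" "s \<one>\<^bsub>R'\<^esub> = 1"
    "\<And>x. x \<in> carrier R' \<Longrightarrow> cmod (s x) \<le> nrm R' x"
    using s by (auto simp: states_def)
  \<comment> \<open>Contractivity of \<open>\<theta>\<close> supplies the norm bound that is part of
    \<open>states\<close>.\<close>
  have "cmod (s (\<theta> x)) \<le> nrm R x" if "x \<in> carrier R" for x
    using s'(5)[OF h(1)[OF that]] contr[OF that] by simp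
  then show ?thesis
    using s'(1-4) by (simp add: states_def linear_functional_def h)
qed

locale embezzling_towers =
  TA: tensor_tower d A e \<mu> + TB: tensor_tower d B e \<nu>
  for d :: "'j \<Rightarrow> nat" and A :: "'a normed_star_algebra" and B :: "'b normed_star_algebra"
    and e :: "nat \<Rightarrow> 'j" and \<mu> \<nu> +
  fixes s :: "('a, 'b) tensor \<Rightarrow> complex" and g :: "'j \<Rightarrow> (complex mat, complex mat) tensor \<Rightarrow> complex"
  assumes s: "s \<in> states (max_tensor A B)"
    and embezzle: "\<lbrakk>a \<in> carrier A; b \<in> carrier B; c \<in> carrier (matrix_algebra (d (e m)));
      c' \<in> carrier (matrix_algebra (d (e m)))\<rbrakk> \<Longrightarrow>
      s (max_pure A B (\<mu> m a c) (\<nu> m b c')) =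
      s (max_pure A B a b) * g (e m) (max_pure (matrix_algebra (d (e m))) (matrix_algebra (d (e m))) c c')"
begin

sublocale AB: cstar_pair A B by (rule cstar_pair.intro[OF TA.A TB.A])

abbreviation C where "C \<equiv> (\<lambda>j. matrix_algebra (d j))"

lemma s_one: "s (max_pure A B \<one>\<^bsub>A\<^esub> \<one>\<^bsub>B\<^esub>) = 1"
  using s tensor_homD(1)[OF AB.max_pure_tensor_hom] by (simp add: states_def)

text \<open>\<open>s\<close> is 1 at the unit of the tensor product and 0 at an elementary tensor
  with a zero factor.\<close>

lemma nontrivial: "\<one>\<^bsub>A\<^esub> \<noteq> \<zero>\<^bsub>A\<^esub>" "\<one>\<^bsub>B\<^esub> \<noteq> \<zero>\<^bsub>B\<^esub>"
proof -
  note mp = tensor_homD[OF AB.max_pure_tensor_hom]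
  have zero: "s x = 0" if "x = 0 \<odot>\<^bsub>max_tensor A B\<^esub> x" "x \<in> carrier (max_tensor A B)" for x
  proof -
    have "s (0 \<odot>\<^bsub>max_tensor A B\<^esub> x) = 0" using s that(2) by (simp add: states_def linear_functional_def)
    then show ?thesis by (subst that(1))
  qed
  have "s (max_pure A B \<zero>\<^bsub>A\<^esub> \<one>\<^bsub>B\<^esub>) = 0" "s (max_pure A B \<one>\<^bsub>A\<^esub> \<zero>\<^bsub>B\<^esub>) = 0"
    using mp(4)[of "\<zero>\<^bsub>A\<^esub>" "\<one>\<^bsub>B\<^esub>" 0] mp(5)[of "\<one>\<^bsub>A\<^esub>" "\<zero>\<^bsub>B\<^esub>" 0] by (auto intro!: zero mp(2))
  then show "\<one>\<^bsub>A\<^esub> \<noteq> \<zero>\<^bsub>A\<^esub>" "\<one>\<^bsub>B\<^esub> \<noteq> \<zero>\<^bsub>B\<^esub>" using s_one by auto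
qed

text \<open>The induction generalises the accumulators: the hypothesis is applied to those produced
  by \<open>\<mu> m\<close> and \<open>\<nu> m\<close>, and embezzlement at level \<open>m\<close>
  splits off the remaining factor.\<close>

lemma s_lam:
  assumes "a \<in> carrier A" "b \<in> carrier B" "\<And>j. c j \<in> carrier (C j)" "\<And>j. c' j \<in> carrier (C j)"
  shows "s (max_pure A B (TA.lam m a c) (TB.lam m b c')) =
    s (max_pure A B a b) * (\<Prod>k<m. g (e k) (max_pure (C (e k)) (C (e k)) (c (e k)) (c' (e k))))"
  using assms(1,2)
proof (induction m arbitrary: a b)
  case (Suc m)
  then show ?case
    using embezzle[of a b "c (e m)" m "c' (e m)"] assms(3,4) by (simp add: TA.\<mu>D TB.\<mu>D mult_ac)
qed simp

text \<open>Embezzlement with units in all four places, where \<open>\<mu> m\<close> and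
  \<open>\<nu> m\<close> return units and \<open>s\<close> is 1.\<close>

lemma g_one: "g j (max_pure (C j) (C j) \<one>\<^bsub>C j\<^esub> \<one>\<^bsub>C j\<^esub>) = 1"
proof -
  obtain m where j: "j = e m" using TA.e by (metis bij_pointE)
  show ?thesis
    using embezzle[of "\<one>\<^bsub>A\<^esub>" "\<one>\<^bsub>B\<^esub>" "\<one>\<^bsub>C j\<^esub>" m "\<one>\<^bsub>C j\<^esub>"] s_one by (simp add: j TA.\<mu>D(1) TB.\<mu>D(1))
qed

lemma s_prod_map:
  assumes c: "c \<in> TA.S" and c': "c' \<in> TA.S"
  shows "s (max_pure A B (TA.prod_map c) (TB.prod_map c')) =
    (\<Prod>j\<in>{j\<in>UNIV. c j \<noteq> \<one>\<^bsub>C j\<^esub> \<or> c' j \<noteq> \<one>\<^bsub>C j\<^esub>}. g j (max_pure (C j) (C j) (c j) (c' j)))"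
proof -
  let ?g = "\<lambda>j. g j (max_pure (C j) (C j) (c j) (c' j))"
  obtain m where m: "\<forall>k\<ge>m. c (e k) = \<one>\<^bsub>C (e k)\<^esub>" "\<forall>k\<ge>m. c' (e k) = \<one>\<^bsub>C (e k)\<^esub>"
    by (rule TA.common_bound[OF c c'])
  have "s (max_pure A B (TA.prod_map c) (TB.prod_map c')) = (\<Prod>k<m. ?g (e k))"
    unfolding TA.prod_map_eq[OF m(1)] TB.prod_map_eq[OF m(2)]
    using s_lam[of "\<one>\<^bsub>A\<^esub>" "\<one>\<^bsub>B\<^esub>" c c' m] TA.S_closed[OF c] TA.S_closed[OF c'] s_one by simp
  also have "\<dots> = (\<Prod>j\<in>e ` {..<m}. ?g j)"
    using inj_on_subset[OF bij_is_inj[OF TA.e], of "{..<m}"] by (simp add: prod.reindex)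
  \<comment> \<open>Levels at which both coordinates are units contribute factors 1 by
    \<open>g_one\<close>, so the product shrinks to the joint support that appears in
    \<open>product_state\<close>.\<close>
  also have "\<dots> = (\<Prod>j\<in>{j\<in>UNIV. c j \<noteq> \<one>\<^bsub>C j\<^esub> \<or> c' j \<noteq> \<one>\<^bsub>C j\<^esub>}. ?g j)"
  proof (rule prod.mono_neutral_right)
    show "{j\<in>UNIV. c j \<noteq> \<one>\<^bsub>C j\<^esub> \<or> c' j \<noteq> \<one>\<^bsub>C j\<^esub>} \<subseteq> e ` {..<m}"
    proof
      fix j assume j: "j \<in> {j\<in>UNIV. c j \<noteq> \<one>\<^bsub>C j\<^esub> \<or> c' j \<noteq> \<one>\<^bsub>C j\<^esub>}"
      obtain k where k: "j = e k" using TA.e by (metis bij_pointE)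
      have "\<not> m \<le> k" using j m k by auto
      then show "j \<in> e ` {..<m}" using k by simp
    qed
    show "\<forall>j\<in>e ` {..<m} - {j\<in>UNIV. c j \<noteq> \<one>\<^bsub>C j\<^esub> \<or> c' j \<noteq> \<one>\<^bsub>C j\<^esub>}. ?g j = 1"
      using g_one by auto
  qed simp
  finally show ?thesis .
qed

theorem locally_contains_product_state:
  "locally_contains A B s (inf_tensor UNIV C) (inf_tensor UNIV C) (product_state UNIV C C g)"
proof -
  let ?G = "inf_tensor UNIV C"
  note G = TA.inf_tensor_cstar_algebra[OF nontrivial(1)]
  interpret GG: cstar_pair ?G ?G by (rule cstar_pair.intro[OF G G])
  obtain \<pi>\<^sub>A where \<pi>A: "star_mono ?G A \<pi>\<^sub>A" "\<And>c. c \<in> TA.S \<Longrightarrow> \<pi>\<^sub>A (inf_pure UNIV C c) = TA.prod_map c"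
    by (rule TA.inf_tensor_embeds[OF nontrivial(1)]) blast
  obtain \<pi>\<^sub>B where \<pi>B: "star_mono ?G B \<pi>\<^sub>B" "\<And>c. c \<in> TA.S \<Longrightarrow> \<pi>\<^sub>B (inf_pure UNIV C c) = TB.prod_map c"
    by (rule TB.inf_tensor_embeds[OF nontrivial(2)]) blast
  have homs: "star_hom ?G A \<pi>\<^sub>A" "star_hom ?G B \<pi>\<^sub>B" using \<pi>A(1) \<pi>B(1) by (simp_all add: star_mono_def)
  obtain \<theta> where \<theta>: "star_hom (max_tensor ?G ?G) (max_tensor A B) \<theta>"
      "\<And>a b. \<lbrakk>a \<in> carrier ?G; b \<in> carrier ?G\<rbrakk> \<Longrightarrow> \<theta> (max_pure ?G ?G a b) = max_pure A B (\<pi>\<^sub>A a) (\<pi>\<^sub>B b)"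
      "\<And>x. x \<in> carrier (max_tensor ?G ?G) \<Longrightarrow> nrm (max_tensor A B) (\<theta> x) \<le> nrm (max_tensor ?G ?G) x"
    by (rule max_tensor_map[OF G G TA.A TB.A homs]) blast
  \<comment> \<open>States are extensional, hence the restriction to the carrier.\<close>
  define h where "h = (\<lambda>x\<in>carrier (max_tensor ?G ?G). s (\<theta> x))"
  have h: "h \<in> states (max_tensor ?G ?G)"
    unfolding h_def
    by (rule states_pullback[OF cstar_algebra_imp_star_alg[OF GG.max_tensor_cstar_algebra] \<theta>(1,3) s])
  have h_pure: "h (max_pure ?G ?G (inf_pure UNIV C c) (inf_pure UNIV C c')) =
      (\<Prod>j\<in>{j\<in>UNIV. c j \<noteq> \<one>\<^bsub>C j\<^esub> \<or> c' j \<noteq> \<one>\<^bsub>C j\<^esub>}. g j (max_pure (C j) (C j) (c j) (c' j)))"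
    if "c \<in> TA.S" "c' \<in> TA.S" for c c'
    using that TA.inf_pure_in[OF nontrivial(1)] tensor_homD(2)[OF GG.max_pure_tensor_hom]
    by (simp add: h_def \<theta>(2) \<pi>A(2) \<pi>B(2) s_prod_map)
  \<comment> \<open>\<open>h\<close> witnesses existence in the definite description; agreement on
    elementary tensors gives uniqueness.\<close>
  have "product_state UNIV C C g = h"
    unfolding product_state_def
  proof (rule the_equality)
    show "f = h" if "f \<in> states (max_tensor ?G ?G) \<and> (\<forall>c\<in>TA.S. \<forall>c'\<in>TA.S.
        f (max_pure ?G ?G (inf_pure UNIV C c) (inf_pure UNIV C c')) =
        (\<Prod>j\<in>{j\<in>UNIV. c j \<noteq> \<one>\<^bsub>C j\<^esub> \<or> c' j \<noteq> \<one>\<^bsub>C j\<^esub>}. g j (max_pure (C j) (C j) (c j) (c' j))))" for f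
      by (rule TA.states_inf_tensor_eqI[OF nontrivial(1)]) (use that h h_pure in simp_all)
  qed (use h h_pure in blast)
  then show ?thesis
    unfolding locally_contains_def
    by (intro conjI exI[of _ \<pi>\<^sub>A] exI[of _ \<pi>\<^sub>B] exI[of _ \<theta>] ballI s \<pi>A(1) \<pi>B(1) \<theta>(1,2))
      (simp_all add: h, simp add: h_def)
qed

end

section \<open>From embezzlement to towers\<close>

lemma star_iso_tensor_hom:
  assumes "cstar_algebra R" "star_iso (min_tensor R (matrix_algebra n)) R \<Phi>"
  shows "tensor_hom R (matrix_algebra n) R (\<lambda>a c. \<Phi> (min_pure R (matrix_algebra n) a c))"
  by (rule tensor_hom_comp[OF cstar_pair.min_pure_tensor_hom[OF cstar_pair.intro[OF assms(1) matrix_cstar_algebra]]])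
    (use assms(2) in \<open>simp add: star_iso_def\<close>)

theorem proposition4:
  fixes A :: "'a normed_star_algebra" and B :: "'b normed_star_algebra"
    and s :: "('a, 'b) tensor \<Rightarrow> complex" and \<psi> :: "nat \<Rightarrow> rat list"
  assumes "cstar_algebra A" and "cstar_algebra B"
    and "s \<in> states (max_tensor A B)"
    and "\<forall>xs\<in>rational_schmidt_lists.
      embezzles A B s (matrix_algebra (length xs)) (matrix_algebra (length xs)) (schmidt_state xs)"
    and "range \<psi> = rational_schmidt_lists"
  shows "locally_contains A B s
    (inf_tensor UNIV (schmidt_factors \<psi>)) (inf_tensor UNIV (schmidt_factors \<psi>))
    (product_state UNIV (schmidt_factors \<psi>) (schmidt_factors \<psi>) (\<lambda>(i, k). schmidt_state (\<psi> i)))"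
proof -
  define d where "d = (\<lambda>j::nat \<times> nat. length (\<psi> (fst j)))"
  define g where "g = (\<lambda>j::nat \<times> nat. schmidt_state (\<psi> (fst j)))"
  have \<psi>: "\<psi> i \<in> rational_schmidt_lists" for i using assms(5) by blast
  have C: "schmidt_factors \<psi> = (\<lambda>j. matrix_algebra (d j))" and g: "(\<lambda>(i, k). schmidt_state (\<psi> i)) = g"
    by (auto simp: schmidt_factors_def d_def g_def)
  \<comment> \<open>Stated for all \<open>j\<close> at once, so that the isomorphisms can be chosen
    as functions of \<open>j\<close>.\<close>
  have "\<forall>j. embezzles A B s (matrix_algebra (d j)) (matrix_algebra (d j)) (g j)"
    using assms(4) \<psi> by (simp add: d_def g_def)
  then obtain \<Phi>\<^sub>A \<Phi>\<^sub>B where \<Phi>: "\<And>j. star_iso (min_tensor A (matrix_algebra (d j))) A (\<Phi>\<^sub>A j)"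
      "\<And>j. star_iso (min_tensor B (matrix_algebra (d j))) B (\<Phi>\<^sub>B j)"
      "\<And>j a b c c'. \<lbrakk>a \<in> carrier A; b \<in> carrier B; c \<in> carrier (matrix_algebra (d j)); c' \<in> carrier (matrix_algebra (d j))\<rbrakk> \<Longrightarrow>
        s (max_pure A B (\<Phi>\<^sub>A j (min_pure A (matrix_algebra (d j)) a c)) (\<Phi>\<^sub>B j (min_pure B (matrix_algebra (d j)) b c'))) =
        s (max_pure A B a b) * g j (max_pure (matrix_algebra (d j)) (matrix_algebra (d j)) c c')"
    unfolding embezzles_def by metis
  have d_pos: "0 < d j" for j using \<psi>[of "fst j"] by (simp add: d_def rational_schmidt_lists_def)
  \<comment> \<open>\<open>prod_decode\<close> enumerates the pairs \<open>(i, k)\<close>, so each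
    state is embezzled at infinitely many levels.\<close>
  interpret embezzling_towers d A B prod_decode
    "\<lambda>m a c. \<Phi>\<^sub>A (prod_decode m) (min_pure A (matrix_algebra (d (prod_decode m))) a c)"
    "\<lambda>m b c. \<Phi>\<^sub>B (prod_decode m) (min_pure B (matrix_algebra (d (prod_decode m))) b c)" s g
    by (intro embezzling_towers.intro tensor_tower.intro matrix_product.intro tensor_tower_axioms.intro
        embezzling_towers_axioms.intro d_pos bij_prod_decode assms(1-3) star_iso_tensor_hom \<Phi>)
  show ?thesis unfolding C g by (rule locally_contains_product_state)
qed

end
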